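(* The open set $\hat\Omega_{ext}$ is homeomorphic to $\mathbb{C}\smallsetminus\overline{\mathbb{D}}$. Therefore $\hat{\mathcal{M}}_3(\theta)$, and hence $\mathcal{M}_3(\theta)$, is connected.
   Context: Fix an irrational number $0<\theta<1$ of Brjuno type, i.e. $\sum_{n\ge1}(\log q_{n+1})/q_n<\infty$, where $p_n/q_n$ are the continued fraction convergents of $\theta$; let $\lambda=e^{2\pi i\theta}$. For $c\in\mathbb{C}^*=\mathbb{C}\smallsetminus\{0\}$ let $$P_c(z)=\lambda z\left(1-\tfrac12\left(1+\tfrac1c\right)z+\tfrac{1}{3c}z^2\right),$$ a cubic polynomial with critical points $c$ and $1$ and with a Siegel disk of rotation number $\theta$ centered at the fixed point $0$. The cubic connectedness locus is $\mathcal{M}_3(\theta)=\{c\in\mathbb{C}^*: J(P_c)\text{ is connected}\}$, where $J(P_c)$ is the Julia set; it is a compact subset of $\mathbb{C}^*$ and $\mathbb{C}^*\smallsetminus\mathcal{M}_3(\theta)$ has two connected components, the unbounded one $\Omega_{ext}$ and its image $\Omega_{int}$ under $c\mapsto1/c$. Let $\hat{\mathcal{M}}_3(\theta)=\{s\in\mathbb{C}^*: s^2\in\mathcal{M}_3(\theta)\}$. Its complement in $\mathbb{C}^*$ has two connected components $\hat\Omega_{ext}=\{s: s^2\in\Omega_{ext}\}$ (the unbounded one) and $\hat\Omega_{int}=\{s:s^2\in\Omega_{int}\}$. $\mathbb{D}$ is the open unit disk. *)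

theory Defs
  imports "HOL-Analysis.Analysis"
begin

section \<open>Continued fractions and the Brjuno condition\<close>

text \<open>
  Complete quotients of the regular continued fraction
  \<open>x = a\<^sub>0 + 1/(a\<^sub>1 + 1/(a\<^sub>2 + \<dots>))\<close>. For irrational \<open>x\<close> no division by zero occurs.
\<close>
primrec complete_quotient :: "real \<Rightarrow> nat \<Rightarrow> real" where
  "complete_quotient x 0 = x"
| "complete_quotient x (Suc n) = 1 / frac (complete_quotient x n)"

definition partial_quotient :: "real \<Rightarrow> nat \<Rightarrow> int" where
  "partial_quotient x n = \<lfloor>complete_quotient x n\<rfloor>"

text \<open>The denominators \<open>q\<^sub>n\<close> of the convergents \<open>p\<^sub>n/q\<^sub>n = [a\<^sub>0; a\<^sub>1, \<dots>, a\<^sub>n]\<close>.\<close>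
fun convergent_denom :: "real \<Rightarrow> nat \<Rightarrow> int" where
  "convergent_denom x 0 = 1"
| "convergent_denom x (Suc 0) = partial_quotient x 1"
| "convergent_denom x (Suc (Suc n)) =
     partial_quotient x (Suc (Suc n)) * convergent_denom x (Suc n) + convergent_denom x n"

text \<open>
  The series \<open>\<Sum>\<^bsub>n\<ge>1\<^esub> ln q\<^bsub>n+1\<^esub> / q\<^sub>n\<close>, shifted to start at index 0.
\<close>
definition brjuno :: "real \<Rightarrow> bool" where
  "brjuno x \<longleftrightarrow> x \<notin> \<rat> \<and>
     summable (\<lambda>n. ln (real_of_int (convergent_denom x (n + 2))) /
                   real_of_int (convergent_denom x (n + 1)))"

section \<open>Julia sets\<close>

text \<open>
  Normality with respect to the Riemann sphere: every sequence in the family has a subsequence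
  converging locally uniformly in the spherical metric. The sphere is avoided by listing the two
  kinds of limit: a locally uniform limit in the plane, or locally uniform divergence to infinity.
  On a connected open set these are the only spherical limits of holomorphic functions (Hurwitz).
\<close>
definition normal_family_on :: "complex set \<Rightarrow> (complex \<Rightarrow> complex) set \<Rightarrow> bool" where
  "normal_family_on U F \<longleftrightarrow>
     (\<forall>\<sigma> :: nat \<Rightarrow> complex \<Rightarrow> complex. range \<sigma> \<subseteq> F \<longrightarrow>
        (\<exists>r :: nat \<Rightarrow> nat. strict_mono r \<and>
           ((\<exists>g. \<forall>K. compact K \<and> K \<subseteq> U \<longrightarrow> uniform_limit K (\<sigma> \<circ> r) g sequentially) \<or>
            (\<forall>K. compact K \<and> K \<subseteq> U \<longrightarrow>
               (\<forall>B::real. \<forall>\<^sub>F n in sequentially. \<forall>z\<in>K. norm (\<sigma> (r n) z) \<ge> B)))))"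

text \<open>
  The part of the Fatou set lying in the plane. For a polynomial of degree at least 2 the point at
  infinity is a superattracting fixed point, so the whole Julia set lies in the plane.
\<close>
definition fatou_set :: "(complex \<Rightarrow> complex) \<Rightarrow> complex set" where
  "fatou_set f =
     {z. \<exists>U. open U \<and> connected U \<and> z \<in> U \<and> normal_family_on U (range (\<lambda>n. f ^^ n))}"

definition julia_set :: "(complex \<Rightarrow> complex) \<Rightarrow> complex set" where
  "julia_set f = - fatou_set f"

section \<open>The cubic family and its connectedness locus\<close>

definition siegel_cubic :: "real \<Rightarrow> complex \<Rightarrow> complex \<Rightarrow> complex" where
  "siegel_cubic \<theta> c z =
     exp (2 * of_real pi * \<i> * of_real \<theta>) * z *
       (1 - 1 / 2 * (1 + 1 / c) * z + 1 / (3 * c) * z\<^sup>2)"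

definition conn_locus :: "real \<Rightarrow> complex set" where
  "conn_locus \<theta> = {c. c \<noteq> 0 \<and> connected (julia_set (siegel_cubic \<theta> c))}"

text \<open>
  The unbounded component of \<open>\<complex>\<^sup>* - conn_locus \<theta>\<close>: by definition, \<open>outside S\<close> is the union of the
  unbounded components of the complement of \<open>S\<close>. The locus is compact, and for bounded \<open>S\<close> in the
  plane there is exactly one such component, see \<open>Omega_ext_unique\<close>.
\<close>
definition Omega_ext :: "real \<Rightarrow> complex set" where
  "Omega_ext \<theta> = outside (insert 0 (conn_locus \<theta>))"

definition conn_locus_hat :: "real \<Rightarrow> complex set" where
  "conn_locus_hat \<theta> = {s. s \<noteq> 0 \<and> s\<^sup>2 \<in> conn_locus \<theta>}"

definition Omega_ext_hat :: "real \<Rightarrow> complex set" where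
  "Omega_ext_hat \<theta> = {s. s\<^sup>2 \<in> Omega_ext \<theta>}"

lemma Omega_ext_unique:
  assumes "bounded (conn_locus \<theta>)"
  shows "U \<in> components (- {0} - conn_locus \<theta>) \<and> \<not> bounded U \<longleftrightarrow> U = Omega_ext \<theta>"
proof -
  let ?S = "insert 0 (conn_locus \<theta>)"
  have b: "bounded ?S" using assms by simp
  have eq: "- {0} - conn_locus \<theta> = - ?S" by auto
  have conn: "connected (outside ?S)" by (rule connected_outside[OF b]) simp
  have "outside ?S \<in> components (- ?S)"
    using conn outside_bounded_nonempty[OF b] by (simp add: outside_in_components)
  moreover have "\<not> bounded (outside ?S)" by (rule unbounded_outside[OF b])
  moreover have "V = W" if "V \<in> components (- ?S)" "\<not> bounded V"
      "W \<in> components (- ?S)" "\<not> bounded W" for V W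
    by (rule cobounded_unique_unbounded_components[OF _ that(3,4,1,2)]) (use b in simp_all)
  ultimately show ?thesis unfolding eq Omega_ext_def by blast
qed

end

theory Submission
  imports Defs "HOL-Complex_Analysis.Complex_Analysis"
begin

text \<open>
  Write \<open>c = s^2\<close> and normalise \<open>P_c\<close> to a monic cubic \<open>cub s\<close> with critical points \<open>\<mu> s\<close> and
  \<open>\<mu> / s\<close>, where \<open>3 \<mu>^2 = \<lambda>\<close>; then \<open>cub (1 / s) = cub s\<close>. The Julia set is connected
  exactly if both critical orbits are bounded (\<open>connected_julia_iff\<close>, \<open>connected_filled_iff\<close>). They
  cannot both escape, because the fixed point \<open>0\<close> has a multiplier of modulus one
  (\<open>critical_point_bounded_of_indifferent\<close>, an application of the Schwarz lemma). Hence the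
  complement of the lifted locus consists of the set \<open>E\<close> of parameters for which \<open>\<mu> s\<close> escapes, its
  reciprocal, and \<open>0\<close>.

  The main point is that \<open>E\<close> together with infinity is simply connected. As for the Mandelbrot set,
  this follows from a proper map of degree one on \<open>E\<close>, the Boettcher coordinate of
  the cocritical point. Instead of the limit map the proof uses its approximations. The \<open>n\<close>-th point
  \<open>h n s\<close> of the critical orbit is a polynomial of degree \<open>3^n\<close> in \<open>s\<close>, and the sets
  \<open>{|h n| > 20}\<close> exhaust \<open>E\<close>. A proper holomorphic map to a disc with a single simple zero is
  bijective (\<open>proper_simple_zero_bij\<close>), so such a set is a punctured disc as soon as \<open>h n\<close> has a
  continuous root of order \<open>3^n\<close> on it (\<open>simply_connected_outer_chart_of_root\<close>).

  The root comes from the dynamical plane. For fixed \<open>s\<close> in this set the \<open>n\<close>-th iterate has no critical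
  values of modulus above \<open>|h n s|\<close>. Sublevel sets of a holomorphic function do not split between critical
  values (\<open>sublevel_connected_descend\<close>), so the sublevel sets above this level are connected and
  the iterate has a root of order \<open>3^n\<close> outside them (\<open>superlevel_root_exists\<close>). The cocritical
  point lies on the boundary of this region, is mapped to \<open>h n s\<close> and is not critical. The value of the root
  extends to it and depends continuously on \<open>s\<close> (\<open>boundary_root_continuous\<close>).

  The Riemann mapping theorem now gives the homeomorphism. Simply connected plane sets have
  connected complements on the sphere, so the complements of \<open>E\<close> and of its reciprocal with
  \<open>0\<close> are connected. They cover the plane, and since the plane is unicoherent, their intersection,
  the lifted locus, is connected. Squaring maps it onto the locus.
\<close>

section \<open>Sublevel sets of a holomorphic function\<close>

lemma connected_component_closure_subset:
  fixes S :: "'a::real_normed_vector set"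
  assumes "open S" "z \<in> closure (connected_component_set S a)" "z \<in> S"
  shows "z \<in> connected_component_set S a"
proof -
  have "open (connected_component_set S z)" by (simp add: open_connected_component assms)
  moreover have "z \<in> connected_component_set S z" using assms by simp
  ultimately have "connected_component_set S z \<inter> connected_component_set S a \<noteq> {}"
    using assms(2) by (metis disjoint_iff open_Int_closure_eq_empty)
  then show ?thesis by (metis connected_component_nonoverlap connected_component_refl assms(3) mem_Collect_eq)
qed

text \<open>
Otherwise \<open>1 / F\<close> would contradict the maximum principle: on the boundary of the component
\<open>|F|\<close> is constantly \<open>t\<close>, inside it is smaller. Compactness keeps the boundary inside \<open>W\<close>.
\<close>
lemma sublevel_component_has_zero:
  fixes F :: "complex \<Rightarrow> complex"
  assumes W: "open W" "F holomorphic_on W"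
    and comp: "compact {z \<in> W. norm (F z) \<le> t}"
    and V: "V \<in> components {z \<in> W. norm (F z) < t}"
  obtains z where "z \<in> V" "F z = 0"
proof -
  let ?S = "{z \<in> W. norm (F z) < t}" and ?C = "{z \<in> W. norm (F z) \<le> t}"
  have contF: "continuous_on W F" using W holomorphic_on_imp_continuous_on by blast
  have "?S = W \<inter> F -` ball 0 t" by auto
  then have openS: "open ?S" using contF W by (metis continuous_on_open_vimage open_ball Int_commute)
  have VS: "V \<subseteq> ?S" using V in_components_subset by blast
  have openV: "open V" using V openS open_components by blast
  have clV: "closure V \<subseteq> ?C" using VS comp by (intro closure_minimal) (auto intro: compact_imp_closed)
  obtain x where x: "x \<in> V" using V in_components_nonempty by blast
  then have t: "t > 0" using VS by (auto intro: le_less_trans[OF norm_ge_zero])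
  have fr: "norm (F z) = t" if "z \<in> frontier V" for z
  proof -
    have "z \<in> ?C" using that clV by (auto simp: frontier_def)
    moreover have "z \<in> frontier ?S" using that V frontier_of_components_subset by blast
    then have "z \<notin> ?S" using openS by (simp add: frontier_def interior_open)
    ultimately show ?thesis by auto
  qed
  have "\<exists>z\<in>V. F z = 0"
  proof (rule ccontr)
    assume "\<not> ?thesis"
    then have nz: "F z \<noteq> 0" if "z \<in> closure V" for z
      using that fr t openV by (force simp: frontier_def interior_open)
    have sub: "closure V \<subseteq> W" using clV by auto
    have "norm (inverse (F x)) \<le> inverse t"
    proof (rule maximum_modulus_frontier[where S = V and \<xi> = x and f = "\<lambda>z. inverse (F z)"])
      show "(\<lambda>z. inverse (F z)) holomorphic_on interior V"
        using nz sub closure_subset[of V] by (intro holomorphic_on_inverse holomorphic_on_subset[OF W(2)]) (auto simp: interior_open[OF openV])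
      show "continuous_on (closure V) (\<lambda>z. inverse (F z))"
        using nz sub by (intro continuous_intros continuous_on_subset[OF contF]) auto
      show "bounded V" by (rule bounded_subset[OF compact_imp_bounded[OF comp]]) (use VS less_imp_le in blast)
    qed (use fr x in \<open>auto simp: norm_inverse\<close>)
    moreover have "norm (F x) < t" "0 < norm (F x)" using x VS nz[of x] closure_subset by auto
    ultimately show False using t by (simp add: norm_inverse)
  qed
  then show ?thesis using that by blast
qed

lemma sublevel_connectedI:
  fixes F :: "complex \<Rightarrow> complex"
  assumes W: "open W" "F holomorphic_on W"
    and comp: "compact {z \<in> W. norm (F z) \<le> t}"
    and zeros: "\<And>a b. \<lbrakk>a \<in> W; F a = 0; b \<in> W; F b = 0\<rbrakk> \<Longrightarrow> connected_component {z \<in> W. norm (F z) < t} a b"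
  shows "connected {z \<in> W. norm (F z) < t}"
proof -
  let ?S = "{z \<in> W. norm (F z) < t}"
  have *: "\<exists>a. a \<in> W \<and> F a = 0 \<and> connected_component ?S x a" if x: "x \<in> ?S" for x
  proof -
    obtain a where "a \<in> connected_component_set ?S x" "F a = 0"
      using sublevel_component_has_zero[OF W comp componentsI[OF x]] by blast
    then show ?thesis using connected_component_subset by blast
  qed
  show ?thesis
    unfolding connected_iff_connected_component
    using * zeros by (meson connected_component_sym connected_component_trans)
qed

text \<open>
Sublevel sets can only split when the level passes a critical value. Every component contains a
zero, so it is enough to keep two zeros \<open>a\<close>, \<open>b\<close> in one component. Let \<open>t0\<close> be the
infimum of the levels at which they are joined. A path joining them at level \<open>t0\<close> already lies
below a smaller level, so \<open>t0\<close> itself is not such a level unless it is the target \<open>t\<close>. On the other hand a nested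
intersection of continua joins \<open>a\<close> and \<open>b\<close> in the closed sublevel set at \<open>t0\<close>, and since the function
is locally invertible on the level curve, the open sublevel set is a connected half-disc near each
boundary point; hence the continuum never leaves the closure of a single open component.
\<close>
theorem sublevel_connected_descend:
  fixes F :: "complex \<Rightarrow> complex"
  assumes W: "open W" "F holomorphic_on W"
    and comp: "\<And>t. t < t1 \<Longrightarrow> compact {z \<in> W. norm (F z) \<le> t}"
    and conn: "connected {z \<in> W. norm (F z) < t1}"
    and crit: "\<And>z. \<lbrakk>z \<in> W; r < norm (F z); norm (F z) < t1\<rbrakk> \<Longrightarrow> deriv F z \<noteq> 0"
    and t: "0 \<le> r" "r < t" "t \<le> t1"
  shows "connected {z \<in> W. norm (F z) < t}"
proof (cases "t = t1")
  case False
  define S where "S \<tau> = {z \<in> W. norm (F z) < \<tau>}" for \<tau>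
  define C where "C \<tau> = {z \<in> W. norm (F z) \<le> \<tau>}" for \<tau>
  have contF: "continuous_on W F" using W holomorphic_on_imp_continuous_on by blast
  have "S \<tau> = W \<inter> F -` ball 0 \<tau>" for \<tau> by (auto simp: S_def)
  then have openS: "open (S \<tau>)" for \<tau> using contF W by (metis continuous_on_open_vimage open_ball Int_commute)
  have joined: "connected_component (S t) a b" if a: "a \<in> W" "F a = 0" and b: "b \<in> W" "F b = 0" for a b
  proof (rule ccontr)
    assume nt: "\<not> connected_component (S t) a b"
    define J where "J = {\<tau>. t \<le> \<tau> \<and> \<tau> \<le> t1 \<and> connected_component (S \<tau>) a b}"
    have abS: "a \<in> S \<tau>" "b \<in> S \<tau>" if "\<tau> > 0" for \<tau> using a b that by (auto simp: S_def)
    have "connected_component (S t1) a b"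
      using conn abS t by (metis S_def connected_iff_connected_component le_less_trans less_le_trans)
    then have t1J: "t1 \<in> J" using t by (simp add: J_def)
    have bdd: "bdd_below J" by (auto simp: J_def intro!: bdd_belowI)
    define t0 where "t0 = Inf J"
    have t0: "t \<le> t0" "t0 \<le> t1"
      using t1J bdd by (auto simp: t0_def J_def intro!: cInf_greatest cInf_lower)
    have t0pos: "t0 > 0" using t0 t by linarith
    have above: "connected_component (S \<tau>) a b" if \<tau>: "t0 < \<tau>" for \<tau>
    proof -
      obtain \<sigma> where "\<sigma> \<in> J" "\<sigma> < \<tau>" using \<tau> t1J cInf_lessD[of J \<tau>] by (auto simp: t0_def)
      then have "S \<sigma> \<subseteq> S \<tau>" "connected_component (S \<sigma>) a b" by (auto simp: S_def J_def)
      then show ?thesis by (metis connected_component_of_subset)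
    qed
    have at0: "connected_component (S t0) a b"
    proof (cases "t0 = t1")
      case True then show ?thesis using t1J by (simp add: J_def)
    next
      case False
      then have lt: "t0 < t1" using t0 by simp
      define \<tau> where "\<tau> n = t0 + (t1 - t0) / (real n + 2)" for n
      have \<tau>: "t0 < \<tau> n" "\<tau> n < t1" for n
      proof -
        show "t0 < \<tau> n" using lt by (simp add: \<tau>_def)
        have "(t1 - t0) / (real n + 2) < (t1 - t0) / 1" using lt by (intro divide_strict_left_mono) auto
        then show "\<tau> n < t1" by (simp add: \<tau>_def)
      qed
      have \<tau>mono: "\<tau> n \<le> \<tau> m" if "m \<le> n" for m n
        using that lt by (auto simp: \<tau>_def intro!: divide_left_mono)
      have \<tau>lim: "\<tau> \<longlonglongrightarrow> t0"
        unfolding \<tau>_def by real_asymp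
      define K where "K n = connected_component_set (C (\<tau> n)) a" for n
      have aC: "a \<in> C (\<tau> n)" for n using a \<tau>(1)[of n] t0pos by (simp add: C_def)
      have compC: "compact (C (\<tau> n))" for n using comp \<tau> by (simp add: C_def)
      have "connected (\<Inter>(range K))"
      proof (rule connected_nest)
        show "compact (K n)" for n using compC[of n] closed_connected_component[of "C (\<tau> n)" a] connected_component_subset[of "C (\<tau> n)" a]
          unfolding K_def by (metis compact_Int_closed compact_imp_closed inf.absorb_iff2 )
        show "connected (K n)" for n by (simp add: K_def)
        show "K n \<subseteq> K m" if "m \<le> n" for m n
          unfolding K_def using \<tau>mono[OF that] by (intro connected_component_mono) (auto simp: C_def)
      qed
      \<comment> \<open>A continuum at the critical level t0 that contains both zeros.\<close>
      define Q where "Q = \<Inter>(range K)"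
      have connQ: "connected Q" by (simp add: Q_def \<open>connected (\<Inter>(range K))\<close>)
      have aQ: "a \<in> Q" using aC by (auto simp: Q_def K_def)
      have bQ: "b \<in> Q"
      proof -
        have "S (\<tau> n) \<subseteq> C (\<tau> n)" for n by (auto simp: S_def C_def)
        then have "connected_component (C (\<tau> n)) a b" for n
          using above[OF \<tau>(1)] by (metis connected_component_of_subset)
        then show ?thesis by (simp add: Q_def K_def)
      qed
      have QC: "Q \<subseteq> C t0"
      proof
        fix x assume "x \<in> Q"
        then have "x \<in> C (\<tau> n)" for n using connected_component_subset by (fastforce simp: Q_def K_def)
        then have "x \<in> W" "\<And>n. norm (F x) \<le> \<tau> n" by (auto simp: C_def)
        then show "x \<in> C t0" using LIMSEQ_le_const[OF \<tau>lim, of "norm (F x)"] by (auto simp: C_def)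
      qed
      define V where "V = connected_component_set (S t0) a"
      have VS: "V \<subseteq> S t0" by (simp add: V_def connected_component_subset)
      have aV: "a \<in> V" using abS t0pos by (simp add: V_def)
      have Vmax: "P \<subseteq> V" if P: "connected P" "P \<subseteq> S t0" "P \<inter> V \<noteq> {}" for P
      proof -
        obtain x where x: "x \<in> P" "x \<in> V" using P by auto
        have "P \<subseteq> connected_component_set (S t0) x" using P x by (simp add: connected_component_maximal)
        moreover have "connected_component_set (S t0) x = V"
          using x unfolding V_def by (metis connected_component_eq)
        ultimately show ?thesis by simp
      qed
      have VmaxS: "z \<in> V" if "z \<in> closure V" "z \<in> S t0" for z
        using connected_component_closure_subset[OF openS] that by (simp add: V_def)
      have "\<exists>U. open U \<and> z \<in> U \<and> U \<inter> Q \<subseteq> closure V" if z: "z \<in> Q" "z \<in> closure V" for z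
      proof (cases "norm (F z) < t0")
        case True
        then have "z \<in> S t0" using z QC by (auto simp: S_def C_def)
        then have "z \<in> V" using VmaxS z by simp
        moreover have "open V" by (simp add: V_def open_connected_component openS)
        ultimately show ?thesis using closure_subset by blast
      next
        case False
        then have Fz: "norm (F z) = t0" "z \<in> W" using z QC by (auto simp: C_def)
        then have "deriv F z \<noteq> 0" using crit t t0 lt by auto
        then obtain \<rho> where \<rho>: "\<rho> > 0" "ball z \<rho> \<subseteq> W" "open (F ` ball z \<rho>)" "inj_on F (ball z \<rho>)"
          using has_complex_derivative_locally_invertible[OF W(2) Fz(2) W(1)] by metis
        have holb: "F holomorphic_on ball z \<rho>" using W \<rho> holomorphic_on_subset by blast
        obtain g where g: "g holomorphic_on (F ` ball z \<rho>)" "\<And>x. x \<in> ball z \<rho> \<Longrightarrow> g (F x) = x"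
          using holomorphic_has_inverse[OF holb open_ball \<rho>(4)] by metis
        have contg: "continuous_on (F ` ball z \<rho>) g" using g holomorphic_on_imp_continuous_on by blast
        obtain \<epsilon> where \<epsilon>: "\<epsilon> > 0" "ball (F z) \<epsilon> \<subseteq> F ` ball z \<rho>"
          using \<rho> by (metis centre_in_ball imageI open_contains_ball)
        define B where "B = ball (F z) \<epsilon> \<inter> ball 0 t0"
        \<comment> \<open>The half-disc: the image under the local inverse of a convex set.\<close>
        define P where "P = g ` B"
        define U where "U = ball z \<rho> \<inter> F -` ball (F z) \<epsilon>"
        have BF: "B \<subseteq> F ` ball z \<rho>" using \<epsilon> by (auto simp: B_def)
        have "connected P" unfolding P_def
          using BF by (intro connected_continuous_image continuous_on_subset[OF contg])
             (auto simp: B_def intro!: convex_connected convex_Int)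
        have openU: "open U" unfolding U_def
          using holb holomorphic_on_imp_continuous_on open_ball
          by (metis continuous_on_open_vimage Int_commute)
        have zU: "z \<in> U" using \<rho> \<epsilon> by (simp add: U_def)
        have PS: "P \<subseteq> S t0"
        proof
          fix x assume "x \<in> P"
          then obtain w where w: "w \<in> B" "x = g w" by (auto simp: P_def)
          then obtain y where "y \<in> ball z \<rho>" "w = F y" using BF by blast
          then show "x \<in> S t0" using w g \<rho> by (auto simp: S_def B_def)
        qed
        have USP: "U \<inter> S t0 \<subseteq> P"
        proof
          fix x assume "x \<in> U \<inter> S t0"
          then have "F x \<in> B" "x = g (F x)" using g by (auto simp: U_def S_def B_def)
          then show "x \<in> P" by (auto simp: P_def)
        qed
        have "U \<inter> V \<noteq> {}" using openU zU z by (meson disjoint_iff open_Int_closure_eq_empty)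
        then have "P \<inter> V \<noteq> {}" using USP VS by blast
        then have PV: "P \<subseteq> V" using Vmax \<open>connected P\<close> PS by blast
        have "y \<in> closure V" if y: "y \<in> U" "y \<in> Q" for y
        proof -
          have "F y \<in> ball (F z) \<epsilon> \<inter> closure (ball 0 t0)"
            using y QC t0pos by (auto simp: U_def C_def)
          then have "F y \<in> closure B"
            using open_Int_closure_subset[of "ball (F z) \<epsilon>" "ball 0 t0"] by (auto simp: B_def)
          then obtain s where s: "\<And>n. s n \<in> B" "s \<longlonglongrightarrow> F y" by (auto simp: closure_sequential)
          have "isCont g (F y)" using contg \<rho> y by (auto simp: U_def continuous_on_eq_continuous_at)
          then have "(\<lambda>n. g (s n)) \<longlonglongrightarrow> g (F y)" using s isCont_tendsto_compose by blast
          moreover have "g (F y) = y" using g y by (auto simp: U_def)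
          moreover have "\<forall>n. g (s n) \<in> P" using s by (simp add: P_def)
          ultimately have "y \<in> closure P" unfolding closure_sequential by (metis (no_types, lifting))
          then show ?thesis using PV closure_mono by blast
        qed
        then show ?thesis using openU zU by blast
      qed
      then have "openin (top_of_set Q) (Q \<inter> closure V)"
        by (subst openin_subopen) (metis (no_types, lifting) Int_iff inf_le2 inf.commute le_inf_iff openin_open_Int inf_le1)
      moreover have "closedin (top_of_set Q) (Q \<inter> closure V)" by (simp add: closedin_closed_Int)
      moreover have "Q \<inter> closure V \<noteq> {}" using aQ aV closure_subset by blast
      ultimately have "Q \<inter> closure V = Q" using connQ by (metis connected_clopen)
      then have "b \<in> V" using bQ VmaxS abS t0pos by auto
      then show ?thesis by (simp add: V_def)
    qed
    \<comment> \<open>The maximum of |F| on a joining path is below t0, which contradicts the choice of t0.\<close>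
    have "path_component (S t0) a b"
      using at0 openS by (simp add: open_path_connected_component path_component_eq_connected_component_set
        open_path_connected_component)
    then obtain \<gamma> where \<gamma>: "path \<gamma>" "path_image \<gamma> \<subseteq> S t0" "pathstart \<gamma> = a" "pathfinish \<gamma> = b"
      by (auto simp: path_component_def)
    have "compact (path_image \<gamma>)" "path_image \<gamma> \<noteq> {}" using \<gamma> by (auto simp: compact_path_image)
    moreover have "continuous_on (path_image \<gamma>) (\<lambda>z. norm (F z))"
      using \<gamma> by (intro continuous_intros continuous_on_subset[OF contF]) (auto simp: S_def)
    ultimately obtain x where x: "x \<in> path_image \<gamma>" "\<And>y. y \<in> path_image \<gamma> \<Longrightarrow> norm (F y) \<le> norm (F x)"
      using continuous_attains_sup by metis
    have xt: "norm (F x) < t0" using x \<gamma> by (auto simp: S_def)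
    have "t0 \<noteq> t" using at0 nt by auto
    then have "t < t0" using t0 by simp
    define \<sigma> where "\<sigma> = max t ((norm (F x) + t0)/2)"
    have \<sigma>: "t \<le> \<sigma>" "\<sigma> < t0" "norm (F x) < \<sigma>" using xt \<open>t < t0\<close> by (auto simp: \<sigma>_def max_def)
    then have "path_image \<gamma> \<subseteq> S \<sigma>" using x \<gamma> by (force simp: S_def)
    then have "connected_component (S \<sigma>) a b"
      using \<gamma> connected_path_image[OF \<gamma>(1)] unfolding connected_component_def
      by (metis pathfinish_in_path_image pathstart_in_path_image)
    then have "\<sigma> \<in> J" using \<sigma> t0 by (simp add: J_def)
    then have "t0 \<le> \<sigma>" using bdd by (simp add: t0_def cInf_lower)
    then show False using \<sigma> by simp
  qed
  have "compact {z \<in> W. norm (F z) \<le> t}" using comp False t by simp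
  from sublevel_connectedI[OF W this] joined show ?thesis by (auto simp: S_def)
qed (use conn in simp)

section \<open>Proper maps to a disc with one simple zero\<close>

lemma roots_of_unity_two:
  assumes "n \<ge> 2" obtains \<zeta> :: complex where "\<zeta> ^ n = 1" "\<zeta> \<noteq> 1"
proof
  have n: "real n * (2 * pi / real n) = 2 * pi" using assms by simp
  have "cis (2 * pi / n) ^ n = cis (2 * pi)" by (simp only: Complex.DeMoivre n)
  then show "cis (2 * pi / n) ^ n = 1" by simp
  show "cis (2 * pi / n) \<noteq> 1"
  proof
    assume "cis (2 * pi / n) = 1"
    then have "cos (2 * pi / n) = 1" by (simp add: complex_eq_iff)
    then obtain k :: int where k: "2 * pi / n = k * (2 * pi)" by (auto simp: cos_one_2pi_int)
    then have "real_of_int k * n = 1" using assms by (simp add: field_simps)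
    then have "k * int n = 1" by (metis of_int_1 of_int_eq_iff of_int_mult of_int_of_nat_eq)
    then show False using assms by (auto simp: zmult_eq_1_iff)
  qed
qed

text \<open>
Near a critical point the map is \<open>G^n\<close> with \<open>G\<close> locally invertible and \<open>n \<ge> 2\<close>; an \<open>n\<close>-th root
\<open>y\<close> of the value and its multiple \<open>\<zeta> y\<close> by a root of unity give two preimages.
\<close>
lemma critical_value_nearby_two_preimages:
  assumes F: "F holomorphic_on D" and D: "open D" "connected D"
    and nc: "\<not> F constant_on D" and u: "u \<in> D" "deriv F u = 0"
  obtains \<delta> where "\<delta> > 0"
    "\<And>v. \<lbrakk>v \<in> ball (F u) \<delta>; v \<noteq> F u\<rbrakk> \<Longrightarrow> \<exists>x\<in>D. \<exists>y\<in>D. x \<noteq> y \<and> F x = v \<and> F y = v"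
proof -
  have "\<exists>n>0. (deriv ^^ n) F u \<noteq> 0"
  proof (rule ccontr)
    assume "\<not> ?thesis"
    then have "F w = F u" if "w \<in> D" for w
      using holomorphic_fun_eq_const_on_connected[OF F D _ u(1) that] by blast
    then show False using nc by (auto simp: constant_on_def)
  qed
  define n where "n = (LEAST n. n > 0 \<and> (deriv ^^ n) F u \<noteq> 0)"
  have n: "n > 0" "(deriv ^^ n) F u \<noteq> 0"
    using LeastI_ex[OF \<open>\<exists>n>0. (deriv ^^ n) F u \<noteq> 0\<close>] by (auto simp: n_def)
  have nmin: "(deriv ^^ i) F u = 0" if "0 < i" "i < n" for i
    using not_less_Least[of i "\<lambda>n. n > 0 \<and> (deriv ^^ n) F u \<noteq> 0"] that by (auto simp: n_def)
  have n2: "n \<ge> 2"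
  proof (rule ccontr)
    assume "\<not> n \<ge> 2"
    then have "n = 1" using n by simp
    then show False using n u by simp
  qed
  obtain g r where gr: "0 < r" "g holomorphic_on ball u r"
      "\<And>w. w \<in> ball u r \<Longrightarrow> F w - F u = ((w - u) * g w) ^ n"
      "\<And>w. w \<in> ball u r \<Longrightarrow> g w \<noteq> 0"
    by (rule holomorphic_factor_order_of_zero_strong[OF F D(1) u(1) n nmin]) (auto intro: that)
  obtain r' where r': "r' > 0" "ball u r' \<subseteq> D" using D u by (meson open_contains_ball)
  define s where "s = min r r'"
  have s: "s > 0" "ball u s \<subseteq> D" "ball u s \<subseteq> ball u r" using gr r' by (auto simp: s_def)
  define G where "G w = (w - u) * g w" for w
  have holG: "G holomorphic_on ball u s"
    unfolding G_def using s gr by (intro holomorphic_intros holomorphic_on_subset[OF gr(2)])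
  have "(g has_field_derivative deriv g u) (at u)"
    using gr s by (intro holomorphic_derivI[of g "ball u r"]) auto
  then have "(G has_field_derivative g u) (at u)"
    unfolding G_def by (auto intro!: derivative_eq_intros)
  then have "deriv G u \<noteq> 0" using gr s by (simp add: DERIV_imp_deriv)
  then obtain q where q: "q > 0" "ball u q \<subseteq> ball u s" "open (G ` ball u q)"
    using has_complex_derivative_locally_invertible[OF holG _ open_ball] s by (metis centre_in_ball)
  have "0 \<in> G ` ball u q" using q by (auto simp: G_def intro!: image_eqI[of _ _ u])
  then obtain d where d: "d > 0" "ball 0 d \<subseteq> G ` ball u q" using q open_contains_ball by metis
  show thesis
  proof
    show "d ^ n > 0" using d by simp
    fix v assume v: "v \<in> ball (F u) (d ^ n)" "v \<noteq> F u"
    obtain y where y: "v - F u = y ^ n" using exists_complex_root n by (metis less_numeral_extra(3))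
    have "norm y ^ n < d ^ n" using v by (simp add: dist_norm norm_minus_commute flip: y norm_power)
    then have yd: "norm y < d" using d by (meson less_imp_le power_less_imp_less_base)
    have y0: "y \<noteq> 0"
    proof
      assume "y = 0"
      then have "v - F u = 0" using y n by (simp add: zero_power)
      then show False using v by simp
    qed
    obtain \<zeta> :: complex where \<zeta>: "\<zeta> ^ n = 1" "\<zeta> \<noteq> 1" using roots_of_unity_two[OF n2] by blast
    have "norm \<zeta> = 1" using \<zeta>(1) n by (metis norm_one norm_power power_eq_1_iff norm_ge_zero zero_less_iff_neq_zero)
    then have "y \<in> ball 0 d" "\<zeta> * y \<in> ball 0 d" using yd by (auto simp: norm_mult)
    then obtain a b where a: "a \<in> ball u q" "y = G a" and b: "b \<in> ball u q" "\<zeta> * y = G b" using d by blast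
    have "F a - F u = v - F u"
    proof -
      have "a \<in> ball u r" using a q s by blast
      then show ?thesis using gr(3)[of a] a(2) y by (simp add: G_def)
    qed
    moreover have "F b - F u = v - F u"
    proof -
      have "b \<in> ball u r" using b q s by blast
      then have "F b - F u = (\<zeta> * y) ^ n" using gr(3)[of b] b(2) by (simp add: G_def)
      then show ?thesis using y \<zeta> by (simp add: power_mult_distrib)
    qed
    moreover have "a \<noteq> b" using a b y0 \<zeta> by auto
    ultimately show "\<exists>x\<in>D. \<exists>y\<in>D. x \<noteq> y \<and> F x = v \<and> F y = v"
      using a b q s by (metis diff_add_cancel subsetD)
  qed
qed

text \<open>
Every sublevel set is connected, since each of its components has to contain the only zero.
\<close>
lemma proper_unique_zero_connected:
  fixes F :: "complex \<Rightarrow> complex"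
  assumes D: "open D" and F: "F holomorphic_on D"
    and comp: "\<And>t. t < T \<Longrightarrow> compact {z \<in> D. norm (F z) \<le> t}"
    and bd: "\<And>z. z \<in> D \<Longrightarrow> norm (F z) < T"
    and u0: "u0 \<in> D" "F u0 = 0" "\<And>z. \<lbrakk>z \<in> D; F z = 0\<rbrakk> \<Longrightarrow> z = u0"
  shows "connected D"
proof -
  have T: "T > 0" using bd[OF u0(1)] u0(2) by simp
  have cc: "connected_component {z \<in> D. norm (F z) < t} u0 z" if "z \<in> D" "norm (F z) < t" "t < T" for z t
  proof -
    have "0 < t" using that(2) by (rule le_less_trans[OF norm_ge_zero])
    then have u0S: "u0 \<in> {z \<in> D. norm (F z) < t}" using u0(1,2) by simp
    then have "connected {z \<in> D. norm (F z) < t}"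
    proof (intro sublevel_connectedI[OF D F comp[OF that(3)]])
      fix a b assume "a \<in> D" "F a = 0" "b \<in> D" "F b = 0"
      then have "a = u0" and "b = u0" using u0(3) by metis+
      then show "connected_component {z \<in> D. norm (F z) < t} a b" using u0S connected_component_refl by metis
    qed
    then show ?thesis using u0S that by (simp add: connected_iff_connected_component)
  qed
  show ?thesis
  proof -
    have "connected_component D u0 z" if "z \<in> D" for z
    proof -
      have "connected_component {w \<in> D. norm (F w) < (norm (F z) + T) / 2} u0 z"
        using bd[OF that] that by (intro cc) (auto simp: field_simps)
      then show ?thesis by (rule connected_component_of_subset) auto
    qed
    then show ?thesis
      unfolding connected_iff_connected_component by (meson connected_component_sym connected_component_trans)
  qed
qed

text \<open>
A proper holomorphic map onto a disc has a constant number of preimages, here one. The argument is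
by connectedness of the disc: the set \<open>A\<close> of values with exactly one preimage, and that one
regular, is open because properness confines the preimages of nearby values, and its complement is
open because two preimages, a critical preimage or no preimage all persist.
In the parameter plane this is how simple connectivity of the domain is obtained.
\<close>
theorem proper_simple_zero_bij:
  fixes F :: "complex \<Rightarrow> complex"
  assumes D: "open D" and F: "F holomorphic_on D"
    and comp: "\<And>t. t < T \<Longrightarrow> compact {z \<in> D. norm (F z) \<le> t}"
    and bd: "\<And>z. z \<in> D \<Longrightarrow> norm (F z) < T"
    and u0: "u0 \<in> D" "F u0 = 0" "\<And>z. \<lbrakk>z \<in> D; F z = 0\<rbrakk> \<Longrightarrow> z = u0" "deriv F u0 \<noteq> 0"
  shows "inj_on F D" and "F ` D = ball 0 T"
proof -
  have T: "T > 0" using bd[OF u0(1)] u0(2) by simp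
  have conD: "connected D" using proper_unique_zero_connected[OF D F comp bd u0(1-3)] .
  have contF: "continuous_on D F" using F holomorphic_on_imp_continuous_on by blast
  have nc: "\<not> F constant_on D"
  proof
    assume "F constant_on D"
    then have "F z = F u0" if "z \<in> D" for z using u0 that by (metis constant_on_def)
    then have "(F has_field_derivative 0) (at u0)"
      using has_field_derivative_transform_within_open[OF DERIV_const D u0(1), of "F u0"] by metis
    then show False using u0 DERIV_imp_deriv by blast
  qed
  have avoid: "\<exists>e>0. \<forall>w\<in>ball w0 e. w \<in> ball 0 T \<and> (\<forall>z\<in>D. F z = w \<longrightarrow> z \<in> U)"
    if w0: "w0 \<in> ball 0 T" and U: "open U" "\<And>z. \<lbrakk>z \<in> D; F z = w0\<rbrakk> \<Longrightarrow> z \<in> U" for w0 U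
  proof -
    define t where "t = (norm w0 + T) / 2"
    have t: "norm w0 < t" "t < T" using w0 by (auto simp: t_def)
    let ?K = "{z \<in> D. norm (F z) \<le> t} - U"
    have "compact ?K" using comp[OF t(2)] U by (simp add: compact_diff)
    then have "closed (F ` ?K)"
      by (intro compact_imp_closed compact_continuous_image continuous_on_subset[OF contF]) auto
    then have "open (ball 0 t - F ` ?K)" by (simp add: open_Diff)
    moreover have "w0 \<in> ball 0 t - F ` ?K" using t U by auto
    ultimately obtain e where e: "e > 0" "ball w0 e \<subseteq> ball 0 t - F ` ?K" using open_contains_ball by metis
    then have "w \<in> ball 0 T \<and> (\<forall>z\<in>D. F z = w \<longrightarrow> z \<in> U)" if "w \<in> ball w0 e" for w
    proof -
      have "w \<in> ball 0 t" "w \<notin> F ` ?K" using e that by blast+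
      then show ?thesis using t by (force simp: image_iff)
    qed
    then show ?thesis using e by blast
  qed
  define A where "A = {w \<in> ball 0 T. \<exists>u\<in>D. F u = w \<and> deriv F u \<noteq> 0 \<and> (\<forall>z\<in>D. F z = w \<longrightarrow> z = u)}"
  have AI: "w \<in> A" if "w \<in> ball 0 T" "u \<in> D" "F u = w" "deriv F u \<noteq> 0" "\<And>z. \<lbrakk>z \<in> D; F z = w\<rbrakk> \<Longrightarrow> z = u" for w u
    unfolding A_def using that by blast
  have AU: "x = y" if "w \<in> A" "x \<in> D" "y \<in> D" "F x = w" "F y = w" for w x y
    using that unfolding A_def by blast
  have openA: "\<exists>e>0. ball w0 e \<subseteq> A" if w0A: "w0 \<in> A" for w0
  proof -
    obtain u where w0: "w0 \<in> ball 0 T" and u: "u \<in> D" "F u = w0" "deriv F u \<noteq> 0" "\<And>z. \<lbrakk>z \<in> D; F z = w0\<rbrakk> \<Longrightarrow> z = u"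
      using w0A unfolding A_def mem_Collect_eq Bex_def by metis
    obtain \<rho> where \<rho>: "\<rho> > 0" "ball u \<rho> \<subseteq> D" "open (F ` ball u \<rho>)" "inj_on F (ball u \<rho>)"
      using has_complex_derivative_locally_invertible[OF F u(1) D u(3)] by metis
    have reg: "deriv F x \<noteq> 0" if "x \<in> ball u \<rho>" for x
      using holomorphic_injective_imp_regular[OF holomorphic_on_subset[OF F \<rho>(2)] open_ball \<rho>(4) that] .
    have "z \<in> ball u \<rho>" if "z \<in> D" "F z = w0" for z using u(4)[OF that] \<rho> by simp
    then obtain e where e: "e > 0" "\<And>w. w \<in> ball w0 e \<Longrightarrow> w \<in> ball 0 T \<and> (\<forall>z\<in>D. F z = w \<longrightarrow> z \<in> ball u \<rho>)"
      using avoid[OF w0 open_ball] by metis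
    have "w0 \<in> F ` ball u \<rho>" using \<rho>(1) by (intro image_eqI[of w0 F u]) (simp_all add: u(2))
    then obtain e' where e': "e' > 0" "ball w0 e' \<subseteq> F ` ball u \<rho>" using \<rho> open_contains_ball by metis
    have "w \<in> A" if w: "w \<in> ball w0 (min e e')" for w
    proof -
      obtain x where x: "x \<in> ball u \<rho>" "F x = w" using w e' by auto
      have "z = x" if "z \<in> D" "F z = w" for z
      proof -
        have "z \<in> ball u \<rho>" using e(2)[of w] w that by auto
        then show ?thesis using x that \<rho>(4) by (auto simp: inj_on_def)
      qed
      moreover have "w \<in> ball 0 T" using e(2)[of w] w by auto
      ultimately show ?thesis using AI[of w x] x(2) reg[OF x(1)] subsetD[OF \<rho>(2) x(1)] by blast
    qed
    then show ?thesis using e e' by (intro exI[of _ "min e e'"]) auto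
  qed
  have openB: "\<exists>e>0. ball w0 e \<inter> A = {}" if w0: "w0 \<in> ball 0 T" "w0 \<notin> A" for w0
  proof -
    consider (crit) u where "u \<in> D" "F u = w0" "deriv F u = 0"
      | (none) "\<forall>z\<in>D. F z \<noteq> w0"
      | (two) u v where "u \<in> D" "v \<in> D" "F u = w0" "F v = w0" "u \<noteq> v"
      using AI[OF w0(1)] w0(2) by metis
    then show ?thesis
    proof cases
      case crit
      obtain \<delta> where \<delta>: "\<delta> > 0"
        "\<And>v. \<lbrakk>v \<in> ball (F u) \<delta>; v \<noteq> F u\<rbrakk> \<Longrightarrow> \<exists>x\<in>D. \<exists>y\<in>D. x \<noteq> y \<and> F x = v \<and> F y = v"
        using critical_value_nearby_two_preimages[OF F D conD nc crit(1,3)] by metis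
      have "v \<notin> A" if "v \<in> ball w0 \<delta>" for v
      proof (cases "v = w0")
        case False
        then have "\<exists>x\<in>D. \<exists>y\<in>D. x \<noteq> y \<and> F x = v \<and> F y = v" using \<delta>(2)[of v] that crit(2) by simp
        then show ?thesis using AU by metis
      qed (use w0 in simp)
      then show ?thesis using \<delta> by auto
    next
      case none
      then obtain e where e: "e > 0" "\<forall>w\<in>ball w0 e. w \<in> ball 0 T \<and> (\<forall>z\<in>D. F z = w \<longrightarrow> z \<in> {})"
        using avoid[OF w0(1) open_empty] by metis
      then have "ball w0 e \<inter> A = {}" unfolding A_def by blast
      then show ?thesis using e(1) by blast
    next
      case two
      have "\<exists>U V. open U \<and> open V \<and> u \<in> U \<and> v \<in> V \<and> U \<inter> V = {}" using hausdorff[OF two(5)] by blast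
      then obtain U V where UV: "open U" "open V" "u \<in> U" "v \<in> V" "U \<inter> V = {}" by blast
      have oi: "open (F ` (U \<inter> D))" "open (F ` (V \<inter> D))"
        by (rule open_mapping_thm[OF F D conD _ _ nc]; use UV D in auto)+
      then have "open (F ` (U \<inter> D) \<inter> F ` (V \<inter> D))" by blast
      moreover have "w0 \<in> F ` (U \<inter> D) \<inter> F ` (V \<inter> D)"
        using image_eqI[of w0 F u "U \<inter> D"] image_eqI[of w0 F v "V \<inter> D"] two UV(3,4) by simp
      ultimately obtain e where e: "e > 0" "ball w0 e \<subseteq> F ` (U \<inter> D) \<inter> F ` (V \<inter> D)"
        using open_contains_ball by metis
      have "w \<notin> A" if w: "w \<in> ball w0 e" for w
      proof -
        have "w \<in> F ` (U \<inter> D)" "w \<in> F ` (V \<inter> D)" using subsetD[OF e(2) w] by simp_all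
        then obtain x y where "x \<in> U" "x \<in> D" "y \<in> V" "y \<in> D" "F x = w" "F y = w" unfolding image_iff by (metis IntE)
        then show ?thesis using UV(5) AU by (metis disjoint_iff)
      qed
      then show ?thesis using e by auto
    qed
  qed
  have "A = ball 0 T"
  proof -
    have "openin (top_of_set (ball 0 T)) A"
    proof -
      have "open A" using openA open_contains_ball by blast
      then show ?thesis by (rule open_openin_trans[OF open_ball]) (auto simp: A_def)
    qed
    moreover have "closedin (top_of_set (ball 0 T)) A"
    proof -
      have "open (ball 0 T - A)" unfolding open_contains_ball
      proof
        fix w assume w: "w \<in> ball 0 T - A"
        obtain e where "e > 0" "ball w e \<inter> A = {}" using openB w by blast
        moreover obtain e' where "e' > 0" "ball w e' \<subseteq> ball 0 T"           using w open_ball[of 0 T] unfolding open_contains_ball by blast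
        ultimately show "\<exists>e>0. ball w e \<subseteq> ball 0 T - A"
          by (intro exI[of _ "min e e'"]) (auto simp: disjoint_iff)
      qed
      then have "openin (top_of_set (ball 0 T)) (ball 0 T - A)" by (rule open_openin_trans[OF open_ball]) auto
      moreover have "A \<subseteq> ball 0 T" by (auto simp: A_def)
      ultimately show ?thesis by (simp add: closedin_def)
    qed
    moreover have "0 \<in> A" by (rule AI[OF _ u0(1) u0(2) u0(4) u0(3)]) (use T in simp_all)
    ultimately show ?thesis using connected_clopen[of "ball 0 T"] connected_ball by blast
  qed
  then have *: "\<exists>u\<in>D. F u = w \<and> (\<forall>z\<in>D. F z = w \<longrightarrow> z = u)" if "w \<in> ball 0 T" for w
    using that by (auto simp: A_def)
  show "inj_on F D"
  proof (rule inj_onI)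
    fix x y assume "x \<in> D" "y \<in> D" "F x = F y"
    then show "x = y" using *[of "F x"] bd by auto
  qed
  show "F ` D = ball 0 T" using * bd by (auto simp: image_iff) metis
qed

section \<open>Roots of a polynomial near infinity\<close>

text \<open>
By Liouville's theorem these are exactly the polynomials of degree \<open>N\<close> with leading coefficient
\<open>C\<close>. The condition at infinity is what the arguments use, and it passes to compositions.
\<close>
definition asymp_monomial :: "nat \<Rightarrow> complex \<Rightarrow> (complex \<Rightarrow> complex) \<Rightarrow> bool" where
  "asymp_monomial N C p \<longleftrightarrow> 0 < N \<and> C \<noteq> 0 \<and> p holomorphic_on UNIV \<and> ((\<lambda>z. p z / z ^ N) \<longlongrightarrow> C) at_infinity"

text \<open>
The set \<open>{z. r < |p z|}\<close> together with the point at infinity, in the coordinate \<open>1 / z\<close>.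
\<close>
definition outer_chart :: "(complex \<Rightarrow> complex) \<Rightarrow> real \<Rightarrow> complex set" where
  "outer_chart p r = insert 0 {u. u \<noteq> 0 \<and> r < norm (p (inverse u))}"

text \<open>
The reversed polynomial. The value at \<open>0\<close> removes the singularity.
\<close>
definition reversed :: "nat \<Rightarrow> complex \<Rightarrow> (complex \<Rightarrow> complex) \<Rightarrow> complex \<Rightarrow> complex" where
  "reversed N C p u = (if u = 0 then C else u ^ N * p (inverse u))"

lemma reversed_holomorphic:
  assumes "asymp_monomial N C p"
  shows "reversed N C p holomorphic_on UNIV"
proof (rule no_isolated_singularity'[where K = "{0}"])
  have p: "p holomorphic_on UNIV" and lim: "((\<lambda>z. p z / z ^ N) \<longlongrightarrow> C) at_infinity"
    using assms by (auto simp: asymp_monomial_def)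
  have "((\<lambda>u. p (inverse u) / inverse u ^ N) \<longlongrightarrow> C) (at 0)"
    using filterlim_compose[OF lim filterlim_inverse_at_infinity] .
  moreover have "p (inverse u) / inverse u ^ N = reversed N C p u" if "u \<noteq> 0" for u
    using that by (simp add: reversed_def field_simps)
  ultimately show "(reversed N C p \<longlongrightarrow> reversed N C p z) (at z within UNIV)" if "z \<in> {0}" for z
    using that by (auto intro: Lim_transform_eventually simp: eventually_at_filter reversed_def)
  have "(\<lambda>u. u ^ N * p (inverse u)) holomorphic_on UNIV - {0}"
    by (intro holomorphic_intros holomorphic_on_compose_gen[OF _ p, unfolded o_def]) auto
  then show "reversed N C p holomorphic_on UNIV - {0}"
    by (rule holomorphic_transform) (auto simp: reversed_def)
qed auto

lemma asymp_monomial_lower_bound: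
  assumes "asymp_monomial N C p"
  obtains B where "B \<ge> 1" "\<And>z. B \<le> norm z \<Longrightarrow> norm (p z) \<ge> norm C / 2 * norm z ^ N"
proof -
  have lim: "((\<lambda>z. norm (p z / z ^ N)) \<longlongrightarrow> norm C) at_infinity" and C: "C \<noteq> 0"
    using assms by (auto simp: asymp_monomial_def intro: tendsto_norm)
  then have "eventually (\<lambda>z. norm (p z / z ^ N) > norm C / 2) at_infinity"
    by (intro order_tendstoD(1)) auto
  then obtain b where b: "\<And>z. b \<le> norm z \<Longrightarrow> norm (p z / z ^ N) > norm C / 2"
    by (auto simp: eventually_at_infinity)
  show ?thesis
  proof
    show "max b 1 \<ge> 1" by simp
    fix z :: complex assume z: "max b 1 \<le> norm z"
    then have "norm (p z / z ^ N) > norm C / 2" using b by simp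
    moreover have "norm z ^ N > 0" using z by (intro zero_less_power) linarith
    ultimately show "norm (p z) \<ge> norm C / 2 * norm z ^ N"
      by (simp add: norm_divide norm_power field_simps)
  qed
qed

lemma asymp_monomial_escape:
  assumes "asymp_monomial N C p"
  obtains B where "\<And>z. B \<le> norm z \<Longrightarrow> norm (p z) > t"
proof -
  obtain B where B: "B \<ge> 1" "\<And>z. B \<le> norm z \<Longrightarrow> norm (p z) \<ge> norm C / 2 * norm z ^ N"
    using asymp_monomial_lower_bound[OF assms] by metis
  have C: "norm C > 0" and N: "N > 0" using assms by (auto simp: asymp_monomial_def)
  show ?thesis
  proof
    fix z :: complex assume z: "max B (2 * \<bar>t\<bar> / norm C + 1) \<le> norm z"
    then have "2 * \<bar>t\<bar> / norm C < norm z" by simp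
    then have "\<bar>t\<bar> < norm C / 2 * norm z" using C by (simp add: field_simps)
    also have "norm z \<le> norm z ^ N" using self_le_power[of "norm z" N] z B N by simp
    then have "norm C / 2 * norm z \<le> norm C / 2 * norm z ^ N" by (intro mult_left_mono) auto
    also have "\<dots> \<le> norm (p z)" using B z by simp
    finally show "norm (p z) > t" by simp
  qed
qed

lemma asymp_monomial_compact_sublevel:
  assumes "asymp_monomial N C p"
  shows "compact {z. norm (p z) \<le> t}"
proof -
  obtain B where B: "\<And>z. B \<le> norm z \<Longrightarrow> norm (p z) > t" using asymp_monomial_escape[OF assms] by metis
  then have "{z. norm (p z) \<le> t} \<subseteq> cball 0 B" using not_le by (metis (mono_tags, lifting) less_imp_le mem_Collect_eq mem_cball_0 subsetI)
  then have "bounded {z. norm (p z) \<le> t}" using bounded_cball bounded_subset by blast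
  moreover have "continuous_on UNIV p"
    using assms by (auto simp: asymp_monomial_def intro: holomorphic_on_imp_continuous_on)
  then have "closed {z. norm (p z) \<le> t}" by (intro closed_Collect_le continuous_intros)
  ultimately show ?thesis by (simp add: compact_eq_bounded_closed)
qed

lemma asymp_monomial_sublevel_eventually_connected:
  assumes "asymp_monomial N C p"
  obtains t1 where "t1 > s" "connected {z. norm (p z) < t1}"
proof -
  have hol: "p holomorphic_on UNIV" using assms by (auto simp: asymp_monomial_def)
  obtain B where B: "\<And>z. B \<le> norm z \<Longrightarrow> norm (p z) > 0" using asymp_monomial_escape[OF assms] by metis
  have "compact (p ` cball 0 \<bar>B\<bar>)"
    using hol by (intro compact_continuous_image holomorphic_on_imp_continuous_on) (auto intro: holomorphic_on_subset)
  then have "bounded (p ` cball 0 \<bar>B\<bar>)" by (rule compact_imp_bounded)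
  then obtain M where "\<forall>y \<in> p ` cball 0 \<bar>B\<bar>. norm y \<le> M" unfolding bounded_iff by blast
  then have M: "norm (p z) \<le> M" if "norm z \<le> \<bar>B\<bar>" for z using that by simp
  define t1 where "t1 = max M s + 1"
  have sub: "cball 0 \<bar>B\<bar> \<subseteq> {z. norm (p z) < t1}" using M by (force simp: t1_def)
  have "connected {z \<in> UNIV. norm (p z) < t1}"
  proof (rule sublevel_connectedI[OF open_UNIV hol])
    show "compact {z \<in> UNIV. cmod (p z) \<le> t1}" using asymp_monomial_compact_sublevel[OF assms] by simp
    fix a b assume ab: "p a = 0" "p b = 0"
    have "\<not> B \<le> norm a" "\<not> B \<le> norm b" using B ab by force+
    then have "a \<in> cball 0 \<bar>B\<bar>" "b \<in> cball 0 \<bar>B\<bar>" by simp_all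
    then show "connected_component {z \<in> UNIV. cmod (p z) < t1} a b"
      using sub connected_cball unfolding connected_component_def by auto
  qed
  then show ?thesis using that[of t1] by (auto simp: t1_def)
qed

text \<open>
At high levels the sublevel set contains a disc with all the zeros and so is connected; from
there one descends without meeting a critical value.
\<close>
theorem sublevel_connected_of_critical_values:
  assumes p: "asymp_monomial N C p" and r: "0 \<le> r" "r < t"
    and crit: "\<And>z. deriv p z = 0 \<Longrightarrow> norm (p z) \<le> r"
  shows "connected {z. norm (p z) < t}"
proof -
  have hol: "p holomorphic_on UNIV" using p by (auto simp: asymp_monomial_def)
  obtain t1 where t1: "t1 > t" "connected {z. norm (p z) < t1}"
    using asymp_monomial_sublevel_eventually_connected[OF p] by metis
  have "connected {z \<in> UNIV. norm (p z) < t}"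
  proof (rule sublevel_connected_descend[OF open_UNIV hol])
    show "compact {z \<in> UNIV. norm (p z) \<le> t}" for t using asymp_monomial_compact_sublevel[OF p] by simp
    show "connected {z \<in> UNIV. norm (p z) < t1}" using t1 by simp
    show "deriv p z \<noteq> 0" if "r < norm (p z)" for z using crit[of z] that by auto
  qed (use r t1 in auto)
  then show ?thesis by simp
qed

text \<open>
Locally the root differs from a holomorphic root by a continuous function with values in the
finite set of roots of unity.
\<close>
lemma continuous_root_of_holomorphic:
  fixes f \<phi> :: "complex \<Rightarrow> complex"
  assumes S: "open S" and f: "f holomorphic_on S" and nz: "\<And>z. z \<in> S \<Longrightarrow> f z \<noteq> 0"
    and \<phi>: "continuous_on S \<phi>" and eq: "\<And>z. z \<in> S \<Longrightarrow> \<phi> z ^ N = f z" and N: "N > 0"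
  shows "\<phi> holomorphic_on S"
proof -
  have "\<phi> field_differentiable at z" if z: "z \<in> S" for z
  proof -
    obtain e where e: "e > 0" "ball z e \<subseteq> S" using S z open_contains_ball by metis
    obtain l where l: "l holomorphic_on ball z e" "\<And>x. x \<in> ball z e \<Longrightarrow> f x = exp (l x)"
      using simply_connected_imp_holomorphic_log[of f "ball z e"] holomorphic_on_subset[OF f e(2)] nz e(2)
        convex_imp_simply_connected[of "ball z e"] convex_imp_locally_path_connected[of "ball z e"]
      by (metis convex_ball subsetD)
    define g where "g x = exp (l x / of_nat N)" for x
    have g: "g x ^ N = f x" if "x \<in> ball z e" for x
      using l(2)[OF that] N by (simp add: g_def flip: exp_of_nat_mult)
    have holg: "g holomorphic_on ball z e" unfolding g_def using N by (intro holomorphic_intros l) auto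
    have "(\<lambda>x. \<phi> x / g x) constant_on ball z e"
    proof (rule continuous_finite_range_constant)
      show "continuous_on (ball z e) (\<lambda>x. \<phi> x / g x)"
        by (rule continuous_on_divide[OF continuous_on_subset[OF \<phi> e(2)] holomorphic_on_imp_continuous_on[OF holg]])
           (simp add: g_def)
      have "(\<phi> x / g x) ^ N = 1" if "x \<in> ball z e" for x
      proof -
        have "x \<in> S" using that e by blast
        then show ?thesis using eq[of x] g[OF that] nz[of x] by (simp add: power_divide)
      qed
      then have "(\<lambda>x. \<phi> x / g x) ` ball z e \<subseteq> {w. w ^ N = 1}" by auto
      then show "finite ((\<lambda>x. \<phi> x / g x) ` ball z e)" using N finite_roots_unity[of N] finite_subset by auto
    qed auto
    then obtain c where c: "\<And>x. x \<in> ball z e \<Longrightarrow> \<phi> x / g x = c" by (auto simp: constant_on_def)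
    have gc: "c * g x = \<phi> x" if "x \<in> ball z e" for x using c[OF that] by (auto simp: g_def field_simps)
    have "(\<lambda>x. c * g x) holomorphic_on ball z e" using holg by (intro holomorphic_intros)
    then have "\<phi> holomorphic_on ball z e" using gc by (rule holomorphic_transform)
    then show ?thesis using e by (meson centre_in_ball holomorphic_on_imp_differentiable_at open_ball)
  qed
  then show ?thesis using S by (auto simp: holomorphic_on_def field_differentiable_at_within)
qed

text \<open>
In the coordinate \<open>u = 1 / z\<close> the function \<open>m = 1 / p\<close> is a proper map from
\<open>outer_chart p r\<close> to the disc of radius \<open>1 / r\<close>, whose only zero, of order \<open>N\<close>, is at \<open>0\<close>.
\<close>
locale superlevel =
  fixes N :: nat and C :: complex and p :: "complex \<Rightarrow> complex" and r :: real
  assumes p: "asymp_monomial N C p" and p0: "p 0 = 0" and r: "r > 0"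
begin

definition q :: "complex \<Rightarrow> complex" where "q = reversed N C p"

definition m :: "complex \<Rightarrow> complex" where "m u = u ^ N / q u"

lemma N_pos: "N > 0" and C_nz: "C \<noteq> 0" and p_hol: "p holomorphic_on UNIV"
  using p by (auto simp: asymp_monomial_def)

lemma q_hol: "q holomorphic_on UNIV" using reversed_holomorphic[OF p] by (simp add: q_def)

lemma q_cont: "continuous_on A q" using q_hol holomorphic_on_imp_continuous_on continuous_on_subset by blast

lemma m_eq: "u \<noteq> 0 \<Longrightarrow> m u = inverse (p (inverse u))" and m_0: "m 0 = 0" and q_0: "q 0 = C"
  using N_pos by (auto simp: m_def q_def reversed_def field_simps)

lemma outer_chart_alt: "outer_chart p r = {u. r * norm u ^ N < norm (q u)}"
proof -
  have "r < norm (p (inverse u)) \<longleftrightarrow> r * norm u ^ N < norm (q u)" if "u \<noteq> 0" for u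
  proof -
    have "norm u ^ N > 0" using that by simp
    then have "r < norm (p (inverse u)) \<longleftrightarrow> norm u ^ N * r < norm u ^ N * norm (p (inverse u))" by simp
    then show ?thesis using that by (simp add: q_def reversed_def norm_mult norm_power mult.commute)
  qed
  moreover have "r * norm (0::complex) ^ N < norm (q 0)" using N_pos C_nz by (simp add: q_0 zero_power)
  ultimately show ?thesis by (auto simp: outer_chart_def)
qed

lemma open_outer_chart: "open (outer_chart p r)"
  unfolding outer_chart_alt by (intro open_Collect_less continuous_intros q_cont)

lemma q_nz: "u \<in> outer_chart p r \<Longrightarrow> q u \<noteq> 0"
  using r unfolding outer_chart_alt by (auto simp: mult_less_0_iff not_less)

lemma m_hol: "m holomorphic_on outer_chart p r"
  unfolding m_def using q_nz by (intro holomorphic_intros holomorphic_on_subset[OF q_hol]) auto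

lemma m_bound: "u \<in> outer_chart p r \<Longrightarrow> norm (m u) < inverse r"
  using r q_nz[of u] unfolding outer_chart_alt by (simp add: m_def norm_divide norm_power field_simps)

lemma m_zero: "u \<in> outer_chart p r \<Longrightarrow> m u = 0 \<Longrightarrow> u = 0"
  using q_nz[of u] N_pos by (simp add: m_def)

lemma bounded_outer_chart: "bounded (outer_chart p r)"
proof -
  have "isCont p 0" using p_hol holomorphic_on_imp_continuous_on continuous_on_eq_continuous_at by blast
  then obtain d where d: "d > 0" "\<And>z. norm z < d \<Longrightarrow> norm (p z) < r"
    using r p0 by (auto simp: continuous_at_eps_delta)
  have "norm u \<le> inverse d" if "u \<in> outer_chart p r" for u
  proof (cases "u = 0")
    case False
    then have "r < norm (p (inverse u))" using that by (simp add: outer_chart_def)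
    then have "d \<le> norm (inverse u)" using d(2)[of "inverse u"] by linarith
    then have "d * norm u \<le> norm (inverse u) * norm u" by (rule mult_right_mono) simp
    also have "\<dots> = 1" using False by (simp add: norm_inverse)
    finally have "d * norm u \<le> 1" .
    then show ?thesis using d(1) by (simp add: field_simps)
  qed (use d in auto)
  then show ?thesis by (auto simp: bounded_iff)
qed

lemma m_compact:
  assumes "t < inverse r" shows "compact {u \<in> outer_chart p r. norm (m u) \<le> t}"
proof (cases "t < 0")
  case True
  then have "{u \<in> outer_chart p r. norm (m u) \<le> t} = {}" by (auto simp: not_le intro: less_le_trans)
  then show ?thesis by (simp only: compact_empty)
next
  case False
  have tr: "r * t < 1" using assms r by (simp add: field_simps)
  have "{u \<in> outer_chart p r. norm (m u) \<le> t} = {u. norm u ^ N \<le> t * norm (q u)}"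
  proof (intro equalityI subsetI)
    fix u assume "u \<in> {u \<in> outer_chart p r. norm (m u) \<le> t}"
    then show "u \<in> {u. norm u ^ N \<le> t * norm (q u)}"
      using q_nz[of u] by (simp add: m_def norm_divide norm_power field_simps)
  next
    fix u assume u: "u \<in> {u. norm u ^ N \<le> t * norm (q u)}"
    have q: "q u \<noteq> 0"
    proof
      assume "q u = 0"
      then have "norm u ^ N = 0" using u by (intro antisym) auto
      then have "u = 0" by simp
      then show False using \<open>q u = 0\<close> C_nz q_0 by simp
    qed
    have "r * norm u ^ N \<le> r * (t * norm (q u))" using u r by (intro mult_left_mono) auto
    also have "\<dots> = (r * t) * norm (q u)" by simp
    also have "\<dots> < 1 * norm (q u)" using tr q by (intro mult_strict_right_mono) auto
    finally show "u \<in> {u \<in> outer_chart p r. norm (m u) \<le> t}"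
      using u q by (simp add: outer_chart_alt m_def norm_divide norm_power field_simps)
  qed
  moreover have "closed {u. norm u ^ N \<le> t * norm (q u)}"
    by (intro closed_Collect_le continuous_intros q_cont)
  moreover have "bounded {u \<in> outer_chart p r. norm (m u) \<le> t}"
    using bounded_outer_chart by (rule bounded_subset) auto
  ultimately show ?thesis by (simp add: compact_eq_bounded_closed)
qed

lemma zero_in_outer_chart: "0 \<in> outer_chart p r" by (simp add: outer_chart_def)

lemma connected_outer_chart: "connected (outer_chart p r)"
  using proper_unique_zero_connected[OF open_outer_chart m_hol m_compact m_bound zero_in_outer_chart m_0 m_zero] .

lemma connected_superlevel: "connected {z. r < norm (p z)}"
proof -
  have "connected (outer_chart p r - {0})"
    using connected_open_delete[OF open_outer_chart connected_outer_chart] by simp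
  then have "connected (inverse ` (outer_chart p r - {0}))"
    by (rule connected_continuous_image[rotated]) (auto intro!: continuous_intros)
  moreover have "inverse ` (outer_chart p r - {0}) = {z. r < norm (p z)}"
  proof (intro equalityI subsetI)
    fix z assume z: "z \<in> {z. r < norm (p z)}"
    then have "z \<noteq> 0" using p0 r by auto
    then show "z \<in> inverse ` (outer_chart p r - {0})"
      using z by (intro image_eqI[of _ _ "inverse z"]) (auto simp: outer_chart_def)
  qed (auto simp: outer_chart_def)
  ultimately show ?thesis by simp
qed

text \<open>
A point outside the chart belongs to the reciprocal of a sublevel set. This reciprocal is connected and
unbounded, and if the level is close enough to \<open>r\<close> it misses a given loop in the chart; so the
loop does not wind around the point.
\<close>
lemma simply_connected_outer_chart:
  assumes conn: "\<And>t. r < t \<Longrightarrow> connected {z. norm (p z) < t}"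
  shows "simply_connected (outer_chart p r)"
  unfolding simply_connected_eq_winding_number_zero[OF open_outer_chart]
proof (intro conjI allI impI, rule connected_outer_chart, elim conjE)
  fix \<gamma> u assume \<gamma>: "path \<gamma>" "path_image \<gamma> \<subseteq> outer_chart p r" "pathfinish \<gamma> = pathstart \<gamma>"
    and u: "u \<notin> outer_chart p r"
  have u0: "u \<noteq> 0" and pu: "norm (p (inverse u)) \<le> r" using u by (auto simp: outer_chart_def)
  have "continuous_on (path_image \<gamma>) (\<lambda>v. norm (m v))"
    using m_hol \<gamma> by (intro continuous_intros continuous_on_subset[OF holomorphic_on_imp_continuous_on])
  then obtain x where x: "x \<in> path_image \<gamma>" "\<And>v. v \<in> path_image \<gamma> \<Longrightarrow> norm (m v) \<le> norm (m x)"
    using continuous_attains_sup[OF compact_path_image[OF \<gamma>(1)] path_image_nonempty] by metis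
  have "norm (m x) < inverse r" using m_bound x \<gamma> by blast
  then obtain a where a: "norm (m x) < a" "a < inverse r" using dense by blast
  then have "0 < a" using norm_ge_zero le_less_trans by blast
  define t where "t = inverse a"
  have t: "r < t" using a r \<open>0 < a\<close> by (simp add: t_def field_simps)
  define E where "E = {z. norm (p z) < t} - {0}"
  have openE: "open {z. norm (p z) < t}"
    using p_hol holomorphic_on_imp_continuous_on by (intro open_Collect_less continuous_intros) auto
  have "connected E" unfolding E_def using conn[OF t] openE by (intro connected_open_delete) auto
  then have conn': "connected (inverse ` E)"
    by (rule connected_continuous_image[rotated]) (auto intro!: continuous_intros simp: E_def)
  have uE: "u \<in> inverse ` E" using u0 pu t by (intro image_eqI[of _ _ "inverse u"]) (auto simp: E_def)
  have disj: "inverse ` E \<subseteq> - path_image \<gamma>"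
  proof (rule subsetI, rule ComplI)
    fix v assume v: "v \<in> inverse ` E" "v \<in> path_image \<gamma>"
    then have v0: "v \<noteq> 0" and pv: "norm (p (inverse v)) < t" by (auto simp: E_def)
    then have "r < norm (p (inverse v))" using v \<gamma> by (auto simp: outer_chart_def)
    moreover have "norm (m v) < a" using x(2)[OF v(2)] a by simp
    ultimately have "inverse (norm (p (inverse v))) < a" using m_eq[OF v0] by (simp add: norm_inverse)
    moreover have "0 < norm (p (inverse v))" using \<open>r < norm (p (inverse v))\<close> r by linarith
    ultimately
    have "1 < a * norm (p (inverse v))" by (simp add: inverse_less_iff field_simps)
    also have "\<dots> \<le> a * t" using pv \<open>0 < a\<close> by (intro mult_left_mono) auto
    finally show False using \<open>0 < a\<close> by (simp add: t_def)
  qed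
  have unb: "\<not> bounded (inverse ` E)"
  proof
    assume "bounded (inverse ` E)"
    then obtain b where b: "\<And>z. z \<in> E \<Longrightarrow> norm (inverse z) \<le> b" by (auto simp: bounded_iff)
    have "0 \<in> {z. norm (p z) < t}" using p0 r t by simp
    then obtain d where d: "d > 0" "ball 0 d \<subseteq> {z. norm (p z) < t}" using openE open_contains_ball by metis
    define w where "w = complex_of_real (min (d/2) (inverse (\<bar>b\<bar> + 1)))"
    have w: "norm w = min (d/2) (inverse (\<bar>b\<bar> + 1))" "norm w > 0" using d by (auto simp: w_def)
    then have "w \<in> ball 0 d" using d by (auto simp: min_def)
    then have "w \<in> {z. norm (p z) < t}" using d(2) by blast
    then have "w \<in> E" using w(2) unfolding E_def by (metis DiffI norm_zero order_less_irrefl singletonD)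
    then have "inverse (norm w) \<le> b" using b[of w] by (simp add: norm_inverse)
    moreover have "norm w \<le> inverse (\<bar>b\<bar> + 1)" using w by simp
    then have "\<bar>b\<bar> + 1 \<le> inverse (norm w)" using w(2) by (simp add: field_simps)
    ultimately show False by simp
  qed
  have "inverse ` E \<subseteq> connected_component_set (- path_image \<gamma>) u"
    using connected_component_maximal[OF uE conn' disj] .
  then have "\<not> bounded (connected_component_set (- path_image \<gamma>) u)" using unb bounded_subset by blast
  moreover have "u \<notin> path_image \<gamma>" using u \<gamma> by blast
  ultimately have "u \<in> outside (path_image \<gamma>)" by (simp add: outside_def)
  then show "winding_number \<gamma> u = 0" using winding_number_zero_in_outside \<gamma> by blast
qed

text \<open>
On the simply connected chart the reversed polynomial has no zeros, hence an \<open>N\<close>-th root; the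
normalisation at \<open>0\<close> picks the root asymptotic to the identity. For an iterate
\<open>p\<close> of a monic polynomial the root approximates the Boettcher coordinate.
\<close>
theorem superlevel_root_exists:
  assumes C: "C = 1" and conn: "\<And>t. r < t \<Longrightarrow> connected {z. norm (p z) < t}"
  obtains \<phi> where "continuous_on {z. r < norm (p z)} \<phi>" "\<And>z. r < norm (p z) \<Longrightarrow> \<phi> z ^ N = p z"
    "((\<lambda>z. \<phi> z / z) \<longlongrightarrow> 1) at_infinity"
proof -
  have lpc: "locally path_connected (outer_chart p r)"
    using open_outer_chart by (rule open_imp_locally_path_connected)
  obtain l where l: "l holomorphic_on outer_chart p r" "\<And>u. u \<in> outer_chart p r \<Longrightarrow> q u = exp (l u)"
    using simply_connected_imp_holomorphic_log[OF holomorphic_on_subset[OF q_hol subset_UNIV]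
       simply_connected_outer_chart[OF conn] lpc q_nz] by metis
  define g where "g u = exp ((l u - l 0) / of_nat N)" for u
  have contg: "continuous_on (outer_chart p r) g"
    unfolding g_def using l N_pos by (intro continuous_intros holomorphic_on_imp_continuous_on) auto
  have gN: "g u ^ N = q u" if "u \<in> outer_chart p r" for u
  proof -
    have "exp (l 0) = 1" using l(2)[OF zero_in_outer_chart] q_0 C by simp
    then show ?thesis using l(2)[OF that] N_pos by (simp add: g_def exp_diff flip: exp_of_nat_mult)
  qed
  define \<phi> where "\<phi> z = z * g (inverse z)" for z
  have nz: "z \<noteq> 0" and inv: "inverse z \<in> outer_chart p r" if "r < norm (p z)" for z
    using that p0 r by (auto simp: outer_chart_def)
  show ?thesis
  proof
    show "continuous_on {z. r < norm (p z)} \<phi>"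
      unfolding \<phi>_def using nz inv by (intro continuous_intros continuous_on_compose2[OF contg]) auto
    show "\<phi> z ^ N = p z" if "r < norm (p z)" for z
    proof -
      have "\<phi> z ^ N = z ^ N * q (inverse z)" using gN[OF inv[OF that]] by (simp add: \<phi>_def power_mult_distrib)
      also have "\<dots> = p z" using nz[OF that] by (simp add: q_def reversed_def power_inverse)
      finally show ?thesis .
    qed
    have "isCont g 0" using contg open_outer_chart zero_in_outer_chart continuous_on_eq_continuous_at by blast
    then have "((\<lambda>z. g (inverse z)) \<longlongrightarrow> g 0) at_infinity"
      using isCont_tendsto_compose tendsto_inverse_0 by blast
    moreover have "g 0 = 1" by (simp add: g_def)
    moreover have "eventually (\<lambda>z. g (inverse z) = \<phi> z / z) at_infinity"
      by (intro eventually_at_infinityI[of 1]) (auto simp: \<phi>_def)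
    ultimately show "((\<lambda>z. \<phi> z / z) \<longlongrightarrow> 1) at_infinity" by (auto intro: Lim_transform_eventually)
  qed
qed

end

text \<open>
Conversely, an \<open>N\<close>-th root of \<open>p\<close> turns the zero of order \<open>N\<close> of \<open>1 / p\<close> at infinity
into a simple one, and \<open>1 / \<phi>\<close> becomes a conformal isomorphism onto a disc.
\<close>
locale superlevel_root = superlevel +
  fixes \<phi>
  assumes \<phi>: "continuous_on {z. r < norm (p z)} \<phi>" "\<And>z. r < norm (p z) \<Longrightarrow> \<phi> z ^ N = p z"
begin

definition F :: "complex \<Rightarrow> complex" where "F u = (if u = 0 then 0 else inverse (\<phi> (inverse u)))"

lemma open_superlevel: "open {z. r < norm (p z)}"
  using p_hol holomorphic_on_imp_continuous_on by (intro open_Collect_less continuous_intros) auto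

lemma \<phi>_hol: "\<phi> holomorphic_on {z. r < norm (p z)}"
  by (rule continuous_root_of_holomorphic[OF open_superlevel _ _ \<phi>(1) _ N_pos, of p])
     (use p_hol holomorphic_on_subset \<phi> r in auto)

lemma \<phi>_nz: "r < norm (p z) \<Longrightarrow> \<phi> z \<noteq> 0"
  using \<phi>(2)[of z] r N_pos by (auto simp: zero_power)

lemma F_pow: "u \<in> outer_chart p r \<Longrightarrow> F u ^ N = m u"
  using \<phi>(2)[of "inverse u"] N_pos by (cases "u = 0") (auto simp: F_def m_eq m_0 outer_chart_def power_inverse zero_power)

lemma F_norm: "u \<in> outer_chart p r \<Longrightarrow> norm (F u) = root N (norm (m u))"
  using F_pow[of u] N_pos by (metis norm_ge_zero norm_power real_root_power_cancel)

lemma F_hol: "F holomorphic_on outer_chart p r"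
proof (rule no_isolated_singularity[where K = "{0}"])
  have "(\<lambda>u. inverse (\<phi> (inverse u))) holomorphic_on outer_chart p r - {0}"
  proof (intro holomorphic_on_inverse)
    show "(\<lambda>u. \<phi> (inverse u)) holomorphic_on outer_chart p r - {0}"
      by (rule holomorphic_on_compose_gen[OF _ \<phi>_hol, unfolded o_def])
         (auto intro!: holomorphic_intros simp: outer_chart_def)
  qed (auto simp: outer_chart_def \<phi>_nz)
  then show h: "F holomorphic_on outer_chart p r - {0}"
    by (rule holomorphic_transform) (auto simp: F_def)
  have "isCont F 0"
  proof -
    have "isCont m 0" using m_hol open_outer_chart zero_in_outer_chart
      by (meson continuous_on_eq_continuous_at holomorphic_on_imp_continuous_on)
    then have "(\<lambda>u. root N (norm (m u))) \<midarrow>0\<rightarrow> 0"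
      by (auto simp: isCont_def m_0 intro!: tendsto_eq_intros)
    moreover have "eventually (\<lambda>u. root N (norm (m u)) = norm (F u)) (at 0)"
      unfolding eventually_at_topological using open_outer_chart zero_in_outer_chart
      by (intro exI[of _ "outer_chart p r"]) (simp add: F_norm)
    ultimately have "(\<lambda>u. norm (F u)) \<midarrow>0\<rightarrow> 0" by (rule Lim_transform_eventually)
    then show ?thesis by (simp add: isCont_def F_def[of 0] tendsto_norm_zero_iff)
  qed
  moreover have "isCont F u" if "u \<in> outer_chart p r - {0}" for u
    using holomorphic_on_imp_continuous_on[OF h] that open_outer_chart
    by (meson continuous_on_eq_continuous_at open_delete)
  ultimately show "continuous_on (outer_chart p r) F"
    by (metis DiffI continuous_at_imp_continuous_on singletonD)
qed (use open_outer_chart in auto)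

text \<open>
\<open>(F u / u)^N\<close> tends to \<open>1 / C\<close>, which is not zero.
\<close>
lemma F_deriv_0: "deriv F 0 \<noteq> 0"
proof
  assume "deriv F 0 = 0"
  then have "(F has_field_derivative 0) (at 0)"
    using holomorphic_derivI[OF F_hol open_outer_chart zero_in_outer_chart] by simp
  then have "(\<lambda>u. F u / u) \<midarrow>0\<rightarrow> 0" by (simp add: has_field_derivative_iff F_def[of 0])
  then have "(\<lambda>u. (F u / u) ^ N) \<midarrow>0\<rightarrow> 0 ^ N" by (rule tendsto_power)
  moreover have "eventually (\<lambda>u. (F u / u) ^ N = inverse (q u)) (at 0)"
  proof -
    have "eventually (\<lambda>u. u \<in> outer_chart p r - {0}) (at 0)"
      using open_outer_chart zero_in_outer_chart by (auto simp: eventually_at_topological)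
    then show ?thesis by eventually_elim (simp add: power_divide F_pow m_def field_simps)
  qed
  ultimately have "(\<lambda>u. inverse (q u)) \<midarrow>0\<rightarrow> 0 ^ N" by (rule Lim_transform_eventually)
  then have "(\<lambda>u. inverse (q u)) \<midarrow>0\<rightarrow> 0" using N_pos by (simp add: zero_power)
  moreover have "(\<lambda>u. inverse (q u)) \<midarrow>0\<rightarrow> inverse C"
  proof (rule tendsto_inverse[OF _ C_nz])
    show "q \<midarrow>0\<rightarrow> C" using q_cont[of UNIV] q_0 by (metis UNIV_I continuous_on_eq_continuous_at isCont_def open_UNIV)
  qed
  ultimately have "inverse C = 0" using LIM_unique by blast
  then show False using C_nz by simp
qed

lemma F_bij: "inj_on F (outer_chart p r)" "F ` outer_chart p r = ball 0 (root N (inverse r))"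
proof -
  have cmp: "compact {u \<in> outer_chart p r. norm (F u) \<le> t}" if t: "t < root N (inverse r)" for t
  proof (cases "t < 0")
    case True
    then have "{u \<in> outer_chart p r. norm (F u) \<le> t} = {}" by (auto simp: not_le intro: less_le_trans)
    then show ?thesis by (simp only: compact_empty)
  next
    case False
    have "norm (F u) \<le> t \<longleftrightarrow> norm (m u) \<le> t ^ N" if "u \<in> outer_chart p r" for u
      using F_pow[OF that] False N_pos
      by (metis norm_ge_zero norm_power not_less power_mono power_strict_mono linorder_not_le)
    then have "{u \<in> outer_chart p r. norm (F u) \<le> t} = {u \<in> outer_chart p r. norm (m u) \<le> t ^ N}" by auto
    moreover have "t ^ N < inverse r"
    proof -
      have "t ^ N < root N (inverse r) ^ N" using t False N_pos by (intro power_strict_mono) auto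
      then show ?thesis using r N_pos by simp
    qed
    ultimately show ?thesis using m_compact by simp
  qed
  have bd: "norm (F u) < root N (inverse r)" if "u \<in> outer_chart p r" for u
    using F_norm[OF that] m_bound[OF that] N_pos by simp
  have z: "u = 0" if "u \<in> outer_chart p r" "F u = 0" for u
    using F_pow[OF that(1)] that m_zero N_pos by (simp add: zero_power)
  have F0: "F 0 = 0" by (simp add: F_def)
  show "inj_on F (outer_chart p r)"
    by (rule proper_simple_zero_bij(1)[OF open_outer_chart F_hol cmp bd zero_in_outer_chart F0 z F_deriv_0])
  show "F ` outer_chart p r = ball 0 (root N (inverse r))"
    by (rule proper_simple_zero_bij(2)[OF open_outer_chart F_hol cmp bd zero_in_outer_chart F0 z F_deriv_0])
qed

theorem simply_connected_outer_chart_of_root: "simply_connected (outer_chart p r)"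
proof -
  obtain G where G: "G holomorphic_on ball 0 (root N (inverse r))" "\<And>u. u \<in> outer_chart p r \<Longrightarrow> G (F u) = u"
    using holomorphic_has_inverse[OF F_hol open_outer_chart F_bij(1)] F_bij(2) by metis
  have "homeomorphism (outer_chart p r) (ball 0 (root N (inverse r))) F G"
  proof (rule homeomorphismI)
    show "continuous_on (outer_chart p r) F" "continuous_on (ball 0 (root N (inverse r))) G"
      by (rule holomorphic_on_imp_continuous_on[OF F_hol], rule holomorphic_on_imp_continuous_on[OF G(1)])
    show "F ` outer_chart p r \<subseteq> ball 0 (root N (inverse r))" "G ` ball 0 (root N (inverse r)) \<subseteq> outer_chart p r"
      using G(2) unfolding F_bij(2)[symmetric] by force+
    show "F (G y) = y" if "y \<in> ball 0 (root N (inverse r))" for y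
      using that G(2) unfolding F_bij(2)[symmetric] by force
  qed (rule G(2))
  then have "outer_chart p r homeomorphic ball (0::complex) (root N (inverse r))" by (auto simp: homeomorphic_def)
  then show ?thesis using homeomorphic_simply_connected_eq convex_imp_simply_connected convex_ball by blast
qed

theorem deriv_nonzero_of_root: "r < norm (p z) \<Longrightarrow> deriv p z \<noteq> 0"
proof -
  assume z: "r < norm (p z)"
  have "inj_on \<phi> {z. r < norm (p z)}"
  proof (rule inj_onI, clarsimp)
    fix x y assume xy: "r < norm (p x)" "r < norm (p y)" "\<phi> x = \<phi> y"
    have nz: "x \<noteq> 0" "y \<noteq> 0" using xy p0 r by auto
    then have "F (inverse x) = F (inverse y)" using xy by (simp add: F_def)
    then have "inverse x = inverse y"
      by (rule inj_onD[OF F_bij(1)]) (use xy nz in \<open>simp_all add: outer_chart_def\<close>)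
    then show "x = y" by simp
  qed
  then have d: "deriv \<phi> z \<noteq> 0" using holomorphic_injective_imp_regular[OF \<phi>_hol open_superlevel] z by simp
  have "(\<phi> has_field_derivative deriv \<phi> z) (at z)" using holomorphic_derivI[OF \<phi>_hol open_superlevel] z by simp
  then have "((\<lambda>z. \<phi> z ^ N) has_field_derivative (of_nat N * \<phi> z ^ (N - 1) * deriv \<phi> z)) (at z)"
    by (auto intro!: derivative_eq_intros)
  then have "(p has_field_derivative (of_nat N * \<phi> z ^ (N - 1) * deriv \<phi> z)) (at z)"
    by (rule has_field_derivative_transform_within_open[OF _ open_superlevel]) (use z \<phi> in auto)
  then have "deriv p z = of_nat N * \<phi> z ^ (N - 1) * deriv \<phi> z" by (rule DERIV_imp_deriv)
  then show ?thesis using d N_pos \<phi>_nz[OF z] by simp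
qed

end

section \<open>Filled Julia sets and critical orbits\<close>

lemma asymp_monomial_comp:
  assumes f: "asymp_monomial N 1 f" and g: "asymp_monomial M 1 g"
  shows "asymp_monomial (M * N) 1 (f \<circ> g)"
proof -
  have "filterlim g at_infinity at_infinity"
    unfolding filterlim_at_infinity[OF order.refl]
  proof (intro allI impI)
    fix t :: real
    obtain B where "\<And>z. B \<le> norm z \<Longrightarrow> norm (g z) > t" using asymp_monomial_escape[OF g] by metis
    then show "\<forall>\<^sub>F x in at_infinity. t \<le> norm (g x)" unfolding eventually_at_infinity by (meson less_imp_le)
  qed
  then have "((\<lambda>z. f (g z) / g z ^ N) \<longlongrightarrow> 1) at_infinity"
    using f filterlim_compose unfolding asymp_monomial_def by blast
  moreover have "((\<lambda>z. (g z / z ^ M) ^ N) \<longlongrightarrow> 1 ^ N) at_infinity"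
    using g unfolding asymp_monomial_def by (intro tendsto_power) auto
  ultimately have "((\<lambda>z. f (g z) / g z ^ N * (g z / z ^ M) ^ N) \<longlongrightarrow> 1) at_infinity"
    using tendsto_mult by fastforce
  moreover obtain B where B: "\<And>z. B \<le> norm z \<Longrightarrow> norm (g z) > 0" using asymp_monomial_escape[OF g] by metis
  have "\<forall>\<^sub>F z in at_infinity. f (g z) / g z ^ N * (g z / z ^ M) ^ N = (f \<circ> g) z / z ^ (M * N)"
    unfolding eventually_at_infinity
    using B by (intro exI[of _ B]) (auto simp: power_divide power_mult)
  ultimately have "((\<lambda>z. (f \<circ> g) z / z ^ (M * N)) \<longlongrightarrow> 1) at_infinity" by (rule Lim_transform_eventually)
  moreover have "(f \<circ> g) holomorphic_on UNIV"
    using f g unfolding asymp_monomial_def by (meson holomorphic_on_compose_gen subset_UNIV)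
  ultimately show ?thesis using f g by (auto simp: asymp_monomial_def)
qed

lemma asymp_monomial_id: "asymp_monomial (Suc 0) 1 id"
proof -
  have "((\<lambda>z::complex. id z / z ^ Suc 0) \<longlongrightarrow> 1) at_infinity"
    by (rule tendsto_eventually) (auto simp: eventually_at_infinity intro!: exI[of _ 1])
  then show ?thesis by (simp add: asymp_monomial_def)
qed

definition filled_julia :: "(complex \<Rightarrow> complex) \<Rightarrow> complex set" where
  "filled_julia f = {z. bounded (range (\<lambda>n. (f ^^ n) z))}"

text \<open>
In a separation of \<open>K\<close> one part misses the connected frontier, so it is open and closed in the plane.
\<close>
lemma connected_of_connected_frontier:
  fixes K :: "complex set"
  assumes K: "closed K" "connected (frontier K)"
  shows "connected K"
proof (rule ccontr)
  assume "\<not> connected K"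
  then obtain A B where AB: "closed A" "closed B" "A \<noteq> {}" "B \<noteq> {}" "A \<union> B = K" "A \<inter> B = {}"
    using K(1) by (auto simp: connected_closed_set)
  have frK: "frontier K \<subseteq> A \<union> B" using AB K(1) by (simp add: frontier_subset_eq)
  have key: "False" if AB: "closed A" "closed B" "A \<noteq> {}" "B \<noteq> {}" "A \<union> B = K" "A \<inter> B = {}" "frontier K \<inter> B = {}" for A B
  proof -
    have "B = interior K - A"
    proof (intro equalityI subsetI)
      fix x assume x: "x \<in> B"
      then have "x \<in> K" "x \<notin> frontier K" using AB by auto
      then show "x \<in> interior K - A" using x AB K(1) by (auto simp: frontier_def)
    next
      fix x assume "x \<in> interior K - A"
      then show "x \<in> B" using interior_subset[of K] AB by auto
    qed
    then have "open B" using AB(1) by (metis open_Diff open_interior)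
    then have "B = UNIV" using AB(2,4) clopen by blast
    then show False using AB by auto
  qed
  show False
  proof (cases "frontier K \<inter> B = {}")
    case False
    then have "frontier K \<inter> A = {}"
      using connected_closedD[OF K(2), of A B] AB frK by blast
    then show False using key[of B A] AB by blast
  qed (use key[of A B] AB in blast)
qed

text \<open>
The growth condition makes \<open>R\<close> an escape radius: outside the disc of radius \<open>R\<close> the modulus
at least doubles in every step.
\<close>
locale escaping_map =
  fixes f :: "complex \<Rightarrow> complex" and R :: real
  assumes entire: "f holomorphic_on UNIV" and R: "R > 0"
    and grow: "\<And>z. R \<le> norm z \<Longrightarrow> 2 * norm z \<le> norm (f z)"
begin

abbreviation "K \<equiv> filled_julia f"

lemma f_hol: "f holomorphic_on A"
  using entire holomorphic_on_subset by blast

lemma iter_hol: "(f ^^ n) holomorphic_on A"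
proof (induction n arbitrary: A)
  case (Suc n)
  then show ?case using f_hol holomorphic_on_compose[of "f ^^ n" A f] by (simp add: o_def)
qed (simp add: id_def)

lemma iter_cont: "continuous_on A (f ^^ n)"
  using iter_hol holomorphic_on_imp_continuous_on by blast


lemma iter_grow: "R \<le> norm z \<Longrightarrow> 2 ^ n * norm z \<le> norm ((f ^^ n) z)"
proof (induction n)
  case (Suc n)
  have "norm z \<le> 2 ^ n * norm z" using mult_right_mono[of 1 "2 ^ n" "norm z"] by simp
  then have "R \<le> norm ((f ^^ n) z)" using Suc by linarith
  then have "2 * norm ((f ^^ n) z) \<le> norm ((f ^^ Suc n) z)" using grow by simp
  then show ?case using Suc by simp
qed simp

lemma iter_mono: "R \<le> norm ((f ^^ m) z) \<Longrightarrow> m \<le> n \<Longrightarrow> 2 ^ (n - m) * norm ((f ^^ m) z) \<le> norm ((f ^^ n) z)"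
  using iter_grow[of "(f ^^ m) z" "n - m"] by (simp flip: funpow_add[unfolded o_def] add: funpow_add[symmetric, THEN fun_cong, unfolded o_def])

lemma iter_mono': "R \<le> norm ((f ^^ m) z) \<Longrightarrow> m \<le> n \<Longrightarrow> norm ((f ^^ m) z) \<le> norm ((f ^^ n) z)"
  using iter_mono[of m z n] mult_right_mono[of 1 "2 ^ (n - m)" "norm ((f ^^ m) z)"] by simp

lemma iter_mono_less: "R \<le> norm ((f ^^ m) z) \<Longrightarrow> m < n \<Longrightarrow> norm ((f ^^ m) z) < norm ((f ^^ n) z)"
proof -
  assume a: "R \<le> norm ((f ^^ m) z)" "m < n"
  have "norm ((f ^^ m) z) < 2 * norm ((f ^^ m) z)" using a R by linarith
  also have "\<dots> \<le> norm ((f ^^ Suc m) z)" using grow a by simp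
  also have "\<dots> \<le> norm ((f ^^ n) z)" using calculation a by (intro iter_mono') auto
  finally show ?thesis .
qed

lemma escape_unbounded:
  assumes "R \<le> norm ((f ^^ m) z)"
  shows "\<exists>k. \<forall>n\<ge>k. b \<le> norm ((f ^^ n) z)"
proof -
  obtain i where i: "b / R < 2 ^ i" using real_arch_pow[of 2 "b / R"] by auto
  have "b \<le> norm ((f ^^ n) z)" if "n \<ge> m + i" for n
  proof -
    have "b \<le> 2 ^ i * R" using i R by (simp add: field_simps)
    also have "\<dots> \<le> 2 ^ (n - m) * norm ((f ^^ m) z)" using that assms R by (intro mult_mono power_increasing) auto
    also have "\<dots> \<le> norm ((f ^^ n) z)" using that assms by (intro iter_mono) auto
    finally show ?thesis .
  qed
  then show ?thesis by blast
qed

lemma filled_iff: "z \<in> K \<longleftrightarrow> (\<forall>n. norm ((f ^^ n) z) < R)"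
proof
  assume "z \<in> K"
  then obtain b where b: "\<And>n. norm ((f ^^ n) z) \<le> b" by (auto simp: filled_julia_def bounded_iff)
  show "\<forall>n. norm ((f ^^ n) z) < R"
  proof (rule ccontr)
    assume "\<not> ?thesis"
    then obtain m where "R \<le> norm ((f ^^ m) z)" by (auto simp: not_less)
    then obtain k where "\<forall>n\<ge>k. b + 1 \<le> norm ((f ^^ n) z)" using escape_unbounded by blast
    then show False using b[of k] by force
  qed
next
  assume "\<forall>n. norm ((f ^^ n) z) < R"
  then show "z \<in> K" by (auto simp: filled_julia_def bounded_iff intro: less_imp_le)
qed

lemma not_filledE: "z \<notin> K \<Longrightarrow> \<exists>m. R \<le> norm ((f ^^ m) z)"
  by (simp add: filled_iff not_less)

lemma filled_iff_le: "z \<in> K \<longleftrightarrow> (\<forall>n. norm ((f ^^ n) z) \<le> R)"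
proof
  assume a: "\<forall>n. norm ((f ^^ n) z) \<le> R"
  then show "z \<in> K" by (auto simp: filled_julia_def bounded_iff)
qed (auto simp: filled_iff intro: less_imp_le)

lemma iter_in_filled: "z \<in> K \<Longrightarrow> (f ^^ n) z \<in> K"
  by (auto simp: filled_iff simp flip: funpow_add[THEN fun_cong, unfolded o_def])

lemma closed_filled: "closed K"
proof -
  have "K = (\<Inter>n. {z. norm ((f ^^ n) z) \<le> R})" by (auto simp: filled_iff_le)
  moreover have "closed {z. norm ((f ^^ n) z) \<le> R}" for n
    by (intro closed_Collect_le continuous_intros iter_cont)
  ultimately show ?thesis by auto
qed

lemma filled_bound: "z \<in> K \<Longrightarrow> norm z < R"
  using filled_iff[of z] by (metis funpow_0)

lemma bounded_filled: "bounded K"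
  using filled_bound by (meson bounded_iff less_imp_le)

text \<open>
By the maximum principle a bounded component of the complement would consist of bounded orbits.
\<close>
lemma connected_Compl_filled: "connected (- K)"
proof (rule ccontr)
  assume "\<not> connected (- K)"
  then obtain C where C: "C \<in> components (- K)" "bounded C"
    using cobounded_has_bounded_component[of "- K"] bounded_filled by auto
  have openC: "open C" using C closed_filled by (meson open_Compl open_components)
  have fr: "frontier C \<subseteq> K"
    using C(1) closed_filled frontier_of_components_subset[of C "- K"]
    by (metis frontier_complement frontier_subset_eq order_trans)
  have "z \<in> K" if z: "z \<in> C" for z
    unfolding filled_iff_le
  proof
    fix n
    show "norm ((f ^^ n) z) \<le> R"
      by (rule maximum_modulus_frontier[OF iter_hol iter_cont C(2) _ z]) (use fr filled_iff_le in blast)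
  qed
  moreover have "C \<noteq> {}" "C \<subseteq> - K" using C in_components_nonempty in_components_subset by blast+
  ultimately show False by blast
qed

text \<open>
A sequence of iterates either repeats one iterate infinitely often, and then has a constant
subsequence, or its exponents tend to infinity, and then it diverges locally uniformly.
\<close>
lemma fatou_outside_filled:
  assumes z: "z \<notin> K" shows "z \<in> fatou_set f"
proof -
  obtain m where m: "R \<le> norm ((f ^^ m) z)" using not_filledE z by metis
  have "R < norm ((f ^^ Suc m) z)" using iter_mono_less[OF m, of "Suc m"] m by simp
  moreover have "open {w. R < norm ((f ^^ Suc m) w)}"
    by (intro open_Collect_less continuous_intros iter_cont)
  ultimately obtain e where e: "e > 0" "ball z e \<subseteq> {w. R < norm ((f ^^ Suc m) w)}"
    using open_contains_ball by (metis mem_Collect_eq)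
  have "normal_family_on (ball z e) (range (\<lambda>n. f ^^ n))"
    unfolding normal_family_on_def
  proof (intro allI impI)
    fix \<sigma> :: "nat \<Rightarrow> complex \<Rightarrow> complex" assume "range \<sigma> \<subseteq> range (\<lambda>n. f ^^ n)"
    then have "\<forall>k. \<exists>j. \<sigma> k = f ^^ j" by blast
    then obtain j where j: "\<And>k. \<sigma> k = f ^^ (j k)" by metis
    show "\<exists>r :: nat \<Rightarrow> nat. strict_mono r \<and>
           ((\<exists>g. \<forall>K. compact K \<and> K \<subseteq> ball z e \<longrightarrow> uniform_limit K (\<sigma> \<circ> r) g sequentially) \<or>
            (\<forall>K. compact K \<and> K \<subseteq> ball z e \<longrightarrow>
               (\<forall>B::real. \<forall>\<^sub>F n in sequentially. \<forall>z\<in>K. norm (\<sigma> (r n) z) \<ge> B)))"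
    proof (cases "\<exists>v. infinite {k. j k = v}")
      case True
      then obtain v where v: "infinite {k. j k = v}" by blast
      define r where "r = enumerate {k. j k = v}"
      have "strict_mono r" using v by (simp add: r_def strict_mono_enumerate)
      moreover have "j (r n) = v" for n using enumerate_in_set[OF v, of n] by (simp add: r_def)
      then have "\<sigma> \<circ> r = (\<lambda>_. f ^^ v)" by (auto simp: j)
      then have "uniform_limit A (\<sigma> \<circ> r) (f ^^ v) sequentially" for A by (simp add: uniform_limit_const)
      ultimately show ?thesis by blast
    next
      case False
      have lim: "\<forall>\<^sub>F n in sequentially. b \<le> j n" for b
      proof -
        have "{k. j k < b} = (\<Union>v<b. {k. j k = v})" by auto
        then have "finite {k. j k < b}" using False by simp
        then show ?thesis unfolding cofinite_eq_sequentially[symmetric] eventually_cofinite by (simp add: not_le)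
      qed
      have "\<forall>\<^sub>F n in sequentially. \<forall>w\<in>A. norm (\<sigma> n w) \<ge> B" if A: "A \<subseteq> ball z e" for A and B :: real
      proof -
        obtain i where i: "B / R < 2 ^ i" using real_arch_pow[of 2 "B / R"] by auto
        have "\<forall>\<^sub>F n in sequentially. Suc m + i \<le> j n" by (rule lim)
        then show ?thesis
        proof eventually_elim
          case (elim n)
          show ?case
          proof
            fix w assume "w \<in> A"
            then have w: "R < norm ((f ^^ Suc m) w)" using A e by auto
            have "B \<le> 2 ^ i * R" using i R by (simp add: field_simps)
            also have "\<dots> \<le> 2 ^ (j n - Suc m) * norm ((f ^^ Suc m) w)"
              using elim w R by (intro mult_mono power_increasing) auto
            also have "\<dots> \<le> norm (\<sigma> n w)" unfolding j using elim w by (intro iter_mono) auto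
            finally show "B \<le> norm (\<sigma> n w)" .
          qed
        qed
      qed
      then show ?thesis by (intro exI[of _ id]) (simp add: strict_mono_def)
    qed
  qed
  then show ?thesis unfolding fatou_set_def using e
    by (intro CollectI exI[of _ "ball z e"]) auto
qed

lemma fatou_interior_filled:
  assumes z: "z \<in> interior K" shows "z \<in> fatou_set f"
proof -
  obtain e where e: "e > 0" "ball z e \<subseteq> K" using z by (auto simp: mem_interior)
  have "normal_family_on (ball z e) (range (\<lambda>n. f ^^ n))"
    unfolding normal_family_on_def
  proof (intro allI impI)
    fix \<sigma> :: "nat \<Rightarrow> complex \<Rightarrow> complex" assume \<sigma>: "range \<sigma> \<subseteq> range (\<lambda>n. f ^^ n)"
    have bd: "\<exists>B. \<forall>h\<in>range (\<lambda>n. f ^^ n). \<forall>z\<in>A. norm (h z) \<le> B" if "A \<subseteq> ball z e" for A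
      using that e filled_iff_le by (intro exI[of _ R]) blast
    obtain g r where "strict_mono (r :: nat \<Rightarrow> nat)"
      "\<And>K. \<lbrakk>compact K; K \<subseteq> ball z e\<rbrakk> \<Longrightarrow> uniform_limit K (\<sigma> \<circ> r) g sequentially"
      by (rule Montel[OF open_ball, of "range (\<lambda>n. f ^^ n)" z e \<sigma>]) (use iter_hol bd \<sigma> in auto)
    then show "\<exists>r :: nat \<Rightarrow> nat. strict_mono r \<and>
           ((\<exists>g. \<forall>K. compact K \<and> K \<subseteq> ball z e \<longrightarrow> uniform_limit K (\<sigma> \<circ> r) g sequentially) \<or>
            (\<forall>K. compact K \<and> K \<subseteq> ball z e \<longrightarrow>
               (\<forall>B::real. \<forall>\<^sub>F n in sequentially. \<forall>z\<in>K. norm (\<sigma> (r n) z) \<ge> B)))" by blast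
  qed
  then show ?thesis unfolding fatou_set_def using e
    by (intro CollectI exI[of _ "ball z e"]) auto
qed

text \<open>
At a frontier point a convergent subsequence would have a limit that is finite at an
escaping point nearby, and a divergent one is excluded by the bounded orbit of the point itself.
\<close>
lemma frontier_filled_not_fatou:
  assumes z: "z \<in> frontier K" shows "z \<notin> fatou_set f"
proof
  assume "z \<in> fatou_set f"
  then obtain U where U: "open U" "z \<in> U" "normal_family_on U (range (\<lambda>n. f ^^ n))"
    by (auto simp: fatou_set_def)
  have zK: "z \<in> K" using z closed_filled frontier_subset_eq by blast
  obtain r :: "nat \<Rightarrow> nat" where r: "strict_mono r"
    and alt: "(\<exists>g. \<forall>K. compact K \<and> K \<subseteq> U \<longrightarrow> uniform_limit K ((\<lambda>n. f ^^ n) \<circ> r) g sequentially) \<or>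
            (\<forall>K. compact K \<and> K \<subseteq> U \<longrightarrow> (\<forall>B::real. \<forall>\<^sub>F n in sequentially. \<forall>z\<in>K. norm ((f ^^ r n) z) \<ge> B))"
    using U(3)[unfolded normal_family_on_def, rule_format, of "\<lambda>n. f ^^ n"] by auto
  from alt show False
  proof
    assume "\<forall>K. compact K \<and> K \<subseteq> U \<longrightarrow> (\<forall>B::real. \<forall>\<^sub>F n in sequentially. \<forall>z\<in>K. norm ((f ^^ r n) z) \<ge> B)"
    then have "\<forall>\<^sub>F n in sequentially. \<forall>w\<in>{z}. norm ((f ^^ r n) w) \<ge> R"
      using U(2) by (elim allE[of _ "{z}"]) simp
    then obtain n where "norm ((f ^^ r n) z) \<ge> R" by (auto simp: eventually_sequentially)
    then show False using zK filled_iff by (meson not_less)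
  next
    assume "\<exists>g. \<forall>K. compact K \<and> K \<subseteq> U \<longrightarrow> uniform_limit K ((\<lambda>n. f ^^ n) \<circ> r) g sequentially"
    then obtain g where g: "\<And>A. compact A \<Longrightarrow> A \<subseteq> U \<Longrightarrow> uniform_limit A ((\<lambda>n. f ^^ n) \<circ> r) g sequentially" by blast
    obtain e where e: "e > 0" "cball z e \<subseteq> U" using U open_contains_cball by metis
    have "\<not> cball z e \<subseteq> K" using z e by (auto simp: frontier_def mem_interior_cball)
    then obtain y where y: "y \<in> cball z e" "y \<notin> K" by blast
    have "\<forall>\<^sub>F n in sequentially. \<forall>x\<in>cball z e. dist ((f ^^ r n) x) (g x) < 1"
      using uniform_limitD[OF g[OF compact_cball e(2)], of 1] by simp
    then obtain n0 where n0: "\<And>n x. n \<ge> n0 \<Longrightarrow> x \<in> cball z e \<Longrightarrow> dist ((f ^^ r n) x) (g x) < 1"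
      unfolding eventually_sequentially by blast
    obtain m where "R \<le> norm ((f ^^ m) y)" using not_filledE y by metis
    then obtain k where k: "\<forall>n\<ge>k. norm (g y) + 1 \<le> norm ((f ^^ n) y)" using escape_unbounded by blast
    have "k \<le> r (max k n0)" using seq_suble[OF r, of "max k n0"] by simp
    then have "norm (g y) + 1 \<le> norm ((f ^^ r (max k n0)) y)" using k by blast
    moreover have "dist ((f ^^ r (max k n0)) y) (g y) < 1" using n0 y by simp
    ultimately show False using norm_triangle_ineq2[of "(f ^^ r (max k n0)) y" "g y"] by (simp add: dist_norm)
  qed
qed

theorem julia_set_eq: "julia_set f = frontier K"
proof -
  have "z \<in> fatou_set f \<longleftrightarrow> z \<notin> frontier K" for z
    using fatou_outside_filled[of z] fatou_interior_filled[of z] frontier_filled_not_fatou[of z] closed_filled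
    by (auto simp: frontier_def)
  then show ?thesis by (auto simp: julia_set_def)
qed

text \<open>
The plane is unicoherent, so the common boundary of the connected closed set and its connected
complement is connected. The converse is \<open>connected_of_connected_frontier\<close>.
\<close>
theorem connected_julia_iff: "connected (julia_set f) \<longleftrightarrow> connected K"
  unfolding julia_set_eq
  using connected_frontier_simple[OF _ connected_Compl_filled] connected_of_connected_frontier[OF closed_filled] by blast

lemma deriv_iter: "deriv (f ^^ n) z = (\<Prod>i<n. deriv f ((f ^^ i) z))"
proof (induction n)
  case (Suc n)
  have "deriv (f \<circ> (f ^^ n)) z = deriv f ((f ^^ n) z) * deriv (f ^^ n) z"
    by (rule deriv_chain) (use f_hol[of UNIV] iter_hol[of n UNIV] in \<open>auto simp: holomorphic_on_def field_differentiable_at_within\<close>)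
  moreover have "f ^^ Suc n = f \<circ> (f ^^ n)" by simp
  ultimately have "deriv (f ^^ Suc n) z = deriv f ((f ^^ n) z) * (\<Prod>i<n. deriv f ((f ^^ i) z))" using Suc by metis
  then show ?case unfolding prod.lessThan_Suc by (simp only: mult.commute)
qed (simp add: id_def)

lemma deriv_iter_zero_iff: "deriv (f ^^ n) z = 0 \<longleftrightarrow> (\<exists>i<n. deriv f ((f ^^ i) z) = 0)"
  unfolding deriv_iter by auto

lemma iter_add: "(f ^^ (m + n)) z = (f ^^ m) ((f ^^ n) z)" by (simp add: funpow_add)

end

locale monic_map = escaping_map +
  fixes d :: nat
  assumes f: "asymp_monomial d 1 f" and f0: "f 0 = 0"
begin

lemma iter_0: "(f ^^ n) 0 = 0" by (induction n) (auto simp: f0)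

lemma iter_asymp: "asymp_monomial (d ^ n) 1 (f ^^ n)"
proof (induction n)
  case (Suc n)
  show ?case using asymp_monomial_comp[OF f Suc] by (simp only: funpow.simps power_Suc2)
qed (simp only: funpow.simps power_0 One_nat_def asymp_monomial_id)

lemma iter_zero_filled: "(f ^^ n) z = 0 \<Longrightarrow> z \<in> K"
proof (rule ccontr)
  assume z: "(f ^^ n) z = 0" "z \<notin> K"
  obtain m where "R \<le> norm ((f ^^ m) z)" using not_filledE z by metis
  then obtain k where k: "\<forall>j\<ge>k. 1 \<le> norm ((f ^^ j) z)" using escape_unbounded by blast
  then have "1 \<le> norm ((f ^^ (k + n)) z)" by simp
  then show False using z iter_0 by (simp add: iter_add)
qed

lemma sublevel_connected_of_filled:
  assumes "connected K" "R \<le> t"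
  shows "connected {z. norm ((f ^^ n) z) < t}"
proof -
  have "connected {z \<in> UNIV. norm ((f ^^ n) z) < t}"
  proof (rule sublevel_connectedI[OF open_UNIV iter_hol])
    show "compact {z \<in> UNIV. norm ((f ^^ n) z) \<le> t}" using asymp_monomial_compact_sublevel[OF iter_asymp] by simp
    fix a b assume "(f ^^ n) a = 0" "(f ^^ n) b = 0"
    then have "a \<in> K" "b \<in> K" using iter_zero_filled by metis+
    moreover have "K \<subseteq> {z \<in> UNIV. norm ((f ^^ n) z) < t}" using less_le_trans[OF _ assms(2)] filled_iff by auto
    ultimately show "connected_component {z \<in> UNIV. norm ((f ^^ n) z) < t} a b"
      using assms(1) unfolding connected_component_def by blast
  qed
  then show ?thesis by simp
qed

text \<open>
The filled Julia set is the nested intersection of the closures of the given sublevel sets.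
\<close>
lemma filled_connected_of_sublevels:
  assumes conn: "\<And>n. connected {z. norm ((f ^^ n) z) < t}" and t: "R < t"
  shows "connected K"
proof -
  define S where "S n = closure {z. norm ((f ^^ n) z) < t}" for n
  have Sle: "S n \<subseteq> {z. norm ((f ^^ n) z) \<le> t}" for n
    unfolding S_def by (intro closure_minimal closed_Collect_le continuous_intros iter_cont) (auto intro: less_imp_le)
  have "connected (\<Inter>(range S))"
  proof (rule connected_nest)
    show "compact (S n)" for n
      using asymp_monomial_compact_sublevel[OF iter_asymp, of n t] Sle[of n]
      by (metis S_def closed_closure compact_Int_closed inf.absorb_iff2)
    show "connected (S n)" for n unfolding S_def by (intro connected_imp_connected_closure conn)
    show "S n \<subseteq> S m" if "m \<le> n" for m n
      unfolding S_def
    proof (intro closure_mono subsetI CollectI)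
      fix z assume z: "z \<in> {z. norm ((f ^^ n) z) < t}"
      show "norm ((f ^^ m) z) < t"
      proof (rule ccontr)
        assume "\<not> ?thesis"
        then have "t \<le> norm ((f ^^ m) z)" by simp
        moreover then have "norm ((f ^^ m) z) \<le> norm ((f ^^ n) z)" using t that by (intro iter_mono') auto
        ultimately show False using z by simp
      qed
    qed
  qed
  moreover have "\<Inter>(range S) = K"
  proof (intro equalityI subsetI)
    fix z assume "z \<in> \<Inter>(range S)"
    then have "norm ((f ^^ n) z) \<le> t" for n using Sle by blast
    then show "z \<in> K" by (auto simp: filled_julia_def bounded_iff)
  next
    fix z assume "z \<in> K"
    then have "norm ((f ^^ n) z) < t" for n using filled_iff t by (meson less_trans)
    then have "z \<in> S n" for n using closure_subset[of "{z. norm ((f ^^ n) z) < t}"] unfolding S_def by blast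
    then show "z \<in> \<Inter>(range S)" by blast
  qed
  ultimately show ?thesis by simp
qed

text \<open>
If the critical orbits are bounded, the critical values of all iterates lie within the escape radius, so the
sublevel sets above it are connected. If the filled Julia set is connected,
it joins all zeros of an iterate, so again these sublevel sets are connected; then the
iterate has a root outside them and is therefore without critical points there.
\<close>
theorem connected_filled_iff: "connected K \<longleftrightarrow> (\<forall>c. deriv f c = 0 \<longrightarrow> c \<in> K)"
proof
  assume crit: "\<forall>c. deriv f c = 0 \<longrightarrow> c \<in> K"
  have "connected {z. norm ((f ^^ n) z) < R + 1}" for n
  proof (rule sublevel_connected_of_critical_values[OF iter_asymp])
    show "norm ((f ^^ n) z) \<le> R" if z: "deriv (f ^^ n) z = 0" for z
    proof -
      obtain i where i: "i < n" "deriv f ((f ^^ i) z) = 0" using z deriv_iter_zero_iff by blast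
      then have "(f ^^ (n - i)) ((f ^^ i) z) \<in> K" using crit iter_in_filled by blast
      then have "(f ^^ n) z \<in> K" using i iter_add[of "n - i" i z] by simp
      then show ?thesis using filled_bound less_imp_le by blast
    qed
  qed (use R in auto)
  then show "connected K" by (rule filled_connected_of_sublevels) simp
next
  assume conn: "connected K"
  show "\<forall>c. deriv f c = 0 \<longrightarrow> c \<in> K"
  proof (intro allI impI, rule ccontr)
    fix c assume c: "deriv f c = 0" "c \<notin> K"
    then obtain m where m: "R \<le> norm ((f ^^ m) c)" using filled_iff not_less by blast
    have Rm: "R < norm ((f ^^ Suc m) c)" using iter_mono_less[OF m, of "Suc m"] m by simp
    interpret S: superlevel "d ^ Suc m" 1 "f ^^ Suc m" R
      by (rule superlevel.intro[OF iter_asymp iter_0 R])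
    obtain \<phi> where \<phi>: "continuous_on {z. R < norm ((f ^^ Suc m) z)} \<phi>"
        "\<And>z. R < norm ((f ^^ Suc m) z) \<Longrightarrow> \<phi> z ^ (d ^ Suc m) = (f ^^ Suc m) z"
      using S.superlevel_root_exists[OF refl sublevel_connected_of_filled[OF conn less_imp_le]] by metis
    interpret T: superlevel_root "d ^ Suc m" 1 "f ^^ Suc m" R \<phi>
      by (rule superlevel_root.intro[OF S.superlevel_axioms superlevel_root_axioms.intro[OF \<phi>]])
    have "deriv (f ^^ Suc m) c \<noteq> 0" using T.deriv_nonzero_of_root[OF Rm] .
    moreover have "deriv (f ^^ Suc m) c = 0" unfolding deriv_iter_zero_iff using c by (intro exI[of _ 0]) auto
    ultimately show False by simp
  qed
qed

end

section \<open>An indifferent fixed point and the critical orbits\<close>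

lemma Riemann_map_normalized:
  assumes S: "open S" "simply_connected S" "S \<noteq> UNIV" "a \<in> S"
  obtains \<psi> g where "\<psi> holomorphic_on S" "g holomorphic_on ball (0::complex) 1" "\<psi> a = 0"
    "\<And>z. z \<in> S \<Longrightarrow> \<psi> z \<in> ball 0 1" "\<And>z. z \<in> S \<Longrightarrow> g (\<psi> z) = z"
    "\<And>w. w \<in> ball 0 1 \<Longrightarrow> g w \<in> S" "\<And>w. w \<in> ball 0 1 \<Longrightarrow> \<psi> (g w) = w"
proof -
  obtain f g where fg: "f holomorphic_on S" "g holomorphic_on ball 0 1"
    "\<And>z. z \<in> S \<Longrightarrow> f z \<in> ball 0 1 \<and> g (f z) = z" "\<And>w. w \<in> ball 0 1 \<Longrightarrow> g w \<in> S \<and> f (g w) = w"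
    using S Riemann_mapping_theorem[of S] by blast
  obtain m k where mk: "m (f a) = 0" "m holomorphic_on ball 0 1" "m ` ball 0 1 \<subseteq> ball 0 1"
    "k holomorphic_on ball 0 1" "k ` ball 0 1 \<subseteq> ball 0 1"
    "\<And>z. z \<in> ball 0 1 \<Longrightarrow> m (k z) = z" "\<And>z. z \<in> ball 0 1 \<Longrightarrow> k (m z) = z"
    using ball_biholomorphism_exists[of "f a"] fg(3)[OF S(4)] by metis
  have m: "m w \<in> ball 0 1" and k: "k w \<in> ball 0 1" if "w \<in> ball 0 1" for w using mk(3,5) that by blast+
  show ?thesis
  proof
    show "(m \<circ> f) holomorphic_on S" using holomorphic_on_compose_gen[OF fg(1) mk(2)] fg(3) by blast
    show "(g \<circ> k) holomorphic_on ball 0 1" using holomorphic_on_compose_gen[OF mk(4) fg(2)] k by blast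
    show "(m \<circ> f) a = 0" using mk by simp
    show "(m \<circ> f) z \<in> ball 0 1" if "z \<in> S" for z using fg(3)[OF that] m by simp
    show "(g \<circ> k) ((m \<circ> f) z) = z" if "z \<in> S" for z using fg(3)[OF that] mk(7) by simp
    show "(g \<circ> k) w \<in> S" if "w \<in> ball 0 1" for w using fg(4)[OF k[OF that]] by simp
    show "(m \<circ> f) ((g \<circ> k) w) = w" if "w \<in> ball 0 1" for w using fg(4)[OF k[OF that]] mk(6)[OF that] by simp
  qed
qed

text \<open>
By the maximum principle the inside of a loop in the component stays below the level and so
belongs to the same component.
\<close>
lemma simply_connected_sublevel_component:
  assumes p: "p holomorphic_on UNIV"
  shows "simply_connected (connected_component_set {z. norm (p z) < r} a)"
proof -
  let ?S = "{z. norm (p z) < r}" and ?W = "connected_component_set {z. norm (p z) < r} a"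
  have contp: "continuous_on A p" for A using p holomorphic_on_imp_continuous_on continuous_on_subset by blast
  have "open ?S" by (intro open_Collect_less continuous_intros contp)
  then have openW: "open ?W" by (rule open_connected_component)
  show ?thesis unfolding simply_connected_eq_winding_number_zero[OF openW]
  proof (intro conjI allI impI, simp, elim conjE)
    fix \<gamma> z assume \<gamma>: "path \<gamma>" "path_image \<gamma> \<subseteq> ?W" "pathfinish \<gamma> = pathstart \<gamma>" and z: "z \<notin> ?W"
    obtain x where x: "x \<in> path_image \<gamma>" "\<And>v. v \<in> path_image \<gamma> \<Longrightarrow> norm (p v) \<le> norm (p x)"
      using continuous_attains_sup[OF compact_path_image[OF \<gamma>(1)] path_image_nonempty, of "\<lambda>v. norm (p v)"]
        continuous_on_norm[OF contp] by blast
    have xS: "norm (p x) < r" using x \<gamma> connected_component_subset[of ?S a] by blast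
    have cl: "closed (path_image \<gamma>)" using closed_path_image[OF \<gamma>(1)] .
    have ins: "norm (p v) < r" if v: "v \<in> inside (path_image \<gamma>)" for v
    proof -
      let ?C = "connected_component_set (- path_image \<gamma>) v"
      have vC: "v \<notin> path_image \<gamma>" "bounded ?C" using v by (auto simp: inside_def)
      have "frontier ?C \<subseteq> path_image \<gamma>"
        using frontier_of_components_closed_complement[OF cl] vC by (simp add: componentsI)
      then have "norm (p v) \<le> norm (p x)"
      proof (intro maximum_modulus_frontier[where f = p and S = ?C and \<xi> = v and B = "norm (p x)"])
        show "p holomorphic_on interior ?C" using p holomorphic_on_subset by blast
        show "continuous_on (closure ?C) p" by (rule contp)
        show "bounded ?C" by (rule vC(2))
        show "v \<in> ?C" using vC(1) by simp
      qed (use x in blast)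
      then show ?thesis using xS by simp
    qed
    have "connected (path_image \<gamma> \<union> inside (path_image \<gamma>))"
      by (intro connected_with_inside cl connected_path_image \<gamma>)
    moreover have "path_image \<gamma> \<union> inside (path_image \<gamma>) \<subseteq> ?S"
      using ins \<gamma>(2) connected_component_subset[of ?S a] by blast
    ultimately have "path_image \<gamma> \<union> inside (path_image \<gamma>) \<subseteq> connected_component_set ?S x"
      using x(1) by (intro connected_component_maximal) auto
    moreover have "connected_component_set ?S x = ?W" using x(1) \<gamma>(2) by (metis connected_component_eq subsetD)
    ultimately have "z \<notin> path_image \<gamma> \<union> inside (path_image \<gamma>)" using z by blast
    then have "z \<in> outside (path_image \<gamma>)" unfolding union_with_inside by simp
    then show "winding_number \<gamma> z = 0" using winding_number_zero_in_outside \<gamma> by blast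
  qed
qed

text \<open>
Around a simple zero there is a circle on which \<open>|F|\<close> is bounded below, and a small connected sublevel
set cannot cross it.
\<close>
lemma unique_zero_of_connected_sublevels:
  assumes W: "open W" "F holomorphic_on W" and a: "a \<in> W" "F a = 0" "deriv F a \<noteq> 0"
    and conn: "\<And>t. \<lbrakk>0 < t; t \<le> 1\<rbrakk> \<Longrightarrow> connected {z \<in> W. norm (F z) < t}"
    and b: "b \<in> W" "F b = 0"
  shows "b = a"
proof (rule ccontr)
  assume ba: "b \<noteq> a"
  obtain \<rho> where \<rho>: "\<rho> > 0" "ball a \<rho> \<subseteq> W" "inj_on F (ball a \<rho>)"
    using has_complex_derivative_locally_invertible[OF W(2) a(1) W(1) a(3)] by metis
  define \<epsilon> where "\<epsilon> = min (\<rho> / 2) (norm (b - a) / 2)"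
  have \<epsilon>: "\<epsilon> > 0" "\<epsilon> < \<rho>" "\<epsilon> < norm (b - a)" using \<rho> ba by (auto simp: \<epsilon>_def min_def)
  have sub: "sphere a \<epsilon> \<subseteq> ball a \<rho>" using \<epsilon> by auto
  have "continuous_on (sphere a \<epsilon>) (\<lambda>z. norm (F z))"
    using sub \<rho> W by (intro continuous_intros continuous_on_subset[OF holomorphic_on_imp_continuous_on[OF W(2)]]) auto
  then obtain x where x: "x \<in> sphere a \<epsilon>" "\<And>z. z \<in> sphere a \<epsilon> \<Longrightarrow> norm (F x) \<le> norm (F z)"
    using continuous_attains_inf[of "sphere a \<epsilon>" "\<lambda>z. norm (F z)"] \<epsilon>(1) by auto
  have "F x \<noteq> F a"
  proof
    assume "F x = F a"
    then have "x = a" using inj_onD[OF \<rho>(3), of x a] x sub \<rho> by auto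
    then show False using x \<epsilon> by simp
  qed
  then have Fx: "norm (F x) > 0" using a by simp
  define t where "t = min 1 (norm (F x))"
  let ?S = "{z \<in> W. norm (F z) < t}"
  have t: "0 < t" "t \<le> 1" using Fx by (auto simp: t_def)
  have "?S \<inter> frontier (ball a \<epsilon>) \<noteq> {}"
  proof (rule connected_Int_frontier[OF conn[OF t]])
    show "?S \<inter> ball a \<epsilon> \<noteq> {}" using a t \<epsilon> by (intro ex_in_conv[THEN iffD1] exI[of _ a]) auto
    show "?S - ball a \<epsilon> \<noteq> {}" using b t \<epsilon> by (intro ex_in_conv[THEN iffD1] exI[of _ b]) (auto simp: dist_norm norm_minus_commute)
  qed
  moreover have "frontier (ball a \<epsilon>) = sphere a \<epsilon>" using \<epsilon>(1) by simp
  ultimately obtain y where "y \<in> sphere a \<epsilon>" "norm (F y) < t" by blast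
  then show False using x(2)[of y] by (simp add: t_def)
qed

context monic_map
begin

text \<open>
Suppose that all critical points escape. Let \<open>W n\<close> be the component of \<open>{|f^n| < R}\<close> around
the fixed point \<open>0\<close>. For large \<open>k\<close> there are no critical points in \<open>W (k+1)\<close>, so
\<open>f\<close> maps it properly and without branching onto the disc-like \<open>W k\<close>, hence bijectively. The inverse branch
maps \<open>W k\<close> into itself with a multiplier of modulus one, so by the Schwarz lemma it is
an automorphism and \<open>W (k+1) = W k\<close>. This is impossible, because the closure of \<open>W (k+1)\<close> lies
in the next larger sublevel set and \<open>W k\<close> would be open and closed.
\<close>
theorem critical_point_bounded_of_indifferent:
  assumes fin: "finite {c. deriv f c = 0}" and indiff: "norm (deriv f 0) = 1"
  shows "\<exists>c\<in>K. deriv f c = 0"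
proof (rule ccontr)
  assume none: "\<not> ?thesis"
  define S where "S n = {z. norm ((f ^^ n) z) < R}" for n
  define W where "W n = connected_component_set (S n) 0" for n
  have openS: "open (S n)" for n unfolding S_def by (intro open_Collect_less continuous_intros iter_cont)
  have S0: "0 \<in> S n" for n using R iter_0 by (simp add: S_def)
  have W0: "0 \<in> W n" and WS: "W n \<subseteq> S n" and connW: "connected (W n)" and openW: "open (W n)" for n
    using S0 openS by (simp_all add: W_def connected_component_subset open_connected_component)
  have Wmax: "P \<subseteq> W n" if "connected P" "0 \<in> P" "P \<subseteq> S n" for P n
    using that by (simp add: W_def connected_component_maximal)
  have S_dec: "S (Suc n) \<subseteq> S n" for n
    using iter_mono'[of n _ "Suc n"] by (force simp: S_def not_le[symmetric])
  have boundedS: "bounded (S n)" for n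
    by (rule bounded_subset[OF compact_imp_bounded[OF asymp_monomial_compact_sublevel[OF iter_asymp, of n R]]]) (auto simp: S_def)
  have boundedW: "bounded (W n)" for n using boundedS WS bounded_subset by blast
  have "\<exists>k. \<forall>c. deriv f c = 0 \<longrightarrow> R \<le> norm ((f ^^ k) c)"
  proof -
    have "\<forall>c. \<exists>m. deriv f c = 0 \<longrightarrow> R \<le> norm ((f ^^ m) c)" using none not_filledE by blast
    then obtain m where m: "\<And>c. deriv f c = 0 \<Longrightarrow> R \<le> norm ((f ^^ m c) c)" by metis
    have "R \<le> norm ((f ^^ (\<Sum>c | deriv f c = 0. m c)) c)" if c: "deriv f c = 0" for c
    proof -
      have "m c \<le> (\<Sum>c | deriv f c = 0. m c)" using member_le_sum[of c "{c. deriv f c = 0}" m] fin c by simp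
      then show ?thesis using iter_mono'[OF m[OF c]] m[OF c] by (meson order_trans)
    qed
    then show ?thesis by blast
  qed
  then obtain k where k: "\<And>c. deriv f c = 0 \<Longrightarrow> R \<le> norm ((f ^^ k) c)" by blast
  have k': "deriv f z \<noteq> 0" if "z \<in> S (Suc k)" for z
    using that k[of z] S_dec[of k] by (auto simp: S_def)
  have fW: "f z \<in> W k" if "z \<in> W (Suc k)" for z
  proof -
    have "connected (f ` W (Suc k))"
      using connected_continuous_image[OF holomorphic_on_imp_continuous_on[OF f_hol] connW] .
    moreover have "0 \<in> f ` W (Suc k)" using W0 f0 by (metis imageI)
    moreover have "f ` W (Suc k) \<subseteq> S k" using WS[of "Suc k"] by (auto simp: S_def funpow_swap1)
    ultimately show ?thesis using Wmax that by blast
  qed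
  have "simply_connected (W k)" unfolding W_def S_def by (intro simply_connected_sublevel_component iter_hol)
  moreover have "W k \<noteq> UNIV" using boundedW[of k] by auto
  ultimately obtain \<psi> g where \<psi>: "\<psi> holomorphic_on W k" "g holomorphic_on ball 0 1" "\<psi> 0 = 0"
    "\<And>z. z \<in> W k \<Longrightarrow> \<psi> z \<in> ball 0 1" "\<And>z. z \<in> W k \<Longrightarrow> g (\<psi> z) = z"
    "\<And>w. w \<in> ball 0 1 \<Longrightarrow> g w \<in> W k" "\<And>w. w \<in> ball 0 1 \<Longrightarrow> \<psi> (g w) = w"
    using Riemann_map_normalized[OF openW _ _ W0] by metis
  have inj\<psi>: "inj_on \<psi> (W k)" using \<psi>(5) by (metis inj_on_inverseI)
  have d\<psi>: "deriv \<psi> z \<noteq> 0" if "z \<in> W k" for z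
    using holomorphic_injective_imp_regular[OF \<psi>(1) openW inj\<psi> that] .
  \<comment> \<open>In the disc coordinate of the target, f becomes a proper map to the unit disc.\<close>
  define F where "F = \<psi> \<circ> f"
  have Fhol: "F holomorphic_on W (Suc k)"
    unfolding F_def by (rule holomorphic_on_compose_gen[OF f_hol \<psi>(1)]) (use fW in blast)
  have dF: "deriv F z = deriv \<psi> (f z) * deriv f z" if "z \<in> W (Suc k)" for z
    unfolding F_def
  proof (rule deriv_chain)
    show "f field_differentiable at z" using f_hol[of UNIV] by (simp add: holomorphic_on_imp_differentiable_at)
    show "\<psi> field_differentiable at (f z)" using holomorphic_on_imp_differentiable_at[OF \<psi>(1) openW fW[OF that]] .
  qed
  have dFnz: "deriv F z \<noteq> 0" if "z \<in> W (Suc k)" for z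
  proof -
    have "deriv f z \<noteq> 0" using k' WS that by blast
    then show ?thesis using dF[OF that] d\<psi>[OF fW[OF that]] by simp
  qed
  have F0: "F 0 = 0" by (simp add: F_def f0 \<psi>(3))
  have Fb: "norm (F z) < 1" if "z \<in> W (Suc k)" for z using \<psi>(4)[OF fW[OF that]] by (simp add: F_def)
  have comp: "compact {z \<in> W (Suc k). norm (F z) \<le> t}" if t: "t < 1" for t
  proof -
    define C where "C = g ` cball 0 t"
    have CW: "C \<subseteq> W k" using \<psi>(6) t by (auto simp: C_def)
    have "compact C" unfolding C_def using t
      by (intro compact_continuous_image continuous_on_subset[OF holomorphic_on_imp_continuous_on[OF \<psi>(2)]]) auto
    then have "closed (f -` C)"
      using closed_vimage[OF compact_imp_closed holomorphic_on_imp_continuous_on[OF f_hol[of UNIV]]] by blast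
    then have "compact (closure (W (Suc k)) \<inter> f -` C)"
      using boundedW by (simp add: compact_closure compact_Int_closed)
    moreover have "{z \<in> W (Suc k). norm (F z) \<le> t} = closure (W (Suc k)) \<inter> f -` C"
    proof (intro equalityI subsetI)
      fix z assume z: "z \<in> {z \<in> W (Suc k). norm (F z) \<le> t}"
      then have "f z = g (F z)" using \<psi>(5)[OF fW] by (simp add: F_def)
      then have "f z \<in> C" using z by (simp add: C_def)
      then show "z \<in> closure (W (Suc k)) \<inter> f -` C" using z closure_subset by blast
    next
      fix z assume z: "z \<in> closure (W (Suc k)) \<inter> f -` C"
      then have "f z \<in> S k" using CW WS by blast
      then have "z \<in> S (Suc k)" by (simp add: S_def funpow_swap1)
      then have zW: "z \<in> W (Suc k)" using connected_component_closure_subset[OF openS] z by (simp add: W_def)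
      obtain w where w: "w \<in> cball 0 t" "f z = g w" using z by (auto simp: C_def)
      then have "F z = w" using \<psi>(7)[of w] t by (simp add: F_def)
      then show "z \<in> {z \<in> W (Suc k). norm (F z) \<le> t}" using zW w by simp
    qed
    ultimately show ?thesis by simp
  qed
  have conn: "connected {z \<in> W (Suc k). norm (F z) < t}" if t: "0 < t" "t \<le> 1" for t
  proof (rule sublevel_connected_descend[OF openW Fhol comp])
    have "{z \<in> W (Suc k). norm (F z) < 1} = W (Suc k)" using Fb by blast
    then show "connected {z \<in> W (Suc k). norm (F z) < 1}" using connW by simp
  qed (use dFnz t in auto)
  have uniq: "z = 0" if "z \<in> W (Suc k)" "F z = 0" for z
    using unique_zero_of_connected_sublevels[OF openW Fhol W0 F0 dFnz[OF W0] conn that] .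
  have inj: "inj_on F (W (Suc k))"
    by (rule proper_simple_zero_bij(1)[OF openW Fhol comp Fb W0 F0 uniq dFnz[OF W0]])
  have im: "F ` W (Suc k) = ball 0 1"
    by (rule proper_simple_zero_bij(2)[OF openW Fhol comp Fb W0 F0 uniq dFnz[OF W0]])
  obtain G where G: "G holomorphic_on ball 0 1" "\<And>z. z \<in> W (Suc k) \<Longrightarrow> G (F z) = z"
    "\<And>z. z \<in> W (Suc k) \<Longrightarrow> deriv F z * deriv G (F z) = 1"
    using holomorphic_has_inverse[OF Fhol openW inj] im by metis
  have GW: "G w \<in> W (Suc k)" if "w \<in> ball 0 1" for w using G(2) that im by (metis imageE)
  have W_dec: "W (Suc k) \<subseteq> W k"
    by (rule Wmax[OF connW W0]) (use WS S_dec in blast)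
  \<comment> \<open>The inverse branch of f, read in the disc coordinate.\<close>
  define H where "H = \<psi> \<circ> G"
  have G0: "G 0 = 0" using G(2)[OF W0] F0 by simp
  have dG: "deriv F 0 * deriv G 0 = 1" using G(3)[OF W0] F0 by simp
  have dH: "deriv H 0 = deriv \<psi> 0 * deriv G 0"
  proof -
    have "deriv H 0 = deriv \<psi> (G 0) * deriv G 0" unfolding H_def
    proof (rule deriv_chain)
      show "G field_differentiable at 0" using holomorphic_on_imp_differentiable_at[OF G(1)] by simp
      show "\<psi> field_differentiable at (G 0)" using holomorphic_on_imp_differentiable_at[OF \<psi>(1) openW W0] G0 by simp
    qed
    then show ?thesis using G0 by simp
  qed
  have "norm (deriv H 0) = 1"
  proof -
    have "deriv F 0 = deriv \<psi> 0 * deriv f 0" using dF[OF W0] f0 by simp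
    then have "deriv H 0 * deriv f 0 = 1" using dG dH by (simp add: mult_ac)
    then have "norm (deriv H 0) * norm (deriv f 0) = 1" by (metis norm_mult norm_one)
    then show ?thesis using indiff by simp
  qed
  moreover have "H holomorphic_on ball 0 1"
    unfolding H_def by (rule holomorphic_on_compose_gen[OF G(1) \<psi>(1)]) (use GW W_dec in blast)
  moreover have "H 0 = 0" using G0 \<psi>(3) by (simp add: H_def)
  moreover have "norm (H z) < 1" if "norm z < 1" for z
    using \<psi>(4)[of "G z"] GW[of z] W_dec that by (auto simp: H_def)
  ultimately obtain \<alpha> where \<alpha>: "\<And>z. norm z < 1 \<Longrightarrow> H z = \<alpha> * z" "norm \<alpha> = 1"
    using Schwarz_Lemma(3)[of H 0] by auto
  have "W k \<subseteq> W (Suc k)"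
  proof
    fix y assume y: "y \<in> W k"
    have "norm (\<psi> y / \<alpha>) < 1" using \<psi>(4)[OF y] \<alpha>(2) by (simp add: norm_divide)
    then have "H (\<psi> y / \<alpha>) = \<psi> y" and GWy: "G (\<psi> y / \<alpha>) \<in> W (Suc k)" using \<alpha> GW by auto
    then have "\<psi> (G (\<psi> y / \<alpha>)) = \<psi> y" by (simp add: H_def)
    then have "G (\<psi> y / \<alpha>) = y" using inj_onD[OF inj\<psi>] y GWy W_dec by blast
    then show "y \<in> W (Suc k)" using GWy by simp
  qed
  then have "W k \<subseteq> S (Suc k)" using WS by blast
  then have "closure (W k) \<subseteq> {z. norm ((f ^^ Suc k) z) \<le> R}"
    by (intro closure_minimal closed_Collect_le continuous_intros iter_cont) (auto simp: S_def)
  moreover have "{z. norm ((f ^^ Suc k) z) \<le> R} \<subseteq> S k"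
    using iter_mono_less[of k _ "Suc k"] by (force simp: S_def not_le[symmetric])
  ultimately have "closure (W k) \<subseteq> S k" by simp
  moreover have "0 \<in> closure (W k)" using W0[of k] closure_subset by blast
  ultimately have "closure (W k) \<subseteq> W k" using Wmax[OF connected_imp_connected_closure[OF connW]] by simp
  then have "closed (W k)" by (simp add: closure_subset_eq)
  then have "W k = UNIV" using openW W0 clopen by blast
  then show False using \<open>W k \<noteq> UNIV\<close> by simp
qed

end

section \<open>Roots depending on a parameter\<close>

lemma Ln_divide_right_half_plane:
  assumes "0 < Re a" "0 < Re b" shows "Ln (a / b) = Ln a - Ln b"
proof (rule Ln_unique)
  have nz: "a \<noteq> 0" "b \<noteq> 0" using assms by auto
  show "exp (Ln a - Ln b) = a / b" using nz by (simp add: exp_diff)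
  have "\<bar>Im (Ln a)\<bar> < pi / 2" "\<bar>Im (Ln b)\<bar> < pi / 2"
    using Re_Ln_pos_lt[of a] Re_Ln_pos_lt[of b] assms nz by auto
  then show "- pi < Im (Ln a - Ln b)" "Im (Ln a - Ln b) \<le> pi" by auto
qed

lemma Re_pos_near_1: "norm (a - 1) < 1 \<Longrightarrow> 0 < Re a"
  using abs_Re_le_cmod[of "a - 1"] by simp

lemma exp_Ln_root: "0 < N \<Longrightarrow> a \<noteq> 0 \<Longrightarrow> exp (Ln a / of_nat N) ^ N = a"
  by (simp flip: exp_of_nat_mult)

lemma continuous_on_Ln_near_1:
  assumes "continuous_on S g" "\<And>x. x \<in> S \<Longrightarrow> norm (g x - 1) < 1"
  shows "continuous_on S (\<lambda>x. exp (Ln (g x) / of_nat N))"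
proof (cases "N = 0")
  case False
  have "g x \<notin> \<real>\<^sub>\<le>\<^sub>0" if "x \<in> S" for x
    using Re_pos_near_1[OF assms(2)[OF that]] by (auto simp: complex_nonpos_Reals_iff)
  then show ?thesis using assms(1) False by (intro continuous_intros) auto
qed simp

text \<open>
The quotient of two \<open>N\<close>-th roots of the same function is continuous and takes values in the finite
set of \<open>N\<close>-th roots of unity.
\<close>
lemma root_quotient_constant:
  assumes "connected S" "continuous_on S \<phi>" "continuous_on S \<rho>" "0 < N"
    and "\<And>z. z \<in> S \<Longrightarrow> \<phi> z ^ N = \<rho> z ^ N" "\<And>z. z \<in> S \<Longrightarrow> \<rho> z \<noteq> (0::complex)"
    and "x \<in> S" "y \<in> S"
  shows "\<phi> x / \<rho> x = \<phi> y / \<rho> y"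
proof -
  have "(\<lambda>z. \<phi> z / \<rho> z) constant_on S"
  proof (rule continuous_finite_range_constant)
    show "continuous_on S (\<lambda>z. \<phi> z / \<rho> z)" using assms by (intro continuous_intros) auto
    have "(\<lambda>z. \<phi> z / \<rho> z) ` S \<subseteq> {w. w ^ N = 1}" using assms(5,6) by (auto simp: power_divide)
    then show "finite ((\<lambda>z. \<phi> z / \<rho> z) ` S)" using \<open>0 < N\<close> finite_roots_unity[of N] finite_subset by auto
  qed (rule assms)
  then show ?thesis using assms(7,8) by (auto simp: constant_on_def)
qed

text \<open>
Both numbers are close to \<open>1\<close>, so the angle between them is acute.
\<close>
lemma norm_add_pos_multiple_gt:
  fixes a b :: complex
  assumes a: "norm (a - 1) \<le> 1/10" and b: "norm (b - 1) \<le> 1/10" and t: "(t::real) > 0"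
  shows "norm a < norm (a + of_real t * b)"
proof -
  have "\<bar>Re a - 1\<bar> \<le> 1/10" "\<bar>Im a\<bar> \<le> 1/10" "\<bar>Re b - 1\<bar> \<le> 1/10" "\<bar>Im b\<bar> \<le> 1/10"
    using order_trans[OF abs_Re_le_cmod a] order_trans[OF abs_Im_le_cmod a] order_trans[OF abs_Re_le_cmod b] order_trans[OF abs_Im_le_cmod b]
    unfolding minus_complex.sel one_complex.sel diff_0_right .
  then have a': "9/10 \<le> Re a" "\<bar>Im a\<bar> \<le> 1/10" and b': "9/10 \<le> Re b" "\<bar>Im b\<bar> \<le> 1/10" by linarith+
  have "9/10 * (9/10) \<le> Re a * Re b" by (rule mult_mono) (use a' b' in linarith)+
  moreover have "\<bar>Im a * Im b\<bar> \<le> 1/10 * (1/10)" unfolding abs_mult by (rule mult_mono) (use a' b' in linarith)+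
  ultimately have pos: "Re a * Re b + Im a * Im b > 0" by linarith
  have "(norm (a + of_real t * b))\<^sup>2 = (norm a)\<^sup>2 + 2 * t * (Re a * Re b + Im a * Im b) + t\<^sup>2 * (norm b)\<^sup>2"
    unfolding cmod_power2 plus_complex.sel times_complex.sel Re_complex_of_real Im_complex_of_real by algebra
  moreover have "2 * t * (Re a * Re b + Im a * Im b) > 0" using pos t by simp
  moreover have "t\<^sup>2 * (norm b)\<^sup>2 \<ge> 0" by simp
  ultimately have "(norm a)\<^sup>2 < (norm (a + of_real t * b))\<^sup>2" by linarith
  then show ?thesis by (rule power2_less_imp_less) simp
qed

lemma uniform_on_compact_fibre:
  fixes g :: "complex \<Rightarrow> complex \<Rightarrow> complex"
  assumes g: "continuous_on (P \<times> UNIV) (\<lambda>(s, z). g s z)" and P: "open P" "s0 \<in> P" and C: "compact C" and \<epsilon>: "\<epsilon> > 0"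
  shows "\<forall>\<^sub>F s in nhds s0. s \<in> P \<and> (\<forall>z\<in>C. norm (g s z - g s0 z) < \<epsilon>)"
proof -
  obtain r where r: "r > 0" "cball s0 r \<subseteq> P" using P open_contains_cball by metis
  have "uniformly_continuous_on (cball s0 r \<times> C) (\<lambda>(s, z). g s z)"
    using r C by (intro compact_uniformly_continuous continuous_on_subset[OF g] compact_Times) auto
  then obtain d where d: "d > 0" "\<And>x y. \<lbrakk>x \<in> cball s0 r \<times> C; y \<in> cball s0 r \<times> C; dist y x < d\<rbrakk>
      \<Longrightarrow> dist ((\<lambda>(s, z). g s z) y) ((\<lambda>(s, z). g s z) x) < \<epsilon>"
    unfolding uniformly_continuous_on_def using \<epsilon> by metis
  have "s \<in> P \<and> (\<forall>z\<in>C. norm (g s z - g s0 z) < \<epsilon>)" if s: "dist s s0 < min r d" for s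
  proof (intro conjI ballI)
    have sr: "s \<in> cball s0 r" using s by (simp add: dist_commute)
    then show "s \<in> P" using r by blast
    fix z assume "z \<in> C"
    then show "norm (g s z - g s0 z) < \<epsilon>"
      using d(2)[of "(s0, z)" "(s, z)"] sr r s by (simp add: dist_Pair_Pair dist_norm)
  qed
  then show ?thesis using r d unfolding eventually_nhds_metric by (metis min_less_iff_conj)
qed

text \<open>
For every parameter \<open>s\<close> the polynomial \<open>p s\<close> has a root \<open>\<Phi> s\<close> on
\<open>A s = {|p s| > |p s (e s)|}\<close>. The point \<open>e s\<close> lies on the boundary of this
set. Since \<open>e s\<close> is not critical, \<open>\<Phi> s\<close> extends to it, and the value there is shown to
depend continuously on the parameter. In the application \<open>e s\<close> is the cocritical point; it has the
same image as an escaping critical point, which lies on the same level, so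
\<open>A s\<close> cannot be enlarged to a sublevel complement containing \<open>e s\<close>.
\<close>
locale root_family =
  fixes P :: "complex set" and N :: nat and p :: "complex \<Rightarrow> complex \<Rightarrow> complex" and e :: "complex \<Rightarrow> complex"
  assumes openP: "open P"
    and p_cont: "continuous_on (P \<times> UNIV) (\<lambda>(s, z). p s z)"
    and dp_cont: "continuous_on (P \<times> UNIV) (\<lambda>(s, z). deriv (p s) z)"
    and p_asymp: "\<And>s. s \<in> P \<Longrightarrow> asymp_monomial N 1 (p s)"
    and p_0: "\<And>s. s \<in> P \<Longrightarrow> p s 0 = 0"
    and e_cont: "continuous_on P e"
    and pe_nz: "\<And>s. s \<in> P \<Longrightarrow> p s (e s) \<noteq> 0"
    and dpe_nz: "\<And>s. s \<in> P \<Longrightarrow> deriv (p s) (e s) \<noteq> 0"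
    and sub_conn: "\<And>s t. \<lbrakk>s \<in> P; norm (p s (e s)) < t\<rbrakk> \<Longrightarrow> connected {z. norm (p s z) < t}"
    and P_ne: "P \<noteq> {}"
begin

definition A :: "complex \<Rightarrow> complex set" where "A s = {z. norm (p s (e s)) < norm (p s z)}"

lemma N_pos: "0 < N" using P_ne p_asymp by (auto simp: asymp_monomial_def)

lemma p_hol: "s \<in> P \<Longrightarrow> p s holomorphic_on S"
  using p_asymp[of s] holomorphic_on_subset[of "p s" UNIV S] by (simp add: asymp_monomial_def)

lemma p_contz: "s \<in> P \<Longrightarrow> continuous_on S (p s)"
  using p_hol holomorphic_on_imp_continuous_on by blast

lemma superlevel: "s \<in> P \<Longrightarrow> superlevel N 1 (p s) (norm (p s (e s)))"
  by (rule superlevel.intro) (auto simp: p_asymp p_0 pe_nz)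

text \<open>
The limit at infinity determines the root, since \<open>A s\<close> is connected.
\<close>
definition root_at_infinity :: "complex \<Rightarrow> (complex \<Rightarrow> complex) \<Rightarrow> bool" where
  "root_at_infinity s \<phi> \<longleftrightarrow> continuous_on (A s) \<phi> \<and> (\<forall>z\<in>A s. \<phi> z ^ N = p s z) \<and> ((\<lambda>z. \<phi> z / z) \<longlongrightarrow> 1) at_infinity"

definition \<Phi> :: "complex \<Rightarrow> complex \<Rightarrow> complex" where
  "\<Phi> s = (SOME \<phi>. root_at_infinity s \<phi>)"

lemma \<Phi>: 
  assumes "s \<in> P"
  shows \<Phi>_cont: "continuous_on (A s) (\<Phi> s)" and \<Phi>_pow: "\<And>z. z \<in> A s \<Longrightarrow> \<Phi> s z ^ N = p s z"
    and \<Phi>_lim: "((\<lambda>z. \<Phi> s z / z) \<longlongrightarrow> 1) at_infinity"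
proof -
  interpret superlevel N 1 "p s" "norm (p s (e s))" using assms by (rule superlevel)
  obtain \<phi> where "continuous_on {z. norm (p s (e s)) < norm (p s z)} \<phi>"
    "\<And>z. norm (p s (e s)) < norm (p s z) \<Longrightarrow> \<phi> z ^ N = p s z" "((\<lambda>z. \<phi> z / z) \<longlongrightarrow> 1) at_infinity"
    using superlevel_root_exists[OF refl sub_conn[OF assms]] that by (smt (verit, del_insts))
  then have "root_at_infinity s \<phi>" by (auto simp: root_at_infinity_def A_def)
  then have "root_at_infinity s (\<Phi> s)" unfolding \<Phi>_def by (rule someI[where P = "root_at_infinity s"])
  then show "continuous_on (A s) (\<Phi> s)" "\<And>z. z \<in> A s \<Longrightarrow> \<Phi> s z ^ N = p s z" "((\<lambda>z. \<Phi> s z / z) \<longlongrightarrow> 1) at_infinity"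
    by (auto simp: root_at_infinity_def)
qed

lemma A_open: "s \<in> P \<Longrightarrow> open (A s)"
  unfolding A_def by (intro open_Collect_less continuous_intros holomorphic_on_imp_continuous_on p_hol)

lemma A_connected: "s \<in> P \<Longrightarrow> connected (A s)"
  unfolding A_def using superlevel.connected_superlevel[OF superlevel] .

lemma A_nz: "s \<in> P \<Longrightarrow> z \<in> A s \<Longrightarrow> p s z \<noteq> 0" by (auto simp: A_def)

lemma pe_cont: "continuous_on P (\<lambda>s. p s (e s))"
  using continuous_on_compose2[OF p_cont continuous_on_Pair[OF continuous_on_id e_cont]] by auto

text \<open>
Near infinity the root is given by the principal branch, because this branch has the
prescribed asymptotics. This compares the roots for different parameters.
\<close>
lemma far_formula:
  assumes s: "s \<in> P" and B: "B > 0" "norm (p s (e s)) < B ^ N / 2"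
    and near: "\<And>z. B \<le> norm z \<Longrightarrow> norm (p s z / z ^ N - 1) < 1/2" and z: "B \<le> norm z"
  shows "z \<in> A s \<and> \<Phi> s z = z * exp (Ln (p s z / z ^ N) / of_nat N)"
proof -
  let ?S = "- ball (0::complex) B"
  define \<rho> where "\<rho> z = z * exp (Ln (p s z / z ^ N) / of_nat N)" for z
  have znz: "z \<noteq> 0" if "z \<in> ?S" for z using that B by auto
  have sub: "?S \<subseteq> A s"
  proof
    fix z assume zS: "z \<in> ?S"
    then have z: "B \<le> norm z" by auto
    have "1/2 < norm (p s z / z ^ N)"
      using near[OF z] norm_triangle_ineq3[of 1 "p s z / z ^ N"] by (simp add: norm_minus_commute)
    then have "norm z ^ N / 2 < norm (p s z)"
      using znz[OF zS] by (simp add: norm_divide norm_power field_simps)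
    moreover have "B ^ N \<le> norm z ^ N" using z B by (intro power_mono) auto
    ultimately show "z \<in> A s" using B unfolding A_def by simp
  qed
  have conS: "connected ?S" by (rule connected_complement_bounded_convex) auto
  have quot_nz: "p s z / z ^ N \<noteq> 0" if "z \<in> ?S" for z
    using A_nz[OF s subsetD[OF sub that]] znz[OF that] by simp
  have \<rho>_pow: "\<rho> z ^ N = p s z" if "z \<in> ?S" for z
    using exp_Ln_root[OF N_pos quot_nz[OF that]] znz[OF that] by (simp add: \<rho>_def power_mult_distrib)
  have \<rho>_cont: "continuous_on ?S \<rho>" unfolding \<rho>_def
  proof (rule continuous_on_mult[OF continuous_on_id continuous_on_Ln_near_1])
    show "norm (p s x / x ^ N - 1) < 1" if "x \<in> ?S" for x using near[of x] that by auto
    show "continuous_on ?S (\<lambda>z. p s z / z ^ N)" using znz by (intro continuous_intros p_contz[OF s]) auto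
  qed
  have const: "\<Phi> s x / \<rho> x = \<Phi> s z / \<rho> z" if "x \<in> ?S" for x
  proof (rule root_quotient_constant[OF conS _ \<rho>_cont N_pos])
    show "continuous_on ?S (\<Phi> s)" using continuous_on_subset[OF \<Phi>_cont[OF s] sub] .
    show "\<Phi> s x ^ N = \<rho> x ^ N" if "x \<in> ?S" for x using \<Phi>_pow[OF s] \<rho>_pow that sub by auto
  qed (use that z znz in \<open>auto simp: \<rho>_def\<close>)
  have "((\<lambda>x. \<rho> x / x) \<longlongrightarrow> exp (Ln 1 / of_nat N)) at_infinity"
  proof -
    have "((\<lambda>x. p s x / x ^ N) \<longlongrightarrow> 1) at_infinity" using p_asymp[OF s] by (simp add: asymp_monomial_def)
    then have "((\<lambda>x. exp (Ln (p s x / x ^ N) / of_nat N)) \<longlongrightarrow> exp (Ln 1 / of_nat N)) at_infinity"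
      using N_pos by (intro tendsto_intros) auto
    moreover have "\<forall>\<^sub>F x in at_infinity. exp (Ln (p s x / x ^ N) / of_nat N) = \<rho> x / x"
      unfolding eventually_at_infinity \<rho>_def using znz by (intro exI[of _ B]) simp
    ultimately show ?thesis by (rule Lim_transform_eventually)
  qed
  then have "((\<lambda>x. (\<Phi> s x / x) / (\<rho> x / x)) \<longlongrightarrow> 1 / exp (Ln 1 / of_nat N)) at_infinity"
    by (intro tendsto_divide \<Phi>_lim[OF s]) auto
  moreover have "\<forall>\<^sub>F x in at_infinity. (\<Phi> s x / x) / (\<rho> x / x) = \<Phi> s z / \<rho> z"
  proof -
    have "(\<Phi> s x / x) / (\<rho> x / x) = \<Phi> s z / \<rho> z" if "B \<le> norm x" for x
    proof -
      have "x \<in> ?S" using that by simp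
      then show ?thesis using znz[of x] const[of x] by simp
    qed
    then show ?thesis unfolding eventually_at_infinity by blast
  qed
  ultimately have lim1: "((\<lambda>x::complex. \<Phi> s z / \<rho> z) \<longlongrightarrow> 1) at_infinity" by (simp add: tendsto_cong)
  have "\<Phi> s z / \<rho> z = 1" by (rule tendsto_unique[OF trivial_limit_at_infinity tendsto_const lim1])
  then have "\<Phi> s z = \<rho> z" by (metis div_by_0 divide_eq_1_iff zero_neq_one)
  then show ?thesis using sub z by (auto simp: \<rho>_def)
qed

text \<open>
The estimate near infinity holds uniformly for nearby parameters: the maximum principle for the
reversed polynomials transfers closeness from a circle to the disc inside it.
\<close>
lemma eventually_near_infinity:
  assumes s0: "s0 \<in> P"
  obtains b where "b > 0" "\<forall>\<^sub>F s in nhds s0. \<forall>z. b \<le> norm z \<longrightarrow> norm (p s z / z ^ N - 1) < 1/2"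
proof -
  define q where "q s = reversed N 1 (p s)" for s
  have q_hol: "q s holomorphic_on S" if "s \<in> P" for s S
    using reversed_holomorphic[OF p_asymp[OF that]] holomorphic_on_subset by (auto simp: q_def)
  have q_eq: "p s z / z ^ N = q s (inverse z)" if "z \<noteq> 0" for s z
    using that by (simp add: q_def reversed_def power_inverse field_simps)
  have "isCont (q s0) 0" using q_hol[OF s0, of UNIV] holomorphic_on_imp_continuous_on
    by (metis UNIV_I continuous_on_eq_continuous_at open_UNIV)
  moreover have "q s0 0 = 1" by (simp add: q_def reversed_def)
  ultimately obtain d where d: "d > 0" "\<And>u. norm u < d \<Longrightarrow> norm (q s0 u - 1) < 1/4"
    unfolding continuous_at_eps_delta dist_norm by (metis diff_zero zero_less_divide_1_iff zero_less_numeral)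
  define \<rho> where "\<rho> = d / 2"
  have \<rho>: "\<rho> > 0" "\<rho> < d" using d by (auto simp: \<rho>_def)
  have "\<forall>\<^sub>F s in nhds s0. s \<in> P \<and> (\<forall>z\<in>sphere 0 (inverse \<rho>). norm (p s z - p s0 z) < inverse \<rho> ^ N / 4)"
    using \<rho> by (intro uniform_on_compact_fibre[OF p_cont openP s0]) auto
  then have "\<forall>\<^sub>F s in nhds s0. \<forall>z. inverse \<rho> \<le> norm z \<longrightarrow> norm (p s z / z ^ N - 1) < 1/2"
  proof eventually_elim
    case (elim s)
    have sphere: "norm (q s u - q s0 u) \<le> 1/4" if u: "u \<in> frontier (ball 0 \<rho>)" for u
    proof -
      have nu: "norm u = \<rho>" using u \<rho> by simp
      then have u0: "u \<noteq> 0" using \<rho> by auto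
      have "norm (p s (inverse u) - p s0 (inverse u)) < inverse \<rho> ^ N / 4" using elim nu by (simp add: norm_inverse)
      then have "\<rho> ^ N * norm (p s (inverse u) - p s0 (inverse u)) \<le> \<rho> ^ N * (inverse \<rho> ^ N / 4)"
        using \<rho> by (intro mult_left_mono) auto
      moreover have "q s u - q s0 u = u ^ N * (p s (inverse u) - p s0 (inverse u))"
        using u0 by (simp add: q_def reversed_def algebra_simps)
      ultimately show ?thesis using \<rho> nu by (simp add: norm_mult norm_power power_inverse)
    qed
    have "norm (q s u - 1) < 1/2" if u: "norm u \<le> \<rho>" for u
    proof -
      have "norm (q s u - q s0 u) \<le> 1/4"
      proof (cases "u \<in> ball 0 \<rho>")
        case True
        show ?thesis
        proof (rule maximum_modulus_frontier[where S = "ball 0 \<rho>" and f = "\<lambda>u. q s u - q s0 u"])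
          show "(\<lambda>u. q s u - q s0 u) holomorphic_on interior (ball 0 \<rho>)"
            using elim s0 by (intro holomorphic_intros q_hol) auto
          show "continuous_on (closure (ball 0 \<rho>)) (\<lambda>u. q s u - q s0 u)"
            using elim s0 by (intro continuous_intros holomorphic_on_imp_continuous_on q_hol) auto
        qed (use True sphere in auto)
      next
        case False
        then show ?thesis using sphere[of u] u \<rho> by simp
      qed
      moreover have "norm (q s0 u - 1) < 1/4" using d(2)[of u] u \<rho> by simp
      ultimately show ?thesis using norm_triangle_ineq[of "q s u - q s0 u" "q s0 u - 1"] by simp
    qed
    moreover have "z \<noteq> 0" "norm (inverse z) \<le> \<rho>" if "inverse \<rho> \<le> norm z" for z :: complex
    proof -
      show "z \<noteq> 0" using that \<rho> by auto
      show "norm (inverse z) \<le> \<rho>" using le_imp_inverse_le[OF that] \<rho> by (simp add: norm_inverse)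
    qed
    ultimately show ?case using q_eq by metis
  qed
  then show ?thesis using that[of "inverse \<rho>"] \<rho> by simp
qed

lemma eventually_superlevel:
  assumes s0: "s0 \<in> P" and C: "compact C" "C \<subseteq> A s0"
  shows "\<forall>\<^sub>F s in nhds s0. s \<in> P \<and> C \<subseteq> A s \<and> (\<forall>z\<in>C. norm (p s z / p s0 z - 1) < 1/2)"
proof (cases "C = {}")
  case True
  then show ?thesis using openP s0 by (simp add: eventually_nhds_in_open)
next
  case False
  have "continuous_on C (\<lambda>z. norm (p s0 z))" by (intro continuous_intros holomorphic_on_imp_continuous_on p_hol s0)
  then obtain x where x: "x \<in> C" "\<And>z. z \<in> C \<Longrightarrow> norm (p s0 x) \<le> norm (p s0 z)"
    using continuous_attains_inf[OF C(1) False] by metis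
  define r where "r = norm (p s0 (e s0))"
  define m where "m = norm (p s0 x)"
  have m: "r < m" "0 < r" using x C s0 pe_nz by (auto simp: m_def r_def A_def)
  have "\<forall>\<^sub>F s in nhds s0. s \<in> P \<and> (\<forall>z\<in>C. norm (p s z - p s0 z) < min ((m - r) / 2) (r / 2))"
    using m by (intro uniform_on_compact_fibre[OF p_cont openP s0 C(1)]) auto
  moreover have "\<forall>\<^sub>F s in nhds s0. norm (p s (e s)) < (r + m) / 2"
  proof -
    have "isCont (\<lambda>s. norm (p s (e s))) s0"
      using pe_cont openP s0 by (intro continuous_intros) (auto simp: continuous_on_eq_continuous_at)
    then have "((\<lambda>s. norm (p s (e s))) \<longlongrightarrow> r) (nhds s0)"
      unfolding r_def continuous_within by (rule tendsto_at_iff_tendsto_nhds[THEN iffD1])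
    then show ?thesis using m by (intro order_tendstoD(2)) auto
  qed
  ultimately show ?thesis
  proof eventually_elim
    case (elim s)
    have *: "norm (p s (e s)) < norm (p s z) \<and> norm (p s z / p s0 z - 1) < 1/2" if z: "z \<in> C" for z
    proof -
      have d: "norm (p s z - p s0 z) < (m - r) / 2" "norm (p s z - p s0 z) < r / 2" and pz: "m \<le> norm (p s0 z)"
        using elim z x by (auto simp: m_def)
      have "norm (p s0 z) \<le> norm (p s z) + norm (p s z - p s0 z)"
        using norm_triangle_ineq2[of "p s0 z" "p s z"] by (simp add: norm_minus_commute)
      then have "norm (p s (e s)) < norm (p s z)" using d pz elim by (simp add: field_simps)
      moreover have nz: "p s0 z \<noteq> 0" using pz m by auto
      have "p s z / p s0 z - 1 = (p s z - p s0 z) / p s0 z" using nz by (simp add: field_simps)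
      then have "norm (p s z / p s0 z - 1) < 1/2" using d pz m nz by (simp add: norm_divide field_simps)
      ultimately show ?thesis by simp
    qed
    then show ?case using elim by (auto simp: A_def)
  qed
qed

text \<open>
Continuity of the root in the parameter at a fixed point \<open>z1\<close>, in a form that also names the
branch. A path from \<open>z1\<close> to a point near infinity stays in \<open>A s\<close> for nearby
parameters, and along it the two sides differ by a constant root of unity, which is \<open>1\<close> at the far end.
\<close>
lemma eventually_root_formula:
  assumes s0: "s0 \<in> P" and z1: "z1 \<in> A s0"
  shows "\<forall>\<^sub>F s in nhds s0. \<Phi> s z1 = \<Phi> s0 z1 * exp (Ln (p s z1 / p s0 z1) / of_nat N)"
proof -
  obtain b where b: "b > 0" "\<forall>\<^sub>F s in nhds s0. \<forall>z. b \<le> norm z \<longrightarrow> norm (p s z / z ^ N - 1) < 1/2"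
    by (rule eventually_near_infinity[OF s0]) (rule that)
  define B where "B = max b (max 1 (2 * (norm (p s0 (e s0)) + 1)))"
  have B: "B \<ge> b" "B \<ge> 1" "B \<ge> 2 * (norm (p s0 (e s0)) + 1)"
    unfolding B_def by linarith+
  have "B \<le> B ^ N" using B N_pos by (intro self_le_power) auto
  then have BN: "norm (p s0 (e s0)) + 1 \<le> B ^ N / 2" using B by simp
  define z2 where "z2 = complex_of_real B"
  have z2: "norm z2 = B" using B by (simp add: z2_def)
  have near0: "\<And>z. b \<le> norm z \<Longrightarrow> norm (p s0 z / z ^ N - 1) < 1/2"
    using eventually_nhds_x_imp_x[OF b(2)] by blast
  have "z2 \<in> A s0" and \<Phi>0: "\<Phi> s0 z2 = z2 * exp (Ln (p s0 z2 / z2 ^ N) / of_nat N)"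
    using far_formula[OF s0, of B z2] B BN near0 z2 by auto
  moreover have "path_connected (A s0)" using A_open[OF s0] A_connected[OF s0] connected_open_path_connected by blast
  ultimately obtain \<gamma> where \<gamma>: "path \<gamma>" "path_image \<gamma> \<subseteq> A s0" "pathstart \<gamma> = z1" "pathfinish \<gamma> = z2"
    using z1 unfolding path_connected_def by metis
  have z12: "z1 \<in> path_image \<gamma>" "z2 \<in> path_image \<gamma>" using \<gamma> by (metis pathstart_in_path_image, metis pathfinish_in_path_image)
  have "\<forall>\<^sub>F s in nhds s0. s \<in> P \<and> path_image \<gamma> \<subseteq> A s \<and> (\<forall>z\<in>path_image \<gamma>. norm (p s z / p s0 z - 1) < 1/2)"
    using eventually_superlevel[OF s0 compact_path_image[OF \<gamma>(1)] \<gamma>(2)] .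
  moreover have "\<forall>\<^sub>F s in nhds s0. norm (p s (e s)) < B ^ N / 2"
  proof -
    have "isCont (\<lambda>s. norm (p s (e s))) s0"
      using pe_cont openP s0 by (intro continuous_intros) (auto simp: continuous_on_eq_continuous_at)
    then have "((\<lambda>s. norm (p s (e s))) \<longlongrightarrow> norm (p s0 (e s0))) (nhds s0)"
      unfolding continuous_within by (rule tendsto_at_iff_tendsto_nhds[THEN iffD1])
    then show ?thesis using BN by (intro order_tendstoD(2)) auto
  qed
  ultimately show ?thesis using b(2)
  proof eventually_elim
    case (elim s)
    then have s: "s \<in> P" and sub: "path_image \<gamma> \<subseteq> A s" by auto
    define \<rho> where "\<rho> z = \<Phi> s0 z * exp (Ln (p s z / p s0 z) / of_nat N)" for z
    have nz: "p s z / p s0 z \<noteq> 0" if "z \<in> path_image \<gamma>" for z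
      using A_nz[OF s] A_nz[OF s0] that sub \<gamma>(2) by auto
    have "\<Phi> s z1 / \<rho> z1 = \<Phi> s z2 / \<rho> z2"
    proof (rule root_quotient_constant[OF connected_path_image[OF \<gamma>(1)] _ _ N_pos])
      show "continuous_on (path_image \<gamma>) (\<Phi> s)" using continuous_on_subset[OF \<Phi>_cont[OF s] sub] .
      show "continuous_on (path_image \<gamma>) \<rho>" unfolding \<rho>_def
      proof (rule continuous_on_mult[OF continuous_on_subset[OF \<Phi>_cont[OF s0] \<gamma>(2)] continuous_on_Ln_near_1])
        show "continuous_on (path_image \<gamma>) (\<lambda>z. p s z / p s0 z)"
          using nz by (intro continuous_on_divide p_contz s s0) auto
        show "norm (p s z / p s0 z - 1) < 1" if "z \<in> path_image \<gamma>" for z using elim that by fastforce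
      qed
      show "\<Phi> s z ^ N = \<rho> z ^ N" if "z \<in> path_image \<gamma>" for z
        using \<Phi>_pow[OF s] \<Phi>_pow[OF s0] exp_Ln_root[OF N_pos nz[OF that]] nz[OF that] that sub \<gamma>(2)
        by (auto simp: \<rho>_def power_mult_distrib subset_iff)
      show "\<rho> z \<noteq> 0" if "z \<in> path_image \<gamma>" for z
        using \<Phi>_pow[OF s0, of z] A_nz[OF s0, of z] that \<gamma>(2) N_pos by (auto simp: \<rho>_def zero_power)
    qed (rule z12)+
    also have "\<Phi> s z2 = \<rho> z2"
    proof -
      have "\<Phi> s z2 = z2 * exp (Ln (p s z2 / z2 ^ N) / of_nat N)"
        using far_formula[OF s, of B z2] B elim z2 by auto
      moreover have "Ln (p s z2 / p s0 z2) = Ln (p s z2 / z2 ^ N) - Ln (p s0 z2 / z2 ^ N)"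
      proof -
        have "0 < Re (p s z2 / z2 ^ N)" "0 < Re (p s0 z2 / z2 ^ N)"
          using elim near0[of z2] z2 B by (auto intro!: Re_pos_near_1 dest!: spec[of _ z2])
        note L = Ln_divide_right_half_plane[OF this]
        have "z2 \<noteq> 0" using z2 B by auto
        then have "p s z2 / z2 ^ N / (p s0 z2 / z2 ^ N) = p s z2 / p s0 z2" by simp
        then show ?thesis using L by metis
      qed
      ultimately show ?thesis unfolding \<rho>_def \<Phi>0 by (simp add: diff_divide_distrib exp_diff)
    qed
    also have "\<rho> z2 / \<rho> z2 = 1"
    proof -
      have "z2 \<in> A s" using z12 sub by blast
      then have "\<rho> z2 ^ N \<noteq> 0" using \<Phi>_pow[OF s, of z2] A_nz[OF s, of z2] \<open>\<Phi> s z2 = \<rho> z2\<close> by simp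
      then show ?thesis using N_pos by auto
    qed
    finally have "\<Phi> s z1 / \<rho> z1 = 1" .
    then show ?case unfolding \<rho>_def by (metis div_by_0 divide_eq_1_iff zero_neq_one)
  qed
qed

text \<open>
\<open>\<Phi> s\<close> is defined only on \<open>A s\<close>, so its value at the boundary point is taken as a limit.
\<close>
definition boundary_root :: "complex \<Rightarrow> complex" where
  "boundary_root s = Lim (at (e s) within A s) (\<Phi> s)"

text \<open>
Near \<open>e s0\<close> all \<open>p s\<close> are almost linear with the same derivative, so moving in the fixed direction
\<open>u\<close> increases \<open>|p s|\<close>. Every point of \<open>A s\<close> near \<open>e s0\<close> is thereby joined inside
\<open>A s\<close> to a neighbourhood of one fixed point \<open>z1\<close>. Hence \<open>\<Phi> s\<close> is
the same multiple \<open>\<omega>\<close> of the principal branch there as at \<open>z1\<close>, and at \<open>z1\<close> this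
multiple does not depend on the parameter.
\<close>
lemma eventually_boundary_root:
  assumes s0: "s0 \<in> P"
  obtains \<omega> y0 where "(\<omega> * y0) ^ N = p s0 (e s0)"
    "\<forall>\<^sub>F s in nhds s0. norm (p s (e s) / p s0 (e s0) - 1) < 1 \<and>
       boundary_root s = \<omega> * y0 * exp (Ln (p s (e s) / p s0 (e s0)) / of_nat N)"
proof -
  define h where "h = p s0 (e s0)"
  define d where "d = deriv (p s0) (e s0)"
  have h: "h \<noteq> 0" and d: "d \<noteq> 0" using pe_nz dpe_nz s0 by (auto simp: h_def d_def)
  \<comment> \<open>Moving by a small t u multiplies p s by about 1 + t.\<close>
  define u where "u = h / d"
  have u: "u \<noteq> 0" "d * u = h" using h d by (auto simp: u_def)
  obtain \<epsilon> \<delta> where \<epsilon>: "\<epsilon> > 0" and \<delta>: "\<delta> > 0" "ball s0 \<delta> \<subseteq> P"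
    and dp: "\<And>s z. \<lbrakk>s \<in> ball s0 \<delta>; z \<in> ball (e s0) \<epsilon>\<rbrakk> \<Longrightarrow> norm (deriv (p s) z - d) \<le> norm d / 10"
    and ph: "\<And>s z. \<lbrakk>s \<in> ball s0 \<delta>; z \<in> ball (e s0) \<epsilon>\<rbrakk> \<Longrightarrow> norm (p s z - h) \<le> norm h / 10"
  proof -
    have op: "open (P \<times> (UNIV::complex set))" using openP by (simp add: open_Times)
    have c: "isCont (\<lambda>(s, z). deriv (p s) z) (s0, e s0)" "isCont (\<lambda>(s, z). p s z) (s0, e s0)"
      using p_cont dp_cont s0 op by (auto simp: continuous_on_eq_continuous_at)
    obtain d1 where d1: "d1 > 0" "\<And>x. dist x (s0, e s0) < d1 \<Longrightarrow> dist ((\<lambda>(s, z). deriv (p s) z) x) d < norm d / 10"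
      using c(1) d unfolding continuous_at_eps_delta d_def by (metis case_prod_conv divide_pos_pos zero_less_norm_iff zero_less_numeral)
    obtain d2 where d2: "d2 > 0" "\<And>x. dist x (s0, e s0) < d2 \<Longrightarrow> dist ((\<lambda>(s, z). p s z) x) h < norm h / 10"
      using c(2) h unfolding continuous_at_eps_delta h_def by (metis case_prod_conv divide_pos_pos zero_less_norm_iff zero_less_numeral)
    obtain d3 where d3: "d3 > 0" "ball s0 d3 \<subseteq> P" using openP s0 open_contains_ball by metis
    define m where "m = min d1 d2"
    have m: "m > 0" using d1 d2 by (simp add: m_def)
    have dd: "dist (s, z) (s0, e s0) < m" if "dist s0 s < m / 2" "dist (e s0) z < m / 2" for s z
      using sqrt_sum_squares_le_sum_abs[of "dist s s0" "dist z (e s0)"] that by (simp add: dist_Pair_Pair dist_commute)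
    show thesis
    proof
      show "m / 2 > 0" "min (m / 2) d3 > 0" "ball s0 (min (m / 2) d3) \<subseteq> P" using m d3 by auto
      fix s z assume "s \<in> ball s0 (min (m / 2) d3)" "z \<in> ball (e s0) (m / 2)"
      then have "dist (s, z) (s0, e s0) < m" by (intro dd) auto
      then show "norm (deriv (p s) z - d) \<le> norm d / 10" "norm (p s z - h) \<le> norm h / 10"
        using d1(2)[of "(s, z)"] d2(2)[of "(s, z)"] by (auto simp: m_def dist_norm)
    qed
  qed
  define \<tau>0 where "\<tau>0 = \<epsilon> / (4 * norm u)"
  have \<tau>0: "\<tau>0 > 0" "\<tau>0 * norm u = \<epsilon> / 4" using \<epsilon> u by (auto simp: \<tau>0_def)
  define z1 where "z1 = e s0 + of_real \<tau>0 * u"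
  have inball: "z + of_real \<tau> * u \<in> ball (e s0) \<epsilon>" if "z \<in> ball (e s0) (\<epsilon> / 2)" "0 \<le> \<tau>" "\<tau> \<le> \<tau>0" for z \<tau>
  proof -
    have "dist (e s0) (z + of_real \<tau> * u) \<le> dist (e s0) z + \<tau> * norm u"
      using dist_triangle[of "e s0" "z + of_real \<tau> * u" z] that by (simp add: dist_norm norm_mult)
    moreover have "\<tau> * norm u \<le> \<epsilon> / 4" using that \<tau>0 mult_right_mono[of \<tau> \<tau>0 "norm u"] by simp
    ultimately show ?thesis using that \<epsilon> by simp
  qed
  have ratio: "norm (p s z / h - 1) \<le> 1/10" if "s \<in> ball s0 \<delta>" "z \<in> ball (e s0) \<epsilon>" for s z
  proof -
    have "p s z / h - 1 = (p s z - h) / h" using h by (simp add: field_simps)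
    then show ?thesis using ph[OF that] h by (simp add: norm_divide field_simps)
  qed
  have push: "norm (p s z) < norm (p s (z + of_real \<tau> * u))"
    if s: "s \<in> ball s0 \<delta>" and z: "z \<in> ball (e s0) (\<epsilon> / 2)" and \<tau>: "0 < \<tau>" "\<tau> \<le> \<tau>0" for s z \<tau>
  proof -
    have sP: "s \<in> P" using s \<delta> by blast
    have zb: "z \<in> ball (e s0) \<epsilon>" using z \<epsilon> by simp
    have "norm ((\<lambda>x. p s x - d * x) (z + of_real \<tau> * u) - (\<lambda>x. p s x - d * x) z) \<le> norm d / 10 * norm ((z + of_real \<tau> * u) - z)"
    proof (rule field_differentiable_bound[OF convex_ball])
      show "((\<lambda>x. p s x - d * x) has_field_derivative (deriv (p s) x - d)) (at x within ball (e s0) \<epsilon>)" for x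
        by (rule has_field_derivative_at_within[OF
              DERIV_diff[OF holomorphic_derivI[OF p_hol[OF sP] open_UNIV UNIV_I] DERIV_cmult_Id]])
      show "norm (deriv (p s) x - d) \<le> norm d / 10" if "x \<in> ball (e s0) \<epsilon>" for x using dp s that by blast
    qed (use zb inball[OF z] \<tau> in auto)
    then have "norm (p s (z + of_real \<tau> * u) - p s z - of_real \<tau> * h) \<le> \<tau> * norm h / 10"
      using \<tau> u by (simp add: algebra_simps norm_mult flip: u(2))
    moreover define b where "b = (p s (z + of_real \<tau> * u) - p s z) / (of_real \<tau> * h)"
    have beq: "p s (z + of_real \<tau> * u) = p s z + of_real \<tau> * h * b" using h \<tau> by (simp add: b_def)
    ultimately have "norm (of_real \<tau> * h * (b - 1)) \<le> \<tau> * norm h / 10" by (simp add: algebra_simps)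
    then have "(\<tau> * norm h) * norm (b - 1) \<le> (\<tau> * norm h) * (1/10)" using \<tau> by (simp add: norm_mult)
    then have b1: "norm (b - 1) \<le> 1/10" by (rule mult_left_le_imp_le) (use h \<tau> in simp)
    have "norm (p s z / h) < norm (p s z / h + of_real \<tau> * b)"
      using norm_add_pos_multiple_gt[OF ratio[OF s zb] b1 \<tau>(1)] .
    also have "p s z / h + of_real \<tau> * b = p s (z + of_real \<tau> * u) / h"
      using h unfolding beq add_divide_distrib by simp
    finally show ?thesis using h by (simp add: norm_divide field_simps)
  qed
  have e0: "e s0 \<in> ball (e s0) (\<epsilon> / 2)" using \<epsilon> by simp
  have z1A: "z1 \<in> A s0" using push[OF _ e0 \<tau>0(1)] \<delta> by (simp add: A_def z1_def)
  obtain \<epsilon>' where \<epsilon>': "\<epsilon>' > 0" "\<epsilon>' \<le> \<epsilon> / 2" "cball z1 \<epsilon>' \<subseteq> A s0"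
  proof -
    obtain c where "c > 0" "cball z1 c \<subseteq> A s0" using A_open[OF s0] z1A open_contains_cball by metis
    moreover have "cball z1 (min c (\<epsilon> / 2)) \<subseteq> cball z1 c" by auto
    ultimately show thesis using that[of "min c (\<epsilon> / 2)"] \<epsilon> by force
  qed
  have near_z1: "cball z1 \<epsilon>' \<subseteq> ball (e s0) \<epsilon>"
  proof
    fix x assume x: "x \<in> cball z1 \<epsilon>'"
    have "dist (e s0) z1 = \<epsilon> / 4" using \<tau>0 by (simp add: z1_def dist_norm norm_mult)
    then show "x \<in> ball (e s0) \<epsilon>" using x \<epsilon>' dist_triangle[of "e s0" x z1] \<epsilon> by simp
  qed
  obtain y0 where y0: "y0 ^ N = h" using exists_complex_root N_pos by (metis less_irrefl)
  define \<rho> where "\<rho> s z = y0 * exp (Ln (p s z / h) / of_nat N)" for s z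
  define \<omega> where "\<omega> = \<Phi> s0 z1 / \<rho> s0 z1"
  have y0nz: "y0 \<noteq> 0" using y0 h N_pos by (auto simp: zero_power)
  have \<rho>nz: "\<rho> s z \<noteq> 0" for s z using y0nz by (simp add: \<rho>_def)
  have \<rho>pow: "\<rho> s z ^ N = p s z" if "p s z \<noteq> 0" for s z
    using exp_Ln_root[OF N_pos, of "p s z / h"] that h y0 by (simp add: \<rho>_def power_mult_distrib)
  have \<omega>pow: "\<omega> ^ N = 1"
    using \<rho>pow[of s0 z1] \<Phi>_pow[OF s0 z1A] A_nz[OF s0 z1A] by (simp add: \<omega>_def power_divide)
  have \<rho>cont: "continuous_on (ball (e s0) \<epsilon>) (\<rho> s)" if s: "s \<in> ball s0 \<delta>" for s
    unfolding \<rho>_def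
  proof (rule continuous_on_mult[OF continuous_on_const continuous_on_Ln_near_1])
    show "norm (p s x / h - 1) < 1" if "x \<in> ball (e s0) \<epsilon>" for x using ratio[OF s that] by simp
    show "continuous_on (ball (e s0) \<epsilon>) (\<lambda>z. p s z / h)"
      using s \<delta> h by (intro continuous_on_divide p_contz continuous_on_const) auto
  qed
  have "\<forall>\<^sub>F s in nhds s0. s \<in> ball s0 \<delta>" using \<delta> by (intro eventually_nhds_in_open) auto
  moreover have "\<forall>\<^sub>F s in nhds s0. s \<in> P \<and> cball z1 \<epsilon>' \<subseteq> A s \<and> (\<forall>z\<in>cball z1 \<epsilon>'. norm (p s z / p s0 z - 1) < 1/2)"
    by (rule eventually_superlevel[OF s0 compact_cball \<epsilon>'(3)])
  moreover have "\<forall>\<^sub>F s in nhds s0. \<Phi> s z1 = \<Phi> s0 z1 * exp (Ln (p s z1 / p s0 z1) / of_nat N)"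
    by (rule eventually_root_formula[OF s0 z1A])
  moreover have "\<forall>\<^sub>F s in nhds s0. e s \<in> ball (e s0) \<epsilon>'"
  proof -
    have "isCont e s0" using e_cont openP s0 by (simp add: continuous_on_eq_continuous_at)
    then have "(e \<longlongrightarrow> e s0) (nhds s0)"
      unfolding continuous_within by (rule tendsto_at_iff_tendsto_nhds[THEN iffD1])
    then show ?thesis using \<epsilon>' by (intro topological_tendstoD) auto
  qed
  ultimately have "\<forall>\<^sub>F s in nhds s0. norm (p s (e s) / h - 1) < 1 \<and>
       boundary_root s = \<omega> * y0 * exp (Ln (p s (e s) / h) / of_nat N)"
  proof eventually_elim
    case (elim s)
    then have s: "s \<in> P" "s \<in> ball s0 \<delta>" and z1s: "cball z1 \<epsilon>' \<subseteq> A s" and es: "e s \<in> ball (e s0) \<epsilon>'" by auto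
    have es\<epsilon>: "e s \<in> ball (e s0) (\<epsilon> / 2)" "e s \<in> ball (e s0) \<epsilon>" using es \<epsilon>' \<epsilon> by auto
    have z1in: "z1 \<in> cball z1 \<epsilon>'" using \<epsilon>' by simp
    have \<omega>s: "\<Phi> s z1 / \<rho> s z1 = \<omega>"
    proof -
      have z1b: "z1 \<in> ball (e s0) \<epsilon>" using near_z1 z1in by blast
      have "0 < Re (p s z1 / h)" "0 < Re (p s0 z1 / h)"
        using ratio[OF s(2) z1b] ratio[of s0 z1] z1b \<delta> by (auto intro!: Re_pos_near_1)
      from Ln_divide_right_half_plane[OF this]
      have "Ln (p s z1 / p s0 z1) = Ln (p s z1 / h) - Ln (p s0 z1 / h)" using h by simp
      then show ?thesis using elim y0nz by (simp add: \<omega>_def \<rho>_def diff_divide_distrib exp_diff)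
    qed
    have key: "\<Phi> s z = \<omega> * \<rho> s z" if z: "z \<in> A s" "z \<in> ball (e s0) \<epsilon>'" for z
    proof -
      \<comment> \<open>The segment that pushes z outwards into the neighbourhood of z1.\<close>
      define L where "L = (\<lambda>\<tau>. z + of_real \<tau> * u) ` {0..\<tau>0}"
      have zb: "z \<in> ball (e s0) (\<epsilon> / 2)" using z \<epsilon>' by simp
      have L0: "z \<in> L" using \<tau>0 by (auto simp: L_def intro!: image_eqI[of _ _ 0])
      have L1: "z + of_real \<tau>0 * u \<in> L" using \<tau>0 by (auto simp: L_def)
      have L1c: "z + of_real \<tau>0 * u \<in> cball z1 \<epsilon>'" using z by (simp add: z1_def dist_norm)
      have "connected L" unfolding L_def by (intro connected_continuous_image continuous_intros) auto
      then have con: "connected (L \<union> cball z1 \<epsilon>')" using L1 L1c by (intro connected_Un connected_cball) auto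
      have LA: "L \<subseteq> A s"
      proof
        fix x assume "x \<in> L"
        then obtain \<tau> where \<tau>: "0 \<le> \<tau>" "\<tau> \<le> \<tau>0" "x = z + of_real \<tau> * u" by (auto simp: L_def)
        show "x \<in> A s"
        proof (cases "\<tau> = 0")
          case False
          then have "norm (p s z) < norm (p s x)" using push[OF s(2) zb, of \<tau>] \<tau> by simp
          then show ?thesis using z by (simp add: A_def)
        qed (use \<tau> z in simp)
      qed
      have Lb: "L \<subseteq> ball (e s0) \<epsilon>" using inball[OF zb] by (auto simp: L_def)
      have TA: "L \<union> cball z1 \<epsilon>' \<subseteq> A s" using LA z1s by simp
      have "\<Phi> s z / \<rho> s z = \<Phi> s z1 / \<rho> s z1"
      proof (rule root_quotient_constant[OF con _ _ N_pos])
        show "continuous_on (L \<union> cball z1 \<epsilon>') (\<Phi> s)" using continuous_on_subset[OF \<Phi>_cont[OF s(1)] TA] .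
        show "continuous_on (L \<union> cball z1 \<epsilon>') (\<rho> s)" using Lb near_z1 by (intro continuous_on_subset[OF \<rho>cont[OF s(2)]]) auto
        show "\<Phi> s x ^ N = \<rho> s x ^ N" if "x \<in> L \<union> cball z1 \<epsilon>'" for x
          using \<Phi>_pow[OF s(1)] \<rho>pow A_nz[OF s(1)] that TA by (metis subsetD)
      qed (use L0 z1in \<rho>nz in auto)
      then have "\<Phi> s z / \<rho> s z = \<omega>" using \<omega>s by simp
      then show ?thesis using \<rho>nz[of s z] by (simp add: field_simps)
    qed
    have limpt: "e s islimpt A s"
      unfolding islimpt_approachable
    proof (intro allI impI)
      fix \<eta> :: real assume \<eta>: "\<eta> > 0"
      define \<tau> where "\<tau> = min \<tau>0 (\<eta> / (2 * norm u))"
      have \<tau>: "0 < \<tau>" "\<tau> \<le> \<tau>0" "\<tau> * norm u < \<eta>"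
      proof -
        show "0 < \<tau>" "\<tau> \<le> \<tau>0" using \<tau>0 \<eta> u by (auto simp: \<tau>_def)
        have "\<tau> * norm u \<le> \<eta> / (2 * norm u) * norm u" by (intro mult_right_mono) (auto simp: \<tau>_def)
        then show "\<tau> * norm u < \<eta>" using u \<eta> by simp
      qed
      have "norm (p s (e s)) < norm (p s (e s + of_real \<tau> * u))" using push[OF s(2) es\<epsilon>(1) \<tau>(1,2)] .
      then have "e s + of_real \<tau> * u \<in> A s" by (simp add: A_def)
      moreover have "e s + of_real \<tau> * u \<noteq> e s" using \<tau> u by simp
      moreover have "dist (e s + of_real \<tau> * u) (e s) < \<eta>" using \<tau> by (simp add: dist_norm norm_mult)
      ultimately show "\<exists>x\<in>A s. x \<noteq> e s \<and> dist x (e s) < \<eta>" by blast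
    qed
    have "(\<rho> s \<longlongrightarrow> \<rho> s (e s)) (at (e s) within A s)"
      using \<rho>cont[OF s(2)] es\<epsilon>(2) by (metis continuous_on_eq_continuous_at open_ball isCont_def tendsto_within_subset subset_UNIV)
    then have "((\<lambda>z. \<omega> * \<rho> s z) \<longlongrightarrow> \<omega> * \<rho> s (e s)) (at (e s) within A s)" by (intro tendsto_intros)
    moreover have "\<forall>\<^sub>F z in at (e s) within A s. \<omega> * \<rho> s z = \<Phi> s z"
      unfolding eventually_at_topological using es key by (intro exI[of _ "ball (e s0) \<epsilon>'"]) auto
    ultimately have "(\<Phi> s \<longlongrightarrow> \<omega> * \<rho> s (e s)) (at (e s) within A s)" by (rule Lim_transform_eventually)
    then have "boundary_root s = \<omega> * \<rho> s (e s)"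
      unfolding boundary_root_def using limpt by (intro tendsto_Lim) (auto simp: trivial_limit_within)
    then show ?case using ratio[OF s(2) es\<epsilon>(2)] by (auto simp: \<rho>_def)
  qed
  moreover have "(\<omega> * y0) ^ N = p s0 (e s0)" using \<omega>pow y0 by (simp add: power_mult_distrib h_def)
  ultimately show ?thesis using that unfolding h_def by blast
qed

theorem boundary_root_pow: "s \<in> P \<Longrightarrow> boundary_root s ^ N = p s (e s)"
proof -
  assume s: "s \<in> P"
  obtain \<omega> y0 where *: "(\<omega> * y0) ^ N = p s (e s)"
    "\<forall>\<^sub>F s' in nhds s. norm (p s' (e s') / p s (e s) - 1) < 1 \<and>
       boundary_root s' = \<omega> * y0 * exp (Ln (p s' (e s') / p s (e s)) / of_nat N)"
    by (rule eventually_boundary_root[OF s]) (rule that)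
  have "boundary_root s = \<omega> * y0 * exp (Ln (p s (e s) / p s (e s)) / of_nat N)"
    using eventually_nhds_x_imp_x[OF *(2)] by blast
  then show ?thesis using pe_nz[OF s] *(1) by simp
qed

theorem boundary_root_continuous: "continuous_on P boundary_root"
proof -
  have "isCont boundary_root s" if s: "s \<in> P" for s
  proof -
    obtain \<omega> y0 where "(\<omega> * y0) ^ N = p s (e s)" and *: "\<forall>\<^sub>F s' in nhds s. norm (p s' (e s') / p s (e s) - 1) < 1 \<and>
       boundary_root s' = \<omega> * y0 * exp (Ln (p s' (e s') / p s (e s)) / of_nat N)"
      by (rule eventually_boundary_root[OF s]) (rule that)
    have "isCont (\<lambda>s'. p s' (e s')) s" using pe_cont openP s by (simp add: continuous_on_eq_continuous_at)
    then have "isCont (\<lambda>s'. \<omega> * y0 * exp (Ln (p s' (e s') / p s (e s)) / of_nat N)) s"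
      using pe_nz[OF s] N_pos by (intro continuous_intros) auto
    moreover have "\<forall>\<^sub>F s' in nhds s. boundary_root s' = \<omega> * y0 * exp (Ln (p s' (e s') / p s (e s)) / of_nat N)"
      using * by eventually_elim simp
    ultimately show ?thesis by (simp add: isCont_cong)
  qed
  then show ?thesis by (simp add: continuous_at_imp_continuous_on)
qed

end

section \<open>The cubic family in symmetric coordinates\<close>

text \<open>
With \<open>c = s^2\<close> and \<open>\<lambda> = 3 \<mu>^2\<close> the cubic \<open>P_c\<close> is conjugate, by the scaling
\<open>\<mu> / s\<close>, to a monic cubic \<open>cub s\<close> with critical points \<open>\<mu> s\<close> and \<open>\<mu> / s\<close>. The parameter
\<open>s\<close> is what makes it monic, and the involution \<open>c \<mapsto> 1 / c\<close> becomes the identity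
\<open>cub (1 / s) = cub s\<close>, which exchanges the roles of the two critical points.
\<close>
locale cubic_family =
  fixes \<mu> :: complex
  assumes \<mu>: "3 * (norm \<mu>)\<^sup>2 = 1"
begin

definition a :: "complex \<Rightarrow> complex" where "a s = 3 / 2 * \<mu> * (s + inverse s)"

definition cub :: "complex \<Rightarrow> complex \<Rightarrow> complex" where
  "cub s w = w ^ 3 - a s * w\<^sup>2 + 3 * \<mu>\<^sup>2 * w"

text \<open>
An escape radius: for \<open>|w| \<ge> |a s| + 2\<close> the modulus at least doubles.
\<close>
definition rad :: "complex \<Rightarrow> real" where "rad s = norm (a s) + 2"

text \<open>
The orbit of the critical point \<open>\<mu> s\<close>, which corresponds to \<open>c\<close>.
\<close>
definition h :: "nat \<Rightarrow> complex \<Rightarrow> complex" where "h n s = (cub s ^^ n) (\<mu> * s)"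

lemma norm_3_mu: "norm (3 * \<mu>\<^sup>2) = 1" using \<mu> by (simp add: norm_mult norm_power)

lemma \<mu>_bounds: "1/2 \<le> norm \<mu>" "norm \<mu> \<le> 3/5" and \<mu>_nz: "\<mu> \<noteq> 0"
proof -
  have "(1/2)\<^sup>2 \<le> (norm \<mu>)\<^sup>2" "(norm \<mu>)\<^sup>2 \<le> (3/5)\<^sup>2" using \<mu> by (simp_all add: power2_eq_square)
  then show "1/2 \<le> norm \<mu>" "norm \<mu> \<le> 3/5" by (auto intro: power2_le_imp_le)
  then show "\<mu> \<noteq> 0" by auto
qed

lemma cub_deriv: "(cub s has_field_derivative (3 * w\<^sup>2 - 2 * a s * w + 3 * \<mu>\<^sup>2)) (at w)"
  unfolding cub_def by (auto intro!: derivative_eq_intros)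

lemma deriv_cub: "deriv (cub s) w = 3 * w\<^sup>2 - 2 * a s * w + 3 * \<mu>\<^sup>2"
  using cub_deriv by (rule DERIV_imp_deriv)

lemma deriv_cub_factor: "s \<noteq> 0 \<Longrightarrow> deriv (cub s) w = 3 * (w - \<mu> * s) * (w - \<mu> * inverse s)"
  unfolding deriv_cub a_def by (simp add: field_simps power2_eq_square)

lemma cub_crit: "s \<noteq> 0 \<Longrightarrow> deriv (cub s) w = 0 \<longleftrightarrow> w = \<mu> * s \<or> w = \<mu> * inverse s"
  by (simp add: deriv_cub_factor)

lemma cub_asymp: "asymp_monomial 3 1 (cub s)"
proof -
  have "((\<lambda>w. 1 - a s * inverse w + 3 * \<mu>\<^sup>2 * (inverse w)\<^sup>2) \<longlongrightarrow> 1 - a s * 0 + 3 * \<mu>\<^sup>2 * 0\<^sup>2) at_infinity"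
    by (intro tendsto_intros tendsto_inverse_0)
  moreover have "\<forall>\<^sub>F w in at_infinity. 1 - a s * inverse w + 3 * \<mu>\<^sup>2 * (inverse w)\<^sup>2 = cub s w / w ^ 3"
    unfolding eventually_at_infinity
  proof (intro exI[of _ 1] allI impI)
    fix w :: complex assume "1 \<le> norm w"
    then have "w \<noteq> 0" by auto
    then show "1 - a s * inverse w + 3 * \<mu>\<^sup>2 * (inverse w)\<^sup>2 = cub s w / w ^ 3"
      by (simp add: cub_def field_simps power2_eq_square power3_eq_cube)
  qed
  ultimately have "((\<lambda>w. cub s w / w ^ 3) \<longlongrightarrow> 1) at_infinity" by (simp add: tendsto_cong)
  moreover have "cub s holomorphic_on UNIV" unfolding cub_def by (intro holomorphic_intros)
  ultimately show ?thesis by (simp add: asymp_monomial_def)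
qed

lemma cub_grow: "rad s \<le> norm w \<Longrightarrow> 2 * norm w \<le> norm (cub s w)"
proof -
  assume w: "rad s \<le> norm w"
  then have w2: "norm w \<ge> 2" "norm w - norm (a s) \<ge> 2" unfolding rad_def using norm_ge_zero[of "a s"] by linarith+
  have "norm w - norm (a s) \<le> norm (w - a s)" by (rule norm_triangle_ineq2)
  then have "2 * 2 \<le> norm w * norm (w - a s)" using w2 by (intro mult_mono) auto
  then have "3 \<le> norm (w * (w - a s)) - norm (3 * \<mu>\<^sup>2)" unfolding norm_3_mu norm_mult[of w] by simp
  also have "\<dots> \<le> norm (w * (w - a s) + 3 * \<mu>\<^sup>2)" by (rule norm_diff_ineq)
  finally have "norm w * 2 \<le> norm w * norm (w * (w - a s) + 3 * \<mu>\<^sup>2)" by (intro mult_left_mono) auto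
  also have "\<dots> = norm (cub s w)"
    unfolding cub_def norm_mult[symmetric] by (simp add: algebra_simps power2_eq_square power3_eq_cube)
  finally show ?thesis by simp
qed

lemma rad_pos: "rad s > 0" by (simp add: rad_def add_nonneg_pos)

sublocale monic_map "cub s" "rad s" 3 for s
proof
  show "cub s holomorphic_on UNIV" using cub_asymp[of s] by (simp add: asymp_monomial_def)
  show "cub s 0 = 0" by (simp add: cub_def)
qed (rule rad_pos cub_grow cub_asymp | assumption)+

lemma cub_inverse: "cub (inverse s) = cub s"
  by (auto simp: cub_def a_def add.commute)

lemma cub_minus: "cub (- s) (- w) = - cub s w"
proof -
  have "a (- s) = - a s" by (simp add: a_def algebra_simps)
  then show ?thesis by (simp add: cub_def power3_eq_cube)
qed

lemma cub_iter_minus: "(cub (- s) ^^ n) (- w) = - (cub s ^^ n) w"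
  by (induction n) (auto simp: cub_minus)

lemma h_Suc: "h (Suc n) s = cub s (h n s)" by (simp add: h_def)

text \<open>
The parameters for which the critical point \<open>\<mu> s\<close> escapes; this will be the exterior component.
\<close>
definition E :: "complex set" where "E = {s. s \<noteq> 0 \<and> \<mu> * s \<notin> filled_julia (cub s)}"

lemma E_minus: "s \<in> E \<Longrightarrow> - s \<in> E"
proof -
  assume s: "s \<in> E"
  have "filled_julia (cub (- s)) = uminus ` filled_julia (cub s)"
  proof -
    have "- w \<in> filled_julia (cub (- s)) \<longleftrightarrow> w \<in> filled_julia (cub s)" for w
      by (simp add: filled_julia_def cub_iter_minus bounded_iff)
    note * = this
    show ?thesis
    proof (intro equalityI subsetI)
      fix w assume "w \<in> filled_julia (cub (- s))"
      then have "- w \<in> filled_julia (cub s)" using *[of "- w"] by simp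
      then show "w \<in> uminus ` filled_julia (cub s)" by (rule rev_image_eqI) simp
    qed (use * in blast)
  qed
  then show ?thesis using s by (auto simp: E_def)
qed

lemma other_critical_bounded: "s \<in> E \<Longrightarrow> \<mu> * inverse s \<in> filled_julia (cub s)"
proof -
  assume s: "s \<in> E"
  then have s0: "s \<noteq> 0" by (simp add: E_def)
  have "\<exists>c\<in>filled_julia (cub s). deriv (cub s) c = 0"
  proof (rule critical_point_bounded_of_indifferent)
    have "{c. deriv (cub s) c = 0} \<subseteq> {\<mu> * s, \<mu> * inverse s}" using cub_crit[OF s0] by auto
    then show "finite {c. deriv (cub s) c = 0}" using finite_subset by blast
    show "norm (deriv (cub s) 0) = 1" using norm_3_mu by (simp add: deriv_cub)
  qed
  then show ?thesis using cub_crit[OF s0] s by (auto simp: E_def)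
qed

lemma E_inverse_disjoint: "s \<in> E \<Longrightarrow> inverse s \<notin> E"
  using other_critical_bounded[of s] by (auto simp: E_def cub_inverse)

lemma connected_filled_cub_iff: "s \<noteq> 0 \<Longrightarrow> connected (filled_julia (cub s)) \<longleftrightarrow> s \<notin> E \<and> inverse s \<notin> E"
  unfolding connected_filled_iff by (auto simp: cub_crit E_def cub_inverse)

text \<open>
The coefficient \<open>a s\<close> has a pole at \<open>s = 0\<close>, but it cancels along the critical orbit: \<open>h n s\<close> is \<open>s\<close>
times this polynomial.
\<close>
primrec h_over_s :: "nat \<Rightarrow> complex \<Rightarrow> complex" where
  "h_over_s 0 s = \<mu>"
| "h_over_s (Suc n) s = h_over_s n s * (s\<^sup>2 * (h_over_s n s)\<^sup>2 - 3 / 2 * \<mu> * (s\<^sup>2 + 1) * h_over_s n s + 3 * \<mu>\<^sup>2)"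

lemma h_eq_mult: "h n s = s * h_over_s n s"
proof (induction n)
  case (Suc n)
  then show ?case
    by (cases "s = 0") (auto simp: h_Suc cub_def a_def field_simps power2_eq_square power3_eq_cube)
qed (simp add: h_def)

lemma h_over_s_hol: "h_over_s n holomorphic_on S"
proof (induction n)
  case 0
  show ?case by (rule holomorphic_transform[of "\<lambda>_. \<mu>"]) auto
next
  case (Suc n)
  have "(\<lambda>s. h_over_s n s * (s\<^sup>2 * (h_over_s n s)\<^sup>2 - 3 / 2 * \<mu> * (s\<^sup>2 + 1) * h_over_s n s + 3 * \<mu>\<^sup>2)) holomorphic_on S"
    using Suc by (intro holomorphic_intros)
  then show ?case by (rule holomorphic_transform) simp
qed

lemma h_hol: "h n holomorphic_on S"
proof -
  have "(\<lambda>s. s * h_over_s n s) holomorphic_on S" by (intro holomorphic_intros h_over_s_hol)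
  then show ?thesis by (rule holomorphic_transform) (simp add: h_eq_mult)
qed

lemma h_cont: "continuous_on S (h n)" using h_hol holomorphic_on_imp_continuous_on by blast

lemma h_0: "h n 0 = 0" by (simp add: h_eq_mult)

lemma h_1: "h (Suc 0) s = \<mu> ^ 3 * s * (3 - s\<^sup>2) / 2"
  by (simp add: h_eq_mult power2_eq_square power3_eq_cube field_simps)

text \<open>
The degree triples in each step. The leading coefficient in the first step is
\<open>\<mu>^3 - 3/2 \<mu>^3 = - \<mu>^3 / 2\<close>, since there the quadratic term contributes; afterwards it is cubed.
\<close>
lemma h_asymp: "\<exists>C. asymp_monomial (3 ^ Suc n) C (h (Suc n))"
proof (induction n)
  case 0
  have "((\<lambda>s. \<mu> ^ 3 * (3 * (inverse s)\<^sup>2 - 1) / 2) \<longlongrightarrow> \<mu> ^ 3 * (3 * 0\<^sup>2 - 1) / 2) at_infinity"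
    by (intro tendsto_intros tendsto_inverse_0) auto
  moreover have "\<forall>\<^sub>F s in at_infinity. \<mu> ^ 3 * (3 * (inverse s)\<^sup>2 - 1) / 2 = h (Suc 0) s / s ^ 3"
    unfolding eventually_at_infinity
  proof (intro exI[of _ 1] allI impI)
    fix s :: complex assume "1 \<le> norm s"
    then have "s \<noteq> 0" by auto
    then show "\<mu> ^ 3 * (3 * (inverse s)\<^sup>2 - 1) / 2 = h (Suc 0) s / s ^ 3"
      by (simp add: h_1 field_simps power2_eq_square power3_eq_cube)
  qed
  ultimately have "((\<lambda>s. h (Suc 0) s / s ^ 3) \<longlongrightarrow> \<mu> ^ 3 * (3 * 0\<^sup>2 - 1) / 2) at_infinity" by (rule Lim_transform_eventually)
  then have "((\<lambda>s. h (Suc 0) s / s ^ 3) \<longlongrightarrow> - (\<mu> ^ 3 / 2)) at_infinity" by simp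
  then show ?case using \<mu>_nz h_hol by (intro exI[of _ "- (\<mu> ^ 3 / 2)"]) (simp add: asymp_monomial_def)
next
  case (Suc n)
  then obtain C where C: "asymp_monomial (3 ^ Suc n) C (h (Suc n))" by blast
  define N where "N = (3::nat) ^ Suc n"
  have N: "N \<ge> 2" unfolding N_def power_Suc using one_le_power[of "3::nat" n] by linarith
  have lim: "((\<lambda>s. h (Suc n) s / s ^ N) \<longlongrightarrow> C) at_infinity" using C by (simp add: asymp_monomial_def N_def)
  have "((\<lambda>s. (h (Suc n) s / s ^ N) ^ 3 - 3 / 2 * \<mu> * (inverse s ^ (N - 1) + inverse s ^ (N + 1)) * (h (Suc n) s / s ^ N)\<^sup>2
        + 3 * \<mu>\<^sup>2 * inverse s ^ (2 * N) * (h (Suc n) s / s ^ N))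
      \<longlongrightarrow> C ^ 3 - 3 / 2 * \<mu> * (0 ^ (N - 1) + 0 ^ (N + 1)) * C\<^sup>2 + 3 * \<mu>\<^sup>2 * 0 ^ (2 * N) * C) at_infinity"
    by (intro tendsto_intros lim tendsto_inverse_0)
  moreover have "\<forall>\<^sub>F s in at_infinity. (h (Suc n) s / s ^ N) ^ 3 - 3 / 2 * \<mu> * (inverse s ^ (N - 1) + inverse s ^ (N + 1)) * (h (Suc n) s / s ^ N)\<^sup>2
        + 3 * \<mu>\<^sup>2 * inverse s ^ (2 * N) * (h (Suc n) s / s ^ N) = h (Suc (Suc n)) s / s ^ (3 * N)"
    unfolding eventually_at_infinity
  proof (intro exI[of _ 1] allI impI)
    fix s :: complex assume "1 \<le> norm s"
    then have s: "s \<noteq> 0" by auto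
    define H where "H = h (Suc n) s"
    define T where "T = s ^ N"
    have T: "T \<noteq> 0" using s by (simp add: T_def)
    have i1: "inverse s ^ (N - 1) = s / T" "inverse s ^ (N + 1) = inverse s / T" "inverse s ^ (2 * N) = 1 / T\<^sup>2" "s ^ (3 * N) = T ^ 3"
      using s N by (auto simp: T_def power_diff power_inverse field_simps power_mult mult.commute[of _ N])
    have "h (Suc (Suc n)) s = H ^ 3 - 3 / 2 * \<mu> * (s + inverse s) * H\<^sup>2 + 3 * \<mu>\<^sup>2 * H"
      unfolding h_Suc[of "Suc n"] cub_def a_def H_def ..
    then show "(h (Suc n) s / s ^ N) ^ 3 - 3 / 2 * \<mu> * (inverse s ^ (N - 1) + inverse s ^ (N + 1)) * (h (Suc n) s / s ^ N)\<^sup>2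
        + 3 * \<mu>\<^sup>2 * inverse s ^ (2 * N) * (h (Suc n) s / s ^ N) = h (Suc (Suc n)) s / s ^ (3 * N)"
    proof -
      have "(H / T) ^ 3 - 3 / 2 * \<mu> * (s / T + j / T) * (H / T)\<^sup>2 + 3 * \<mu>\<^sup>2 * (1 / T\<^sup>2) * (H / T)
          = (H ^ 3 - 3 / 2 * \<mu> * (s + j) * H\<^sup>2 + 3 * \<mu>\<^sup>2 * H) / T ^ 3" for j
        using T by (simp add: field_simps power2_eq_square power3_eq_cube)
      then show ?thesis unfolding i1 T_def[symmetric] H_def[symmetric] \<open>h (Suc (Suc n)) s = _\<close> by blast
    qed
  qed
  ultimately have "((\<lambda>s. h (Suc (Suc n)) s / s ^ (3 * N)) \<longlongrightarrow> C ^ 3 - 3 / 2 * \<mu> * (0 ^ (N - 1) + 0 ^ (N + 1)) * C\<^sup>2 + 3 * \<mu>\<^sup>2 * 0 ^ (2 * N) * C) at_infinity"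
    by (rule Lim_transform_eventually)
  then have "((\<lambda>s. h (Suc (Suc n)) s / s ^ (3 * N)) \<longlongrightarrow> C ^ 3) at_infinity" using N by (simp add: zero_power)
  moreover have "3 * N = 3 ^ Suc (Suc n)" by (simp add: N_def)
  ultimately show ?case using C h_hol by (intro exI[of _ "C ^ 3"]) (simp add: asymp_monomial_def)
qed

lemma norm_a_le: "norm (a s) \<le> 9/10 * (norm s + inverse (norm s))"
proof -
  have "norm (a s) = 3/2 * norm \<mu> * norm (s + inverse s)" by (simp add: a_def norm_mult)
  also have "\<dots> \<le> 3/2 * (3/5) * (norm s + norm (inverse s))"
    using \<mu>_bounds norm_triangle_ineq[of s "inverse s"] by (intro mult_mono) auto
  finally show ?thesis by (simp add: norm_inverse)
qed

lemma rad_le_20: "1/10 \<le> norm s \<Longrightarrow> norm s \<le> 10 \<Longrightarrow> rad s \<le> 20"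
proof -
  assume s: "1/10 \<le> norm s" "norm s \<le> 10"
  have "inverse (norm s) \<le> inverse (1/10)" using s by (intro le_imp_inverse_le) auto
  then show "rad s \<le> 20" using norm_a_le[of s] s unfolding rad_def by simp
qed

lemma rad_le_h_1: "10 \<le> norm s \<Longrightarrow> rad s \<le> norm (h (Suc 0) s)"
proof -
  assume s: "10 \<le> norm s"
  have "inverse (norm s) \<le> inverse 10" using s by (intro le_imp_inverse_le) auto
  then have 1: "rad s \<le> norm s + 3" using norm_a_le[of s] s unfolding rad_def by simp
  have "norm \<mu> ^ 3 = norm \<mu> * (norm \<mu>)\<^sup>2" by (simp add: power2_eq_square power3_eq_cube)
  also have "\<dots> = norm \<mu> / 3" using \<mu> by simp
  finally have m: "1/6 \<le> norm \<mu> ^ 3" using \<mu>_bounds by simp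
  have "10 * 10 \<le> norm s * norm s" using s by (intro mult_mono) auto
  moreover have "norm (s\<^sup>2) = norm s * norm s" "norm (3::complex) = 3" by (simp_all add: norm_mult power2_eq_square)
  ultimately have "97 \<le> norm (s\<^sup>2) - norm (3::complex)" by linarith
  also have "\<dots> \<le> norm (3 - s\<^sup>2)" using norm_triangle_ineq2[of "s\<^sup>2" 3] by (simp add: norm_minus_commute)
  finally have q: "97 \<le> norm (3 - s\<^sup>2)" .
  have "1/6 * norm s * 97 / 2 \<le> norm \<mu> ^ 3 * norm s * norm (3 - s\<^sup>2) / 2"
    using m q by (intro divide_right_mono mult_mono) auto
  also have "\<dots> = norm (h (Suc 0) s)" by (simp add: h_1 norm_mult norm_divide norm_power)
  finally show ?thesis using 1 s by simp
qed

lemma escape_in_E: "s \<noteq> 0 \<Longrightarrow> rad s \<le> norm (h n s) \<Longrightarrow> s \<in> E"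
  using filled_iff[of "\<mu> * s" s] by (auto simp: E_def h_def not_less[symmetric])

lemma large_in_E: "10 \<le> norm s \<Longrightarrow> s \<in> E"
  using escape_in_E[of s "Suc 0"] rad_le_h_1 by fastforce

lemma h_mono: "rad s \<le> norm (h m s) \<Longrightarrow> m \<le> n \<Longrightarrow> norm (h m s) \<le> norm (h n s)"
  using iter_mono'[of s m "\<mu> * s" n] by (simp add: h_def)

text \<open>
The reciprocals of the parameters on the circle \<open>|s| = 1/10\<close> belong to \<open>E\<close>, so on the circle
the orbit stays within \<open>rad s \<le> 20\<close>; inside the circle one applies the maximum principle to
the polynomial \<open>h n\<close>. The radius \<open>rad s\<close> itself is unbounded there.
\<close>
lemma h_small: "norm s \<le> 1/10 \<Longrightarrow> norm (h n s) \<le> 20"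
proof -
  assume s: "norm s \<le> 1/10"
  have bd: "norm (h n z) \<le> 20" if z: "norm z = 1/10" for z
  proof -
    have "norm (inverse z) = 10" unfolding norm_inverse z by simp
    then have "inverse z \<in> E" by (intro large_in_E) simp
    then have "z \<notin> E" using E_inverse_disjoint[of "inverse z"] by simp
    moreover have "z \<noteq> 0" using z by auto
    ultimately have "norm (h n z) < rad z" using escape_in_E[of z n] by fastforce
    moreover have "rad z \<le> 20" using z by (intro rad_le_20) auto
    ultimately show ?thesis by simp
  qed
  show "norm (h n s) \<le> 20"
  proof (cases "norm s = 1/10")
    case False
    show ?thesis
      by (rule maximum_modulus_frontier[where S = "ball 0 (1/10)" and f = "h n"])
         (use h_hol h_cont bd s False in auto)
  qed (use bd in simp)
qed

text \<open>
These sets exhaust \<open>E\<close>. The level \<open>20\<close> bounds \<open>rad s\<close> on the annulus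
\<open>1/10 \<le> |s| \<le> 10\<close>; beyond it \<open>h 1\<close> already exceeds \<open>rad s\<close>.
\<close>
definition P :: "nat \<Rightarrow> complex set" where "P n = {s. 20 < norm (h n s)}"

lemma P_facts:
  assumes "s \<in> P (Suc n)"
  shows P_nz: "s \<noteq> 0" and P_rad: "rad s \<le> norm (h (Suc n) s)" and P_E: "s \<in> E"
proof -
  have s: "20 < norm (h (Suc n) s)" using assms by (simp add: P_def)
  then have "1/10 < norm s" using h_small[of s "Suc n"] by linarith
  then show s0: "s \<noteq> 0" by auto
  show r: "rad s \<le> norm (h (Suc n) s)"
  proof (cases "norm s \<le> 10")
    case True
    then show ?thesis using rad_le_20[of s] s \<open>1/10 < norm s\<close> by simp
  next
    case False
    then have "rad s \<le> norm (h (Suc 0) s)" by (intro rad_le_h_1) auto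
    then show ?thesis using h_mono[of s "Suc 0" "Suc n"] by simp
  qed
  show "s \<in> E" using escape_in_E s0 r by blast
qed

lemma P_mono: "m \<le> n \<Longrightarrow> P (Suc m) \<subseteq> P (Suc n)"
proof
  fix s assume "m \<le> n" "s \<in> P (Suc m)"
  then show "s \<in> P (Suc n)" using h_mono[OF P_rad, of s m "Suc n"] by (simp add: P_def)
qed

lemma E_eq_Union_P: "E = (\<Union>n. P (Suc n))"
proof (intro equalityI subsetI)
  fix s assume s: "s \<in> E"
  then obtain m where "rad s \<le> norm (h m s)" using not_filledE[of "\<mu> * s" s] by (auto simp: E_def h_def)
  then obtain k where "\<forall>n\<ge>k. 21 \<le> norm (h n s)" using escape_unbounded[of s m "\<mu> * s" 21] by (auto simp: h_def)
  then have "21 \<le> norm (h (Suc k) s)" by simp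
  then have "s \<in> P (Suc k)" by (simp add: P_def)
  then show "s \<in> (\<Union>n. P (Suc n))" by blast
qed (use P_E in blast)

text \<open>
The cocritical point: the other preimage of the critical value \<open>cub s (\<mu> s)\<close>.
\<close>
definition e :: "complex \<Rightarrow> complex" where "e s = \<mu> * (3 * inverse s - s) / 2"

lemma cub_e: "s \<noteq> 0 \<Longrightarrow> cub s (e s) = cub s (\<mu> * s)"
  unfolding cub_def a_def e_def by (simp add: field_simps power2_eq_square power3_eq_cube)

lemma iter_e: "s \<noteq> 0 \<Longrightarrow> (cub s ^^ Suc n) (e s) = h (Suc n) s"
  by (simp add: h_def cub_e funpow_swap1)

lemma iter_joint_cont: "continuous_on ((- {0}) \<times> UNIV) (\<lambda>y. (cub (fst y) ^^ n) (snd y))"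
proof (induction n)
  case 0
  show ?case by (simp add: continuous_on_snd)
next
  case (Suc n)
  then show ?case unfolding funpow.simps o_def cub_def[of _ "(cub _ ^^ n) _"] a_def
    by (intro continuous_intros) auto
qed

lemma deriv_iter_joint_cont: "continuous_on ((- {0}) \<times> UNIV) (\<lambda>y. deriv (cub (fst y) ^^ n) (snd y))"
  unfolding deriv_iter deriv_cub a_def using iter_joint_cont by (intro continuous_intros) auto

lemma periodic_bounded: "(cub s ^^ Suc i) w = w \<Longrightarrow> w \<in> filled_julia (cub s)"
proof (rule ccontr)
  assume w: "(cub s ^^ Suc i) w = w" "w \<notin> filled_julia (cub s)"
  have per: "(cub s ^^ (Suc i * k)) w = w" for k
  proof (induction k)
    case (Suc k)
    have "(cub s ^^ (Suc i * Suc k)) w = (cub s ^^ Suc i) ((cub s ^^ (Suc i * k)) w)"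
      by (simp only: mult_Suc_right funpow_add o_apply)
    then show ?case using Suc w by simp
  qed simp
  obtain m where "rad s \<le> norm ((cub s ^^ m) w)" using not_filledE[OF w(2)] by blast
  then obtain k where "\<forall>n\<ge>k. norm w + 1 \<le> norm ((cub s ^^ n) w)" using escape_unbounded by blast
  moreover have "k \<le> Suc i * k" by simp
  ultimately have "norm w + 1 \<le> norm ((cub s ^^ (Suc i * k)) w)" by blast
  then show False using per by simp
qed

lemma h_not_filled: "s \<in> P (Suc n) \<Longrightarrow> h (Suc n) s \<notin> filled_julia (cub s)"
  using P_rad[of s n] filled_bound[of "h (Suc n) s" s] by fastforce

text \<open>
The orbit of the cocritical point meets neither critical point: \<open>\<mu> / s\<close> has a bounded orbit, and
\<open>\<mu> s\<close> would be periodic, or equal to the cocritical point, which forces \<open>s^2 = 1\<close> and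
makes the critical points coincide.
\<close>
lemma deriv_iter_e_nz: 
  assumes s: "s \<in> P (Suc n)" shows "deriv (cub s ^^ Suc n) (e s) \<noteq> 0"
proof
  assume "deriv (cub s ^^ Suc n) (e s) = 0"
  then obtain i where i: "i < Suc n" "deriv (cub s) ((cub s ^^ i) (e s)) = 0"
    unfolding deriv_iter_zero_iff by blast
  have s0: "s \<noteq> 0" and sE: "s \<in> E" using P_nz[OF s] P_E[OF s] by auto
  have c1: "\<mu> * s \<notin> filled_julia (cub s)" using sE by (simp add: E_def)
  consider "(cub s ^^ i) (e s) = \<mu> * s" | "(cub s ^^ i) (e s) = \<mu> * inverse s" using i cub_crit[OF s0] by blast
  then show False
  proof cases
    case 2
    then have "(cub s ^^ i) (e s) \<in> filled_julia (cub s)" using other_critical_bounded[OF sE] by simp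
    then have "(cub s ^^ (Suc n - i)) ((cub s ^^ i) (e s)) \<in> filled_julia (cub s)" by (rule iter_in_filled)
    then have "(cub s ^^ Suc n) (e s) \<in> filled_julia (cub s)" using i iter_add[where m = "Suc n - i" and n = i and z = "e s" and s = s] by simp
    then show False using h_not_filled[OF s] iter_e[OF s0] by simp
  next
    case 1
    show False
    proof (cases i)
      case 0
      then have "\<mu> * (3 * inverse s - s) / 2 = \<mu> * s" using 1 by (simp add: e_def)
      then have "\<mu> * (3 * inverse s - s) = \<mu> * (2 * s)" by (simp add: field_simps)
      then have "3 * inverse s - s = 2 * s" using \<mu>_nz by (metis mult_left_cancel)
      then have "inverse s = s" by simp
      then show False using other_critical_bounded[OF sE] c1 by simp
    next
      case (Suc j)
      then have "(cub s ^^ Suc j) (\<mu> * s) = \<mu> * s" using 1 iter_e[OF s0, of j] by (simp add: h_def)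
      then show False using periodic_bounded c1 by blast
    qed
  qed
qed

text \<open>
The critical values of the iterate are \<open>h 1 s\<close>, ..., \<open>h (n+1) s\<close>, whose moduli are at most the last
one because it is beyond the escape radius, and points of the bounded orbit of \<open>\<mu> / s\<close>.
\<close>
lemma sublevel_connected_at_e:
  assumes s: "s \<in> P (Suc n)" and t: "norm (h (Suc n) s) < t"
  shows "connected {z. norm ((cub s ^^ Suc n) z) < t}"
proof (rule sublevel_connected_of_critical_values[OF iter_asymp norm_ge_zero t])
  fix z assume "deriv (cub s ^^ Suc n) z = 0"
  then obtain i where i: "i < Suc n" "deriv (cub s) ((cub s ^^ i) z) = 0"
    unfolding deriv_iter_zero_iff by blast
  have s0: "s \<noteq> 0" and sE: "s \<in> E" using P_nz[OF s] P_E[OF s] by auto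
  have eq: "(cub s ^^ Suc n) z = (cub s ^^ (Suc n - i)) ((cub s ^^ i) z)" using i iter_add[where m = "Suc n - i" and n = i and z = z and s = s] by simp
  consider "(cub s ^^ i) z = \<mu> * s" | "(cub s ^^ i) z = \<mu> * inverse s" using i cub_crit[OF s0] by blast
  then show "norm ((cub s ^^ Suc n) z) \<le> norm (h (Suc n) s)"
  proof cases
    case 1
    then have e1: "(cub s ^^ Suc n) z = h (Suc n - i) s" using eq by (simp add: h_def)
    show ?thesis
    proof (cases "rad s \<le> norm (h (Suc n - i) s)")
      case True
      then show ?thesis unfolding e1 by (intro h_mono) auto
    next
      case False
      then show ?thesis unfolding e1 using P_rad[OF s] by simp
    qed
  next
    case 2
    then have "(cub s ^^ Suc n) z \<in> filled_julia (cub s)"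
      unfolding eq using other_critical_bounded[OF sE] by (simp add: iter_in_filled)
    then show ?thesis using filled_bound P_rad[OF s] by (meson less_imp_le order_trans)
  qed
qed

lemma P_open: "open (P n)" unfolding P_def by (intro open_Collect_less continuous_intros h_cont)

lemma P_nonempty: "P (Suc n) \<noteq> {}"
proof -
  obtain C where C: "asymp_monomial (3 ^ Suc n) C (h (Suc n))" using h_asymp by blast
  obtain B where "\<And>z. B \<le> norm z \<Longrightarrow> norm (h (Suc n) z) > 20" using asymp_monomial_escape[OF C] by metis
  then have "complex_of_real \<bar>B\<bar> \<in> P (Suc n)" by (simp add: P_def)
  then show ?thesis by blast
qed

lemma root_family_cub: "root_family (P (Suc n)) (3 ^ Suc n) (\<lambda>s. cub s ^^ Suc n) e"
proof (rule root_family.intro)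
  have sub: "P (Suc n) \<times> UNIV \<subseteq> (- {0}) \<times> (UNIV::complex set)" using P_nz by auto
  show "continuous_on (P (Suc n) \<times> UNIV) (\<lambda>(s, z). (cub s ^^ Suc n) z)"
    using continuous_on_subset[OF iter_joint_cont sub] by (simp only: case_prod_unfold)
  show "continuous_on (P (Suc n) \<times> UNIV) (\<lambda>(s, z). deriv (cub s ^^ Suc n) z)"
    using continuous_on_subset[OF deriv_iter_joint_cont sub] by (simp only: case_prod_unfold)
  show "continuous_on (P (Suc n)) e" unfolding e_def using P_nz by (intro continuous_intros) auto
  show "asymp_monomial (3 ^ Suc n) 1 (cub s ^^ Suc n)" for s by (rule iter_asymp)
  show "(cub s ^^ Suc n) 0 = 0" for s by (rule iter_0)
  show "(cub s ^^ Suc n) (e s) \<noteq> 0" if s: "s \<in> P (Suc n)" for s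
    unfolding iter_e[OF P_nz[OF s]] using s by (auto simp: P_def)
  show "deriv (cub s ^^ Suc n) (e s) \<noteq> 0" if s: "s \<in> P (Suc n)" for s by (rule deriv_iter_e_nz[OF s])
  show "connected {z. norm ((cub s ^^ Suc n) z) < t}"
    if s: "s \<in> P (Suc n)" and t: "norm ((cub s ^^ Suc n) (e s)) < t" for s t
    by (rule sublevel_connected_at_e[OF s]) (use t iter_e[OF P_nz[OF s]] in simp)
qed (rule P_open P_nonempty)+

text \<open>
The boundary root at the cocritical point is a root of order \<open>3^(n+1)\<close> of the critical orbit
\<open>h (n+1)\<close>, as a function of the parameter. It approximates the map to \<open>\<complex> - cball 0 1\<close>
given by the Boettcher coordinate of the cocritical point.
\<close>
lemma simply_connected_chart_P: "simply_connected (outer_chart (h (Suc n)) 20)"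
proof -
  interpret root_family "P (Suc n)" "3 ^ Suc n" "\<lambda>s. cub s ^^ Suc n" e by (rule root_family_cub)
  obtain C where C: "asymp_monomial (3 ^ Suc n) C (h (Suc n))" using h_asymp by blast
  have y: "continuous_on {s. 20 < norm (h (Suc n) s)} boundary_root"
    using boundary_root_continuous by (simp add: P_def)
  have yp: "boundary_root s ^ (3 ^ Suc n) = h (Suc n) s" if "20 < norm (h (Suc n) s)" for s
  proof -
    have s: "s \<in> P (Suc n)" using that by (simp add: P_def)
    show ?thesis using boundary_root_pow[OF s] unfolding iter_e[OF P_nz[OF s]] .
  qed
  interpret S: superlevel "3 ^ Suc n" C "h (Suc n)" 20 by (rule superlevel.intro[OF C h_0]) simp
  interpret T: superlevel_root "3 ^ Suc n" C "h (Suc n)" 20 boundary_root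
    by (rule superlevel_root.intro[OF S.superlevel_axioms superlevel_root_axioms.intro[OF y yp]])
  show ?thesis by (rule T.simply_connected_outer_chart_of_root)
qed

lemma open_chart_P: "open (outer_chart (h (Suc n)) 20)"
proof -
  obtain C where C: "asymp_monomial (3 ^ Suc n) C (h (Suc n))" using h_asymp by blast
  interpret S: superlevel "3 ^ Suc n" C "h (Suc n)" 20 by (rule superlevel.intro[OF C h_0]) simp
  show ?thesis by (rule S.open_outer_chart)
qed

text \<open>
\<open>E\<close> with the point at infinity, in the coordinate \<open>1 / s\<close>. Read in the coordinate
\<open>s\<close>, it is the interior component together with the puncture \<open>0\<close>.
\<close>
definition D :: "complex set" where "D = insert 0 {u. u \<noteq> 0 \<and> inverse u \<in> E}"

lemma D_eq: "D = (\<Union>n. outer_chart (h (Suc n)) 20)"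
  by (auto simp: D_def outer_chart_def E_eq_Union_P P_def)

lemma chart_mono: "m \<le> n \<Longrightarrow> outer_chart (h (Suc m)) 20 \<subseteq> outer_chart (h (Suc n)) 20"
  using P_mono[of m n] by (auto simp: outer_chart_def P_def)

theorem open_D: "open D" unfolding D_eq using open_chart_P by blast

text \<open>
A loop is compact, so it lies in one member of the increasing union of simply connected charts.
\<close>
theorem simply_connected_D: "simply_connected D"
  unfolding simply_connected_eq_winding_number_zero[OF open_D]
proof (intro conjI allI impI)
  show "connected D" unfolding D_eq
    by (rule connected_Union) (use simply_connected_imp_connected[OF simply_connected_chart_P] in \<open>auto simp: outer_chart_def\<close>)
next
  fix \<gamma> z assume *: "path \<gamma> \<and> path_image \<gamma> \<subseteq> D \<and> pathfinish \<gamma> = pathstart \<gamma> \<and> z \<notin> D"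
  then have "compact (path_image \<gamma>)" "path_image \<gamma> \<subseteq> (\<Union>n\<in>UNIV. outer_chart (h (Suc n)) 20)"
    by (auto simp: compact_path_image D_eq)
  then obtain F where F: "finite F" "path_image \<gamma> \<subseteq> (\<Union>n\<in>F. outer_chart (h (Suc n)) 20)"
    using compactE_image[of "path_image \<gamma>" UNIV "\<lambda>n. outer_chart (h (Suc n)) 20"] open_chart_P by metis
  define m where "m = Max (insert 0 F)"
  have "n \<le> m" if "n \<in> F" for n using F(1) that by (simp add: m_def)
  then have "path_image \<gamma> \<subseteq> outer_chart (h (Suc m)) 20" using F(2) chart_mono by blast
  moreover have "z \<notin> outer_chart (h (Suc m)) 20" using * by (auto simp: D_eq)
  ultimately show "winding_number \<gamma> z = 0"
    using simply_connected_imp_winding_number_zero[OF simply_connected_chart_P] * by blast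
qed

end

section \<open>The topology of the parameter plane\<close>

context cubic_family
begin

lemma zero_in_D: "0 \<in> D" by (simp add: D_def)

lemma inverse_D: "inverse ` (D - {0}) = E"
proof (intro equalityI subsetI)
  fix s assume "s \<in> E"
  then show "s \<in> inverse ` (D - {0})"
    by (intro image_eqI[of _ _ "inverse s"]) (auto simp: D_def E_def)
qed (auto simp: D_def)

lemma D_bounded_by: "u \<in> D \<Longrightarrow> norm u < 10"
proof (rule ccontr)
  assume u: "u \<in> D" "\<not> norm u < 10"
  then have "u \<in> E" "u \<noteq> 0" using large_in_E[of u] by auto
  then show False using u E_inverse_disjoint[of u] by (auto simp: D_def)
qed

lemma bounded_D: "bounded D" using D_bounded_by by (meson bounded_iff less_imp_le)

lemma connected_D: "connected D" using simply_connected_D simply_connected_imp_connected by blast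

lemma connected_inverse_image: "connected S \<Longrightarrow> 0 \<notin> S \<Longrightarrow> connected (inverse ` S)" for S :: "complex set"
  by (rule connected_continuous_image) (auto intro!: continuous_intros)

lemma connected_E: "connected E"
  using connected_inverse_image[of "D - {0}"] connected_open_delete[OF open_D connected_D, of 0] inverse_D by simp

lemma open_E: "open E"
proof -
  have "open (- {0} \<inter> inverse -` D)"
    using open_D by (intro continuous_open_preimage continuous_intros) auto
  moreover have "- {0} \<inter> inverse -` D = E" by (auto simp: D_def E_def)
  ultimately show ?thesis by simp
qed

lemma E_homeomorphic: "E homeomorphic (- cball (0::complex) 1)"
proof -
  have "D \<noteq> UNIV" using bounded_D by auto
  then obtain \<psi> g where \<psi>: "\<psi> holomorphic_on D" "g holomorphic_on ball (0::complex) 1" "\<psi> 0 = 0"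
    "\<And>z. z \<in> D \<Longrightarrow> \<psi> z \<in> ball 0 1" "\<And>z. z \<in> D \<Longrightarrow> g (\<psi> z) = z"
    "\<And>w. w \<in> ball 0 1 \<Longrightarrow> g w \<in> D" "\<And>w. w \<in> ball 0 1 \<Longrightarrow> \<psi> (g w) = w"
    using Riemann_map_normalized[OF open_D simply_connected_D _ zero_in_D] by metis
  have g0: "g 0 = 0" using \<psi>(5)[OF zero_in_D] \<psi>(3) by simp
  have \<psi>nz: "\<psi> u \<noteq> 0" if "u \<in> D" "u \<noteq> 0" for u using \<psi>(5)[OF that(1)] that g0 by metis
  have gnz: "g w \<noteq> 0" if "w \<in> ball 0 1" "w \<noteq> 0" for w using \<psi>(7)[OF that(1)] that \<psi>(3) by metis
  have ED: "inverse s \<in> D" "s \<noteq> 0" if "s \<in> E" for s using that by (auto simp: D_def E_def)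
  have inball: "inverse w \<in> ball (0::complex) 1" "w \<noteq> 0" if "w \<in> - cball (0::complex) 1" for w :: complex
  proof -
    have w: "1 < norm w" using that by simp
    then show "w \<noteq> 0" by auto
    then show "inverse w \<in> ball 0 1" using w by (simp add: norm_inverse inverse_less_1_iff)
  qed
  have "homeomorphism E (- cball 0 1) (\<lambda>s. inverse (\<psi> (inverse s))) (\<lambda>w. inverse (g (inverse w)))"
  proof (rule homeomorphismI)
    show "continuous_on E (\<lambda>s. inverse (\<psi> (inverse s)))"
      by (intro continuous_intros continuous_on_compose2[OF holomorphic_on_imp_continuous_on[OF \<psi>(1)]])
         (use ED \<psi>nz in auto)
    show "continuous_on (- cball 0 1) (\<lambda>w. inverse (g (inverse w)))"
      by (intro continuous_intros continuous_on_compose2[OF holomorphic_on_imp_continuous_on[OF \<psi>(2)]])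
         (use inball gnz in auto)
    show "(\<lambda>s. inverse (\<psi> (inverse s))) ` E \<subseteq> - cball 0 1"
    proof
      fix y assume "y \<in> (\<lambda>s. inverse (\<psi> (inverse s))) ` E"
      then obtain s where s: "s \<in> E" "y = inverse (\<psi> (inverse s))" by blast
      have "norm (\<psi> (inverse s)) < 1" "\<psi> (inverse s) \<noteq> 0" using \<psi>(4)[OF ED(1)] \<psi>nz ED s(1) by auto
      then have "1 < norm (inverse (\<psi> (inverse s)))" unfolding norm_inverse one_less_inverse_iff by simp
      then show "y \<in> - cball 0 1" using s by simp
    qed
    show "(\<lambda>w. inverse (g (inverse w))) ` (- cball 0 1) \<subseteq> E"
    proof
      fix y assume "y \<in> (\<lambda>w. inverse (g (inverse w))) ` (- cball 0 1)"
      then obtain w where w: "w \<in> - cball 0 1" "y = inverse (g (inverse w))" by blast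
      have "g (inverse w) \<in> D - {0}" using \<psi>(6)[OF inball(1)[OF w(1)]] gnz inball[OF w(1)] by auto
      then show "y \<in> E" using inverse_D w(2) by blast
    qed
    show "inverse (g (inverse (inverse (\<psi> (inverse s))))) = s" if "s \<in> E" for s
      using \<psi>(5)[OF ED(1)[OF that]] by simp
    show "inverse (\<psi> (inverse (inverse (g (inverse w))))) = w" if "w \<in> - cball 0 1" for w
      using \<psi>(7)[OF inball(1)[OF that]] by simp
  qed
  then show ?thesis by (auto simp: homeomorphic_def)
qed

lemma connected_Compl_D: "connected (- D)"
  using simply_connected_iff_simple[OF open_D bounded_D] simply_connected_D by simp

text \<open>
The reciprocal of the connected set \<open>- D\<close> is \<open>- E\<close> without \<open>0\<close>, and \<open>0\<close> is a limit of it.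
\<close>
lemma connected_Compl_E: "connected (- E)"
proof -
  have eq: "inverse ` (- D) = - E - {0}"
  proof (intro equalityI subsetI)
    fix s assume "s \<in> - E - {0}"
    then show "s \<in> inverse ` (- D)" by (intro image_eqI[of _ _ "inverse s"]) (auto simp: D_def)
  qed (auto simp: D_def)
  have "connected (- E - {0})"
    using connected_inverse_image[OF connected_Compl_D] zero_in_D unfolding eq by simp
  moreover have "- E - {0} \<subseteq> - E" by blast
  moreover have "- E \<subseteq> closure (- E - {0})"
  proof
    fix z assume z: "z \<in> - E"
    show "z \<in> closure (- E - {0})"
    proof (cases "z = 0")
      case True
      have "\<exists>y\<in>- E - {0}. dist y 0 < \<epsilon>" if \<epsilon>: "\<epsilon> > 0" for \<epsilon>
      proof -
        define y where "y = complex_of_real (min (\<epsilon> / 2) (1/10))"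
        have y: "norm y = min (\<epsilon> / 2) (1/10)" "norm y > 0" using \<epsilon> by (auto simp: y_def)
        have "10 * norm y \<le> 1" using y(1) by linarith
        then have "norm y \<le> inverse 10" by simp
        then have "10 \<le> norm (inverse y)" using y(2) le_imp_inverse_le[of "norm y" "inverse 10"] by (simp add: norm_inverse)
        then have "inverse y \<in> E" by (rule large_in_E)
        then have "y \<notin> E" using E_inverse_disjoint[of "inverse y"] by simp
        moreover have "y \<noteq> 0" "norm y < \<epsilon>" using y \<epsilon> by (auto simp: min_def)
        ultimately show ?thesis by (intro bexI[of _ y]) auto
      qed
      then show ?thesis using True by (simp add: closure_approachable)
    next
      case False
      then have "z \<in> - E - {0}" using z by simp
      then show ?thesis by (rule subsetD[OF closure_subset])
    qed
  qed
  ultimately show ?thesis by (rule connected_intermediate_closure)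
qed

text \<open>
\<open>D\<close> and \<open>E\<close> are disjoint, so their complements are closed connected sets which cover the plane;
by unicoherence their intersection is connected.
\<close>
theorem connected_core: "connected (- E - D)"
proof -
  have "connected ((- D) \<inter> (- E))"
  proof (rule unicoherentD[OF unicoherent_UNIV connected_Compl_D connected_Compl_E])
    show "UNIV = - D \<union> - E"
      using E_inverse_disjoint by (auto simp: D_def E_def)
    show "closedin (top_of_set UNIV) (- D)" "closedin (top_of_set UNIV) (- E)"
      using open_D open_E by (auto simp: closed_Compl)
  qed
  moreover have "- D \<inter> - E = - E - D" by blast
  ultimately show ?thesis by simp
qed

end

lemma filled_julia_scale:
  assumes k: "k \<noteq> 0" and eq: "\<And>z. k * P z = f (k * z)"
  shows "filled_julia f = (\<lambda>z. k * z) ` filled_julia P"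
proof -
  have iter: "(f ^^ n) (k * z) = k * (P ^^ n) z" for n z by (induction n) (auto simp: eq)
  have "k * z \<in> filled_julia f \<longleftrightarrow> z \<in> filled_julia P" for z
  proof -
    have "bounded (range (\<lambda>n. k * (P ^^ n) z)) \<longleftrightarrow> bounded (range (\<lambda>n. (P ^^ n) z))"
    proof
      assume "bounded (range (\<lambda>n. (P ^^ n) z))"
      then show "bounded (range (\<lambda>n. k * (P ^^ n) z))"
        using bounded_linear_image[OF _ bounded_linear_mult_right[of k]] by (fastforce simp: image_image)
    next
      assume "bounded (range (\<lambda>n. k * (P ^^ n) z))"
      then have "bounded ((*) (inverse k) ` range (\<lambda>n. k * (P ^^ n) z))"
        by (rule bounded_linear_image[OF _ bounded_linear_mult_right])
      then show "bounded (range (\<lambda>n. (P ^^ n) z))" using k by (simp add: image_image field_simps)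
    qed
    then show ?thesis by (simp add: filled_julia_def iter)
  qed
  note mem = this
  show ?thesis
  proof (intro equalityI subsetI)
    fix w assume "w \<in> filled_julia f"
    then have "w / k \<in> filled_julia P" using mem[of "w / k"] k by simp
    then show "w \<in> (\<lambda>z. k * z) ` filled_julia P" using k by (intro image_eqI[of _ _ "w / k"]) auto
  qed (use mem in blast)
qed

section \<open>The original family\<close>

lemma open_image_square: "open U \<Longrightarrow> open ((\<lambda>s::complex. s\<^sup>2) ` U)"
proof (rule open_mapping_thm[of _ UNIV])
  show "\<not> (\<lambda>s::complex. s\<^sup>2) constant_on UNIV"
  proof
    assume "(\<lambda>s::complex. s\<^sup>2) constant_on UNIV"
    then obtain c where "\<And>s::complex. s\<^sup>2 = c" by (auto simp: constant_on_def)
    from this[of 0] this[of 1] show False by simp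
  qed
qed (auto intro!: holomorphic_intros)

text \<open>
The link with the family in the parameter \<open>c\<close>: \<open>3 \<mu>^2\<close> is the multiplier at the fixed point.
\<close>
locale siegel_family = cubic_family +
  fixes \<theta> :: real
  assumes \<mu>_\<theta>: "3 * \<mu>\<^sup>2 = exp (2 * of_real pi * \<i> * of_real \<theta>)"
begin

lemma siegel_cubic_conj:
  assumes s: "s \<noteq> 0"
  shows "\<mu> / s * siegel_cubic \<theta> (s\<^sup>2) z = cub s (\<mu> / s * z)"
  unfolding siegel_cubic_def \<mu>_\<theta>[symmetric] cub_def a_def using s
  by (simp add: field_simps power2_eq_square power3_eq_cube)

lemma siegel_cubic_escaping:
  assumes s: "s \<noteq> 0"
  shows "escaping_map (siegel_cubic \<theta> (s\<^sup>2)) (rad s / norm (\<mu> / s))"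
proof
  define k where "k = \<mu> / s"
  have k: "norm k > 0" using s \<mu>_nz by (simp add: k_def)
  show "siegel_cubic \<theta> (s\<^sup>2) holomorphic_on UNIV"
    unfolding siegel_cubic_def by (intro holomorphic_intros) (use s in auto)
  show "0 < rad s / norm (\<mu> / s)" using rad_pos k by (simp add: k_def)
  fix z :: complex assume "rad s / norm (\<mu> / s) \<le> norm z"
  then have "rad s \<le> norm (k * z)" using k by (simp add: k_def[symmetric] norm_mult field_simps)
  then have "2 * norm (k * z) \<le> norm (cub s (k * z))" by (rule cub_grow)
  also have "cub s (k * z) = k * siegel_cubic \<theta> (s\<^sup>2) z" using siegel_cubic_conj[OF s] by (simp add: k_def)
  finally have "norm k * (2 * norm z) \<le> norm k * norm (siegel_cubic \<theta> (s\<^sup>2) z)" by (simp add: norm_mult)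
  then show "2 * norm z \<le> norm (siegel_cubic \<theta> (s\<^sup>2) z)" using k by simp
qed

lemma conn_locus_iff:
  assumes s: "s \<noteq> 0"
  shows "s\<^sup>2 \<in> conn_locus \<theta> \<longleftrightarrow> s \<in> - E - D"
proof -
  interpret S: escaping_map "siegel_cubic \<theta> (s\<^sup>2)" "rad s / norm (\<mu> / s)" by (rule siegel_cubic_escaping[OF s])
  define k where "k = \<mu> / s"
  have k: "k \<noteq> 0" using s \<mu>_nz by (simp add: k_def)
  have im: "filled_julia (cub s) = (\<lambda>z. k * z) ` filled_julia (siegel_cubic \<theta> (s\<^sup>2))"
    by (rule filled_julia_scale[OF k]) (use siegel_cubic_conj[OF s] in \<open>simp add: k_def\<close>)
  have im': "filled_julia (siegel_cubic \<theta> (s\<^sup>2)) = (\<lambda>z. inverse k * z) ` filled_julia (cub s)"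
    unfolding im image_image using k by (simp flip: mult.assoc)
  have "connected (filled_julia (siegel_cubic \<theta> (s\<^sup>2))) \<longleftrightarrow> connected (filled_julia (cub s))"
  proof
    assume "connected (filled_julia (cub s))"
    then show "connected (filled_julia (siegel_cubic \<theta> (s\<^sup>2)))" unfolding im'
      by (intro connected_continuous_image continuous_intros)
  next
    assume "connected (filled_julia (siegel_cubic \<theta> (s\<^sup>2)))"
    then show "connected (filled_julia (cub s))" unfolding im
      by (intro connected_continuous_image continuous_intros)
  qed
  then show ?thesis
    using s connected_filled_cub_iff[OF s] S.connected_julia_iff by (auto simp: conn_locus_def D_def)
qed

lemma conn_locus_hat_eq: "conn_locus_hat \<theta> = - E - D"
proof (rule set_eqI)
  fix s show "s \<in> conn_locus_hat \<theta> \<longleftrightarrow> s \<in> - E - D"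
    using conn_locus_iff[of s] zero_in_D by (cases "s = 0") (auto simp: conn_locus_hat_def)
qed

lemma conn_locus_eq: "conn_locus \<theta> = (\<lambda>s. s\<^sup>2) ` (- E - D)"
proof (intro equalityI subsetI)
  fix c assume c: "c \<in> conn_locus \<theta>"
  then have "csqrt c \<noteq> 0" by (auto simp: conn_locus_def)
  then have "csqrt c \<in> - E - D" using conn_locus_iff[of "csqrt c"] c by simp
  then show "c \<in> (\<lambda>s. s\<^sup>2) ` (- E - D)" by (intro image_eqI[of _ _ "csqrt c"]) auto
next
  fix c assume "c \<in> (\<lambda>s. s\<^sup>2) ` (- E - D)"
  then obtain s where s: "s \<in> - E - D" "c = s\<^sup>2" by blast
  then have "s \<noteq> 0" using zero_in_D by auto
  then show "c \<in> conn_locus \<theta>" using conn_locus_iff s by blast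
qed

lemma square_mem_E: "s\<^sup>2 \<in> (\<lambda>s. s\<^sup>2) ` E \<longleftrightarrow> s \<in> E"
proof
  assume "s\<^sup>2 \<in> (\<lambda>s. s\<^sup>2) ` E"
  then obtain t where "t \<in> E" "s\<^sup>2 = t\<^sup>2" by blast
  then show "s \<in> E" using E_minus[of t] by (auto simp: power2_eq_iff)
qed blast

text \<open>
Off the locus and the puncture the plane is the disjoint union of two open sets, the squares of
\<open>E\<close> and of \<open>D - {0}\<close>. The first is connected and unbounded, the second is bounded.
\<close>
lemma Omega_ext_eq: "Omega_ext \<theta> = (\<lambda>s. s\<^sup>2) ` E"
proof -
  define S where "S = insert 0 (conn_locus \<theta>)"
  define E2 where "E2 = (\<lambda>s. s\<^sup>2) ` E"
  define D2 where "D2 = (\<lambda>s. s\<^sup>2) ` (D - {0})"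
  have mem: "s\<^sup>2 \<in> D2 \<longleftrightarrow> s \<in> D - {0}" for s
  proof
    assume "s\<^sup>2 \<in> D2"
    then obtain t where t: "t \<in> D - {0}" "s\<^sup>2 = t\<^sup>2" by (auto simp: D2_def)
    then show "s \<in> D - {0}" using E_minus[of "inverse t"] by (auto simp: power2_eq_iff D_def)
  qed (auto simp: D2_def)
  have compl: "- S = E2 \<union> D2"
  proof (intro equalityI subsetI)
    fix c assume "c \<in> - S"
    then have c: "c \<noteq> 0" "(csqrt c)\<^sup>2 \<notin> conn_locus \<theta>" by (auto simp: S_def)
    then have "csqrt c \<in> E \<union> (D - {0})" using conn_locus_iff[of "csqrt c"] by auto
    then have "(csqrt c)\<^sup>2 \<in> E2 \<union> D2" unfolding E2_def D2_def by blast
    then show "c \<in> E2 \<union> D2" by simp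
  next
    fix c assume "c \<in> E2 \<union> D2"
    then obtain s where s: "s \<in> E \<union> (D - {0})" "c = s\<^sup>2" by (auto simp: E2_def D2_def)
    then have "s \<noteq> 0" by (auto simp: E_def)
    then show "c \<in> - S" using conn_locus_iff[of s] s by (auto simp: S_def)
  qed
  have disj: "E2 \<inter> D2 = {}"
    using mem E_inverse_disjoint by (auto simp: E2_def D_def)
  have open2: "open E2" "open D2"
    unfolding E2_def D2_def using open_E open_D by (auto intro: open_image_square)
  have conE: "connected E2" unfolding E2_def by (intro connected_continuous_image connected_E continuous_intros)
  have bdD: "bounded D2"
  proof -
    have "norm y \<le> 100" if y: "y \<in> D2" for y
    proof -
      obtain u where u: "u \<in> D" "y = u\<^sup>2" using y by (auto simp: D2_def)
      have "norm u ^ 2 \<le> 10 ^ 2" using D_bounded_by[OF u(1)] by (intro power_mono) auto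
      then show ?thesis using u by (simp add: norm_power)
    qed
    then show ?thesis by (auto simp: bounded_iff)
  qed
  have unbE: "\<not> bounded E2"
  proof
    assume "bounded E2"
    then obtain b where b: "\<And>y. y \<in> E2 \<Longrightarrow> norm y \<le> b" by (auto simp: bounded_iff)
    define s where "s = complex_of_real (10 + \<bar>b\<bar>)"
    have s: "norm s = 10 + \<bar>b\<bar>" by (simp add: s_def del: of_real_add)
    have "s \<in> E" using s by (intro large_in_E) simp
    then have "norm (s\<^sup>2) \<le> b" by (intro b) (auto simp: E2_def)
    moreover have "norm s \<le> (norm s)\<^sup>2" using s by (intro self_le_power) auto
    ultimately show False using s by (simp add: norm_power)
  qed
  have "outside S = E2"
  proof (intro equalityI subsetI)
    fix x assume x: "x \<in> E2"
    then have "E2 \<subseteq> connected_component_set (- S) x"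
      using conE compl by (intro connected_component_maximal) auto
    then have "\<not> bounded (connected_component_set (- S) x)" using unbE bounded_subset by blast
    moreover have "x \<notin> S" using x compl by blast
    ultimately show "x \<in> outside S" by (simp add: outside_def)
  next
    fix x assume x: "x \<in> outside S"
    then have xS: "x \<in> - S" and unb: "\<not> bounded (connected_component_set (- S) x)" by (auto simp: outside_def)
    show "x \<in> E2"
    proof (rule ccontr)
      assume "x \<notin> E2"
      then have xD: "x \<in> D2" using xS compl by blast
      let ?C = "connected_component_set (- S) x"
      have sub: "?C \<subseteq> E2 \<union> D2" using connected_component_subset[of "- S" x] compl by simp
      have "E2 \<inter> ?C = {} \<or> D2 \<inter> ?C = {}"
        using connectedD[OF connected_connected_component open2, of "- S" x] disj sub by blast
      moreover have "x \<in> D2 \<inter> ?C" using xD xS by simp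
      ultimately have "?C \<subseteq> D2" using sub by blast
      then show False using unb bdD bounded_subset by blast
    qed
  qed
  then show ?thesis by (simp add: Omega_ext_def S_def E2_def)
qed

lemma Omega_ext_hat_eq: "Omega_ext_hat \<theta> = E"
  unfolding Omega_ext_hat_def Omega_ext_eq square_mem_E by simp

end

theorem theorem6p1:
  fixes \<theta> :: real
  assumes "0 < \<theta>" and "\<theta> < 1" and "\<theta> \<notin> \<rat>" and "brjuno \<theta>"
  shows "Omega_ext_hat \<theta> homeomorphic (- cball (0 :: complex) 1) \<and>
         connected (conn_locus_hat \<theta>) \<and>
         connected (conn_locus \<theta>)"
proof -
  define l where "l = exp (2 * of_real pi * \<i> * of_real \<theta>)"
  have \<mu>2: "3 * (csqrt (l / 3))\<^sup>2 = l" by simp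
  have "norm l = 1" by (simp add: l_def)
  then have "3 * (norm (csqrt (l / 3)))\<^sup>2 = 1"
    using arg_cong[OF \<mu>2, of norm] by (simp add: norm_mult norm_power)
  then interpret siegel_family "csqrt (l / 3)" \<theta>
    by unfold_locales (use \<mu>2 in \<open>simp_all add: l_def\<close>)
  have "connected (conn_locus \<theta>)"
    unfolding conn_locus_eq by (intro connected_continuous_image connected_core continuous_intros)
  then show ?thesis
    using E_homeomorphic connected_core by (simp add: Omega_ext_hat_eq conn_locus_hat_eq)
qed

end
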